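(* Let $E\subseteq X^2$ be a countable Borel equivalence relation on a standard Borel space $X$ with a locally finite Borel graphing $G$. Suppose there exists a Borel assignment $X/E\ni C\mapsto \mathcal H(C)\subseteq 2^C$, to each component $C$, of a collection of sets of vertices $H\subseteq C$ with finite boundary such that both $H$ and $C\setminus H$ are connected, so that the following conditions hold for each $C$: (i) each vertex $x\in C$ lies on the boundary of only finitely many $H\in\mathcal H(C)$; (ii) each end of the graph $G|C$ has a neighborhood basis in $\mathcal H(C)$. Then $E$ is Borel treeable.
   Context: A countable Borel equivalence relation (CBER) is a Borel equivalence relation with countable classes. A graph is a symmetric irreflexive relation. A Borel graphing of $E$ is a Borel graph $G\subseteq X^2$ whose connectedness relation is exactly $E$; $E$ is Borel treeable if it has an acyclic Borel graphing. $G|C$ is the restriction of $G$ to a class $C$. For $H\subseteq C$, the inner vertex boundary $\partial_{\mathrm{iv}}H$ is the set of vertices in $H$ with a neighbor in $C\setminus H$, the outer vertex boundary is $\partial_{\mathrm{ov}}H=\partial_{\mathrm{iv}}(C\setminus H)$, and the boundary is $\partial_{\mathrm v}H=\partial_{\mathrm{iv}}H\cup\partial_{\mathrm{ov}}H$. Let $\mathcal H_{\mathrm{fin}}(C)$ be the Boolean algebra of all $H\subseteq C$ with finite boundary. An end of $G|C$ is an ultrafilter $U$ on $\mathcal H_{\mathrm{fin}}(C)$ which is not of the form $\{H: x\in H\}$ for some $x\in C$. Condition (ii) means: for each end $U$ and each $A\in U$ there is $H\in\mathcal H(C)$ with $H\in U$ and $H\subseteq A$ (neighborhoods being taken in the Stone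 space of $\mathcal H_{\mathrm{fin}}(C)$). The empty set counts as connected. The assignment is Borel if the set of all pairs $(\partial_{\mathrm{iv}}H,\partial_{\mathrm{ov}}H)$, for $C\in X/E$ and $H\in\mathcal H(C)\setminus\{\emptyset,C\}$, is Borel in the standard Borel space of pairs of finite subsets of $X$ (this pair determines $H$). *)

theory Defs
  imports "HOL-Analysis.Analysis"
begin

text \<open>A standard Borel space is a measurable space (the measure part of the type is irrelevant)
  whose \<open>\<sigma>\<close>-algebra is the Borel \<open>\<sigma>\<close>-algebra of some Polish topology on the carrier.\<close>

definition standard_borel :: "'a measure \<Rightarrow> bool" where
  "standard_borel M \<longleftrightarrow>
    (\<exists>T. topspace T = space M \<and> completely_metrizable_space T \<and> second_countable T \<and>
         sets M = sigma_sets (space M) {U. openin T U})"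

definition countable_borel_equivalence :: "'a measure \<Rightarrow> ('a \<times> 'a) set \<Rightarrow> bool" where
  "countable_borel_equivalence M E \<longleftrightarrow>
    E \<in> sets (M \<Otimes>\<^sub>M M) \<and> equiv (space M) E \<and> (\<forall>C \<in> space M // E. countable C)"

definition borel_graphing :: "'a measure \<Rightarrow> ('a \<times> 'a) set \<Rightarrow> ('a \<times> 'a) set \<Rightarrow> bool" where
  "borel_graphing M E G \<longleftrightarrow>
    G \<in> sets (M \<Otimes>\<^sub>M M) \<and> sym G \<and> irrefl G \<and> Restr (G\<^sup>*) (space M) = E"

definition locally_finite_graph :: "'a set \<Rightarrow> ('a \<times> 'a) set \<Rightarrow> bool" where
  "locally_finite_graph X G \<longleftrightarrow> (\<forall>x \<in> X. finite (G `` {x}))"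

definition graph_cycle :: "('a \<times> 'a) set \<Rightarrow> 'a list \<Rightarrow> bool" where
  "graph_cycle G xs \<longleftrightarrow>
    length xs \<ge> 3 \<and> distinct xs \<and>
    (\<forall>i < length xs. (xs ! i, xs ! (Suc i mod length xs)) \<in> G)"

text \<open>Acyclicity of an undirected graph; the library's \<open>acyclic\<close> concerns directed cycles and fails
  for every nonempty symmetric relation.\<close>

definition acyclic_graph :: "('a \<times> 'a) set \<Rightarrow> bool" where
  "acyclic_graph G \<longleftrightarrow> (\<nexists>xs. graph_cycle G xs)"

definition borel_treeable :: "'a measure \<Rightarrow> ('a \<times> 'a) set \<Rightarrow> bool" where
  "borel_treeable M E \<longleftrightarrow> (\<exists>T. borel_graphing M E T \<and> acyclic_graph T)"

definition connected_set :: "('a \<times> 'a) set \<Rightarrow> 'a set \<Rightarrow> bool" where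
  "connected_set G H \<longleftrightarrow> (\<forall>x \<in> H. \<forall>y \<in> H. (x, y) \<in> (Restr G H)\<^sup>*)"

definition inner_boundary :: "('a \<times> 'a) set \<Rightarrow> 'a set \<Rightarrow> 'a set \<Rightarrow> 'a set" where
  "inner_boundary G C H = {x \<in> H. \<exists>y \<in> C - H. (x, y) \<in> G}"

definition outer_boundary :: "('a \<times> 'a) set \<Rightarrow> 'a set \<Rightarrow> 'a set \<Rightarrow> 'a set" where
  "outer_boundary G C H = inner_boundary G C (C - H)"

definition vertex_boundary :: "('a \<times> 'a) set \<Rightarrow> 'a set \<Rightarrow> 'a set \<Rightarrow> 'a set" where
  "vertex_boundary G C H = inner_boundary G C H \<union> outer_boundary G C H"

definition fin_boundary_sets :: "('a \<times> 'a) set \<Rightarrow> 'a set \<Rightarrow> 'a set set" where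
  "fin_boundary_sets G C = {H. H \<subseteq> C \<and> finite (vertex_boundary G C H)}"

text \<open>Ultrafilters on a Boolean algebra \<open>B\<close> of subsets of \<open>C\<close>.\<close>

definition ultrafilter_on :: "'a set \<Rightarrow> 'a set set \<Rightarrow> 'a set set \<Rightarrow> bool" where
  "ultrafilter_on C B U \<longleftrightarrow>
    U \<subseteq> B \<and> C \<in> U \<and> {} \<notin> U \<and>
    (\<forall>A \<in> U. \<forall>A' \<in> U. A \<inter> A' \<in> U) \<and>
    (\<forall>A \<in> U. \<forall>A' \<in> B. A \<subseteq> A' \<longrightarrow> A' \<in> U) \<and>
    (\<forall>A \<in> B. A \<in> U \<or> C - A \<in> U)"

definition graph_end :: "('a \<times> 'a) set \<Rightarrow> 'a set \<Rightarrow> 'a set set \<Rightarrow> bool" where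
  "graph_end G C U \<longleftrightarrow>
    ultrafilter_on C (fin_boundary_sets G C) U \<and>
    (\<nexists>x. x \<in> C \<and> U = {H \<in> fin_boundary_sets G C. x \<in> H})"

text \<open>The standard Borel space of finite subsets of \<open>M\<close>, as the quotient of the space of finite
  sequences by \<open>(x\<^sub>0, \<dots>, x\<^sub>n\<^sub>-\<^sub>1) \<mapsto> {x\<^sub>0, \<dots>, x\<^sub>n\<^sub>-\<^sub>1}\<close>: a set of finite subsets is Borel iff, for every
  \<open>n\<close>, its preimage in the \<open>n\<close>-th power of \<open>M\<close> is.\<close>

definition finite_subsets :: "'a measure \<Rightarrow> 'a set set" where
  "finite_subsets M = {F. F \<subseteq> space M \<and> finite F}"

definition finite_subset_space :: "'a measure \<Rightarrow> 'a set measure" where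
  "finite_subset_space M =
    sigma (finite_subsets M)
      {S. S \<subseteq> finite_subsets M \<and>
          (\<forall>n::nat. {f \<in> space (Pi\<^sub>M {..<n} (\<lambda>_. M)). f ` {..<n} \<in> S} \<in> sets (Pi\<^sub>M {..<n} (\<lambda>_. M)))}"

lemma space_finite_subset_space: "space (finite_subset_space M) = finite_subsets M"
  unfolding finite_subset_space_def by (rule space_measure_of) auto

lemma sets_finite_subset_space:
  "sets (finite_subset_space M) =
    {S. S \<subseteq> finite_subsets M \<and>
        (\<forall>n::nat. {f \<in> space (Pi\<^sub>M {..<n} (\<lambda>_. M)). f ` {..<n} \<in> S} \<in> sets (Pi\<^sub>M {..<n} (\<lambda>_. M)))}"
    (is "_ = ?A")
proof -
  let ?P = "\<lambda>n::nat. Pi\<^sub>M {..<n} (\<lambda>_. M)"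
  have img: "f ` {..<n} \<in> finite_subsets M" if "f \<in> space (?P n)" for f n
    using that by (auto simp: finite_subsets_def space_PiM)
  have "sigma_algebra (finite_subsets M) ?A"
    unfolding sigma_algebra_iff2
  proof (intro conjI ballI allI impI)
    show "?A \<subseteq> Pow (finite_subsets M)" "{} \<in> ?A" by auto
  next
    fix S assume S: "S \<in> ?A"
    have "{f \<in> space (?P n). f ` {..<n} \<in> finite_subsets M - S} =
        space (?P n) - {f \<in> space (?P n). f ` {..<n} \<in> S}" for n
      using img by blast
    then show "finite_subsets M - S \<in> ?A" using S by auto
  next
    fix A :: "nat \<Rightarrow> 'a set set" assume A: "range A \<subseteq> ?A"
    have "{f \<in> space (?P n). f ` {..<n} \<in> (\<Union>i. A i)} =
        (\<Union>i. {f \<in> space (?P n). f ` {..<n} \<in> A i})" for n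
      by blast
    moreover have "(\<Union>i. {f \<in> space (?P n). f ` {..<n} \<in> A i}) \<in> sets (?P n)" for n
      using A by (intro sets.countable_UN) auto
    ultimately show "(\<Union>i. A i) \<in> ?A" using A by auto
  qed
  then show ?thesis
    unfolding finite_subset_space_def
    by (subst sets_measure_of) (auto simp: sigma_algebra.sigma_sets_eq)
qed

text \<open>The domain of \<open>\<H>\<close> is all of \<open>'a set\<close>, but only its values on equivalence classes matter.\<close>

definition borel_assignment ::
  "'a measure \<Rightarrow> ('a \<times> 'a) set \<Rightarrow> ('a \<times> 'a) set \<Rightarrow> ('a set \<Rightarrow> 'a set set) \<Rightarrow> bool" where
  "borel_assignment M E G \<H> \<longleftrightarrow>
    {(inner_boundary G C H, outer_boundary G C H) | C H. C \<in> space M // E \<and> H \<in> \<H> C - {{}, C}}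
      \<in> sets (finite_subset_space M \<Otimes>\<^sub>M finite_subset_space M)"

end

theory Submission
  imports Defs
begin

text \<open>On each class, the walls given by \<open>\<H>\<close> satisfy three finiteness properties: finitely many
  walls separate two points, finitely many walls cross a given wall, and, by compactness of the end
  space and the neighborhood bases of ends in \<open>\<H>\<close>, only finitely many points lie within a given
  number of walls of a point. The orientations of the walls that differ finitely from the orientation
  by a point are the vertices of the dual median graph. Color the walls with natural numbers so that
  crossing walls have distinct colors. For a wall of color \<open>n\<close>, identify two of its dual edges if
  their endpoints are joined by edges of color less than \<open>n\<close>, and keep one edge of each identification
  class: the kept edges form a tree. Contracting each orientation along this tree towards a nearest
  orientation that comes from a point yields a tree on the class. All choices are made in finite sets,
  so the construction is Borel once the classes are enumerated by Borel functions. The enumeration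
  exists because a Borel relation with finite sections is covered by countably many graphs of Borel
  functions, a consequence of Novikov's separation theorem.\<close>

section \<open>Novikov separation of analytic sets\<close>

text \<open>The obstacle is that a Borel graph with finite degrees need not contain a Borel acyclic
  graph with the same components: cycles have to be broken by choices that do not interfere with one
  another. The colors supply an order for these choices. Cycles of the median graph stem from
  crossing walls, and the choice made for a wall looks only at differences in smaller colors; walls
  of equal color are nested, so they can be treated simultaneously. The edges competing for a wall
  differ only on the walls that cross it, which makes the choice finite. Finite separation makes any
  two orientations differ finitely, hence connects the graph. The finite balls serve the
  contraction: they leave each orientation finitely many candidate points, from which a Borel linear
  order selects one, although it is not a well-order. Distinct points can have the same orientation,
  so the points that are not selected are attached as leaves. For measurability, a wall is coded by
  index lists for its two boundaries and an orientation by a base point with a finite list of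
  reversed walls. Thus all quantifiers in the construction become countable.\<close>

abbreviation borel_sets_of :: "'a topology \<Rightarrow> 'a set set" where
  "borel_sets_of T \<equiv> sigma_sets (topspace T) {U. openin T U}"

lemma sigma_algebra_borel_sets_of: "sigma_algebra (topspace T) (borel_sets_of T)"
  by (rule sigma_algebra_sigma_sets) (auto dest: openin_subset)

abbreviation baire :: "(nat \<Rightarrow> nat) topology" where "baire \<equiv> euclidean"

lemma continuous_map_into_baire:
  fixes f :: "'a \<Rightarrow> nat \<Rightarrow> nat"
  assumes "\<And>n. continuous_map X euclidean (\<lambda>x. f x n)"
  shows "continuous_map X baire f"
  using assms by (subst euclidean_product_topology[symmetric]) (simp add: continuous_map_componentwise_UNIV)

lemma continuous_map_baire_component: "continuous_map baire euclidean (\<lambda>\<alpha>. \<alpha> n)"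
  by (metis continuous_map_product_projection UNIV_I euclidean_product_topology)

text \<open>In a metrizable space open sets are countable unions of closed sets, so it is enough
  that projections of closed sets are stable under countable unions and intersections. Baire space
  absorbs the countable data of each operation into a single coordinate.\<close>

lemma borel_set_is_projection:
  assumes Z: "metrizable_space Z" and B: "B \<in> borel_sets_of Z"
  shows "\<exists>F. closedin (prod_topology Z baire) F \<and> fst ` F = B"
proof -
  define Q where "Q B \<longleftrightarrow> (\<exists>F. closedin (prod_topology Z baire) F \<and> fst ` F = B)" for B
  have closed: "Q S" if "closedin Z S" for S
    unfolding Q_def using that by (intro exI[of _ "S \<times> UNIV"]) (auto simp: closedin_prod_Times_iff)
  have comp: "continuous_map (prod_topology Z baire) euclidean (\<lambda>p. snd p n)" for n
    using continuous_map_compose[OF continuous_map_snd continuous_map_baire_component[of n]]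
    by (simp add: comp_def)
  have union: "Q (\<Union>n. A n)" if "\<And>n. Q (A n)" for A :: "nat \<Rightarrow> _"
  proof -
    have "\<forall>n. \<exists>F. closedin (prod_topology Z baire) F \<and> fst ` F = A n"
      using that by (simp add: Q_def)
    then obtain F where "\<forall>n. closedin (prod_topology Z baire) (F n) \<and> fst ` F n = A n"
      by (rule choice[THEN exE])
    then have F: "\<And>n. closedin (prod_topology Z baire) (F n)" "\<And>n. fst ` F n = A n"
      by blast+
    \<comment> \<open>Coordinate 0 names the set \<open>A n\<close>, and the shifted remainder is
      the witness for it.\<close>
    define sh where "sh = (\<lambda>p::'a \<times> (nat \<Rightarrow> nat). (fst p, \<lambda>k. snd p (Suc k)))"
    have sh: "continuous_map (prod_topology Z baire) (prod_topology Z baire) sh"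
      unfolding sh_def
      by (intro continuous_map_pairedI continuous_map_fst continuous_map_into_baire comp)
    define S where "S n = {p \<in> topspace (prod_topology Z baire). snd p 0 \<in> - {n}} \<union>
        {p \<in> topspace (prod_topology Z baire). sh p \<in> F n}" for n
    have "closedin (prod_topology Z baire) (S n)" for n
      unfolding S_def
      by (intro closedin_Un closedin_continuous_map_preimage[OF comp]
          closedin_continuous_map_preimage[OF sh] F) (simp add: closed_def open_discrete)
    then have cl: "closedin (prod_topology Z baire) (\<Inter>n. S n)" by (intro closedin_Inter) auto
    have mem: "(z, \<alpha>) \<in> (\<Inter>n. S n) \<longleftrightarrow> z \<in> topspace Z \<and> (z, \<lambda>k. \<alpha> (Suc k)) \<in> F (\<alpha> 0)" for z \<alpha>
      by (auto simp: S_def sh_def)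
    have "fst ` (\<Inter>n. S n) = (\<Union>n. A n)"
    proof (intro equalityI subsetI)
      fix z assume "z \<in> fst ` (\<Inter>n. S n)"
      then obtain \<alpha> where "(z, \<alpha>) \<in> (\<Inter>n. S n)" by (metis imageE prod.collapse)
      then have "(z, \<lambda>k. \<alpha> (Suc k)) \<in> F (\<alpha> 0)" using mem by blast
      then show "z \<in> (\<Union>n. A n)" using F(2) by (metis UNIV_I UN_I fst_conv imageI)
    next
      fix z assume "z \<in> (\<Union>n. A n)"
      then obtain n \<beta> where nb: "(z, \<beta>) \<in> F n" using F(2) by fastforce
      then have "z \<in> topspace Z" using closedin_subset[OF F(1)[of n]] by auto
      then have "(z, case_nat n \<beta>) \<in> (\<Inter>n. S n)" using nb unfolding mem by simp
      then show "z \<in> fst ` (\<Inter>n. S n)" by (metis fst_conv imageI)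
    qed
    then show ?thesis using cl unfolding Q_def by blast
  qed
  have inter: "Q (\<Inter>n. A n)" if "\<And>n. Q (A n)" for A :: "nat \<Rightarrow> _"
  proof -
    have "\<forall>n. \<exists>F. closedin (prod_topology Z baire) F \<and> fst ` F = A n"
      using that by (simp add: Q_def)
    then obtain F where "\<forall>n. closedin (prod_topology Z baire) (F n) \<and> fst ` F n = A n"
      by (rule choice[THEN exE])
    then have F: "\<And>n. closedin (prod_topology Z baire) (F n)" "\<And>n. fst ` F n = A n"
      by blast+
    \<comment> \<open>One point of Baire space carries a witness for every \<open>n\<close>, in the
      columns of \<open>prod_encode\<close>; all columns share the same \<open>z\<close>.\<close>
    define pr where "pr n = (\<lambda>p::'a \<times> (nat \<Rightarrow> nat). (fst p, \<lambda>k. snd p (prod_encode (n, k))))" for n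
    have pr: "continuous_map (prod_topology Z baire) (prod_topology Z baire) (pr n)" for n
      unfolding pr_def
      by (intro continuous_map_pairedI continuous_map_fst continuous_map_into_baire comp)
    define S where "S n = {p \<in> topspace (prod_topology Z baire). pr n p \<in> F n}" for n
    have "closedin (prod_topology Z baire) (S n)" for n
      unfolding S_def by (intro closedin_continuous_map_preimage[OF pr] F)
    then have cl: "closedin (prod_topology Z baire) (\<Inter>n. S n)" by (intro closedin_Inter) auto
    have "fst ` (\<Inter>n. S n) = (\<Inter>n. A n)"
    proof (intro equalityI subsetI)
      fix z assume "z \<in> fst ` (\<Inter>n. S n)"
      then show "z \<in> (\<Inter>n. A n)"
        unfolding S_def pr_def F(2)[symmetric] by force
    next
      fix z assume z: "z \<in> (\<Inter>n. A n)"
      then have "\<forall>n. \<exists>\<beta>. (z, \<beta>) \<in> F n" using F(2) by fastforce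
      then obtain \<beta> where b: "\<And>n. (z, \<beta> n) \<in> F n" by metis
      then have zt: "z \<in> topspace Z" using closedin_subset[OF F(1)[of 0]] by auto
      define \<alpha> where "\<alpha> m = (case prod_decode m of (n, k) \<Rightarrow> \<beta> n k)" for m
      have "(z, \<alpha>) \<in> (\<Inter>n. S n)" using b zt by (auto simp: S_def pr_def \<alpha>_def)
      then show "z \<in> fst ` (\<Inter>n. S n)" by (metis fst_conv imageI)
    qed
    then show ?thesis using cl unfolding Q_def by blast
  qed
  \<comment> \<open>Projections are not visibly stable under complement, so a set and its complement
    are carried through the induction together.\<close>
  have "Q B \<and> Q (topspace Z - B)"
    using B
  proof (induction rule: sigma_sets.induct)
    case (Basic U)
    then have U: "openin Z U" by simp
    then obtain C where C: "\<And>n::nat. closedin Z (C n)" "(\<Union>n. C n) = U"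
      using open_imp_fsigma_in[OF Z U] unfolding fsigma_in_ascending by metis
    show ?case using union[of C] closed C U by (auto simp: openin_closedin_eq)
  next
    case Empty
    show ?case using closed by simp
  next
    case (Compl a)
    have "a \<subseteq> topspace Z"
      by (rule sigma_sets_into_sp[OF _ Compl.hyps]) (auto dest: openin_subset)
    then show ?case using Compl by (simp add: double_diff)
  next
    case (Union a)
    have "topspace Z - (\<Union>i. a i) = (\<Inter>i. topspace Z - a i)" by auto
    moreover have "Q (\<Union>i. a i)" by (rule union) (use Union.IH in blast)
    moreover have "Q (\<Inter>i. topspace Z - a i)" by (rule inter) (use Union.IH in blast)
    ultimately show ?case by simp
  qed
  then show ?thesis unfolding Q_def by blast
qed

lemma separable_space_baire: "separable_space baire"
proof (rule second_countable_imp_separable_space)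
  obtain \<B> :: "(nat \<Rightarrow> nat) set set" where B: "countable \<B>" "topological_basis \<B>"
    using ex_countable_basis by blast
  have "\<forall>U x. openin baire U \<and> x \<in> U \<longrightarrow> (\<exists>V\<in>\<B>. x \<in> V \<and> V \<subseteq> U)"
    using topological_basisE[OF B(2)] by (metis open_openin)
  moreover have "\<forall>V\<in>\<B>. openin baire V"
    using topological_basis_open[OF B(2)] by simp
  ultimately show "second_countable baire"
    unfolding second_countable_def using B(1) by blast
qed

text \<open>Only the common intersection of the hulls has to be empty; if all but two members get
  the whole space, this is the usual separation of two sets.\<close>

definition borel_separable ::
  "'z topology \<Rightarrow> ('y \<Rightarrow> 'z) \<Rightarrow> (nat \<Rightarrow> 'y set) \<Rightarrow> bool" where
  "borel_separable W f S \<longleftrightarrow>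
    (\<exists>C. (\<forall>n. C n \<in> borel_sets_of W \<and> f ` S n \<subseteq> C n) \<and> (\<Inter>n. C n) = {})"

text \<open>Used contrapositively: an inseparable sequence stays inseparable when one member is cut
  to a suitable piece of a countable cover. The hulls for the pieces combine by a union at
  \<open>n0\<close> and by intersections elsewhere.\<close>

lemma borel_separable_split:
  assumes cover: "S n0 \<subseteq> (\<Union>i::nat. P i)"
    and sep: "\<And>i. borel_separable W f (S(n0 := S n0 \<inter> P i))"
  shows "borel_separable W f S"
proof -
  interpret W: sigma_algebra "topspace W" "borel_sets_of W"
    by (rule sigma_algebra_borel_sets_of)
  have "\<forall>i. \<exists>C. (\<forall>n. C n \<in> borel_sets_of W \<and> f ` (S(n0 := S n0 \<inter> P i)) n \<subseteq> C n) \<and> (\<Inter>n. C n) = {}"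
    using sep unfolding borel_separable_def by blast
  then obtain C where "\<forall>i. (\<forall>n. C i n \<in> borel_sets_of W \<and> f ` (S(n0 := S n0 \<inter> P i)) n \<subseteq> C i n)
      \<and> (\<Inter>n. C i n) = {}"
    by (rule choice[THEN exE])
  then have C: "\<And>i n. C i n \<in> borel_sets_of W" "\<And>i n. f ` (S(n0 := S n0 \<inter> P i)) n \<subseteq> C i n"
      "\<And>i. (\<Inter>n. C i n) = {}"
    by blast+
  define D where "D n = (if n = n0 then \<Union>i. C i n else \<Inter>i. C i n)" for n
  have "D n \<in> borel_sets_of W" for n
    unfolding D_def using C(1) by (auto intro!: W.countable_UN W.countable_INT)
  moreover have "f ` S n \<subseteq> D n" for n
  proof (cases "n = n0")
    case True
    have "f ` S n0 \<subseteq> (\<Union>i. C i n0)"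
    proof
      fix y assume "y \<in> f ` S n0"
      then obtain x i where "x \<in> S n0" "x \<in> P i" "y = f x" using cover by blast
      then show "y \<in> (\<Union>i. C i n0)" using C(2)[of i n0] by auto
    qed
    then show ?thesis by (simp add: D_def True)
  next
    case False
    then show ?thesis using C(2)[of _ n] by (auto simp: D_def)
  qed
  moreover have "(\<Inter>n. D n) = {}"
  proof (rule ccontr)
    assume "(\<Inter>n. D n) \<noteq> {}"
    then obtain y where y: "\<And>n. y \<in> D n" by auto
    then obtain i where "y \<in> C i n0" using y[of n0] by (auto simp: D_def)
    moreover have "y \<in> C i n" if "n \<noteq> n0" for n using y[of n] that by (auto simp: D_def)
    ultimately have "y \<in> (\<Inter>n. C i n)" by (metis INT_I)
    then show False using C(3) by auto
  qed
  ultimately show ?thesis unfolding borel_separable_def by blast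
qed

text \<open>If separation fails, repeated cutting shrinks every member to arbitrarily small diameter
  and keeps the sequence inseparable. By completeness the members shrink to points
  \<open>z n\<close> of the closed sets \<open>B n\<close>. Two of these have different images,
  whose disjoint neighborhoods separate a late stage.\<close>

theorem novikov_separation_closed:
  assumes Z: "completely_metrizable_space Z" "separable_space Z"
    and W: "Hausdorff_space W" and f: "continuous_map Z W f"
    and B: "\<And>n. closedin Z (B n)" and empty: "(\<Inter>n. f ` B n) = {}"
  shows "borel_separable W f B"
proof (rule ccontr)
  assume insep: "\<not> borel_separable W f B"
  obtain X d where met: "Metric_space X d" and compl: "Metric_space.mcomplete X d"
    and top: "Z = Metric_space.mtopology X d"
    using Z(1) unfolding completely_metrizable_space_def by blast
  interpret Metric_space X d by (rule met)
  interpret W: sigma_algebra "topspace W" "borel_sets_of W"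
    by (rule sigma_algebra_borel_sets_of)
  \<comment> \<open>Two members inside disjoint open sets suffice, since the other hulls may be the
    whole space. With \<open>U\<close> empty this also shows that an inseparable sequence has no
    empty member.\<close>
  have two: "borel_separable W f S"
    if S: "\<And>k. S k \<subseteq> B k" and "n \<noteq> m" "openin W U" "openin W V" "U \<inter> V = {}" "f ` S n \<subseteq> U" "f ` S m \<subseteq> V"
    for S n m U V
    unfolding borel_separable_def
  proof (intro exI conjI allI)
    define C where "C k = (if k = n then U else if k = m then V else topspace W)" for k
    fix k
    have "f ` S k \<subseteq> topspace W"
      using S[of k] closedin_subset[OF B[of k]] continuous_map_image_subset_topspace[OF f] by blast
    then show "f ` S k \<subseteq> C k" using that by (auto simp: C_def)
    show "C k \<in> borel_sets_of W"
      using that by (auto simp: C_def intro: sigma_sets.Basic)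
    show "(\<Inter>k. C k) = {}" using that INT_lower[of n UNIV C] INT_lower[of m UNIV C]
      by (auto simp: C_def)
  qed
  obtain D where D: "countable D" "D \<subseteq> X" "Z closure_of D = X"
    using Z(2) unfolding separable_space_def top by auto
  have "B 0 \<noteq> {}"
  proof
    assume "B 0 = {}"
    then have "borel_separable W f B" 
      by (intro two[of B 0 1 "{}" "topspace W"]) 
        (use continuous_map_image_subset_topspace[OF f] closedin_subset[OF B[of 1]] in auto)
    then show False using insep by simp
  qed
  then have "X \<noteq> {}" using closedin_subset[OF B[of 0]] top by auto
  then have "D \<noteq> {}" using D(3) by auto
  then obtain q :: "nat \<Rightarrow> _" where q: "range q = D"
    using D(1) by (metis uncountable_def)
  have cover: "X \<subseteq> (\<Union>i. mball (q i) (1 / real (Suc k)))" for k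
  proof
    fix x assume x: "x \<in> X"
    have "x \<in> mtopology closure_of D" using D(3) x unfolding top by simp
    moreover have "0 < 1 / real (Suc k)" by simp
    ultimately obtain y where y: "y \<in> D" "y \<in> mball x (1 / real (Suc k))"
      unfolding metric_closure_of by blast
    then obtain i where "y = q i" using q by blast
    then have "x \<in> mball (q i) (1 / real (Suc k))" using y(2) by (simp add: commute)
    then show "x \<in> (\<Union>i. mball (q i) (1 / real (Suc k)))" by blast
  qed
  \<comment> \<open>Stage \<open>t\<close> cuts member \<open>n\<close> by a ball of radius 1 / (k +
    1), where \<open>(n, k)\<close> is decoded from \<open>t\<close>; so every member is cut to
    every radius at some stage.\<close>
  define R where "R t S S' \<longleftrightarrow> (case prod_decode t of (n, k) \<Rightarrow>
      \<exists>i. S' = S(n := S n \<inter> mball (q i) (1 / real (Suc k))))" for t S and S' :: "nat \<Rightarrow> 'a set"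
  have "\<exists>S. \<forall>t. (\<not> borel_separable W f (S t) \<and> (\<forall>k. S t k \<subseteq> B k)) \<and> R t (S t) (S (Suc t))"
  proof (rule dependent_nat_choice[where P = "\<lambda>_ S. \<not> borel_separable W f S \<and> (\<forall>k. S k \<subseteq> B k)" and Q = R])
    show "\<exists>x. \<not> borel_separable W f x \<and> (\<forall>k. x k \<subseteq> B k)" using insep by blast
  next
    fix S :: "nat \<Rightarrow> 'a set" and t
    assume S: "\<not> borel_separable W f S \<and> (\<forall>k. S k \<subseteq> B k)"
    obtain n k where nk: "prod_decode t = (n, k)" by fastforce
    have "S n \<subseteq> (\<Union>i. mball (q i) (1 / real (Suc k)))"
      using S cover[of k] closedin_subset[OF B[of n]] unfolding top topspace_mtopology
      by (meson order_trans)
    from borel_separable_split[where S = S and ?n0.0 = n, OF this, of W f] S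
    obtain i where "\<not> borel_separable W f (S(n := S n \<inter> mball (q i) (1 / real (Suc k))))"
      by blast
    then show "\<exists>y. (\<not> borel_separable W f y \<and> (\<forall>k. y k \<subseteq> B k)) \<and> R t S y"
      using S unfolding R_def nk by (intro exI[of _ "S(n := S n \<inter> mball (q i) (1 / real (Suc k)))"]) auto
  qed
  then obtain S where ins: "\<And>t. \<not> borel_separable W f (S t)" and SB: "\<And>t k. S t k \<subseteq> B k"
    and R: "\<And>t. R t (S t) (S (Suc t))" by blast
  have step: "S (Suc t) n \<subseteq> S t n" for t n
    using R[of t] unfolding R_def by (auto split: prod.splits if_splits)
  have mono: "S t' n \<subseteq> S t n" if "t \<le> t'" for t t' n
    using lift_Suc_antimono_le[of "\<lambda>t. S t n", OF step that] .
  have small: "\<exists>i. \<forall>t > prod_encode (n, k). S t n \<subseteq> mball (q i) (1 / real (Suc k))" for n k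
  proof -
    obtain i where "S (Suc (prod_encode (n, k))) =
        (S (prod_encode (n, k)))(n := S (prod_encode (n, k)) n \<inter> mball (q i) (1 / real (Suc k)))"
      using R[of "prod_encode (n, k)"] unfolding R_def by auto
    then have "S (Suc (prod_encode (n, k))) n \<subseteq> mball (q i) (1 / real (Suc k))"
      by (metis fun_upd_same inf_le2)
    then show ?thesis using mono[of "Suc (prod_encode (n, k))" _ n] by (meson Suc_leI order_trans)
  qed
  have ne: "S t n \<noteq> {}" for t n
  proof
    assume "S t n = {}"
    moreover have "f ` S t (Suc n) \<subseteq> topspace W"
      using SB[of t "Suc n"] closedin_subset[OF B[of "Suc n"]]
        continuous_map_image_subset_topspace[OF f] by blast
    ultimately have "borel_separable W f (S t)"
      by (intro two[of "S t" n "Suc n" "{}" "topspace W"] SB) auto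
    then show False using ins by blast
  qed
  define p where "p n t = (SOME x. x \<in> S t n)" for n t
  have p: "p n t \<in> S t n" for n t
    unfolding p_def using ne by (simp add: some_in_eq)
  have SX: "S t n \<subseteq> X" for t n
    using SB[of t n] closedin_subset[OF B[of n]] unfolding top by auto
  have close: "\<exists>t0. \<forall>t\<ge>t0. \<forall>x\<in>S t n. \<forall>y\<in>S t0 n. d x y < \<epsilon>" if "\<epsilon> > 0" for n \<epsilon>
  proof -
    obtain k where k: "2 / real (Suc k) < \<epsilon>"
      using \<open>\<epsilon> > 0\<close> reals_Archimedean[of "\<epsilon> / 2"] by (auto simp: field_simps)
    obtain i where i: "\<And>t. t > prod_encode (n, k) \<Longrightarrow> S t n \<subseteq> mball (q i) (1 / real (Suc k))"
      using small by blast
    have "d x y < \<epsilon>" if "x \<in> S (Suc (prod_encode (n, k))) n" "y \<in> S (Suc (prod_encode (n, k))) n" for x y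
    proof -
      have "d (q i) x < 1 / real (Suc k)" "d (q i) y < 1 / real (Suc k)" "q i \<in> X" "x \<in> X" "y \<in> X"
        using that i[of "Suc (prod_encode (n, k))"] by (auto simp: subset_iff)
      then have "d x y < 1 / real (Suc k) + 1 / real (Suc k)" using triangle''[of x "q i" y] by linarith
      then show ?thesis using k by linarith
    qed
    then show ?thesis using mono by (meson subsetD)
  qed
  have "\<exists>z. limitin mtopology (p n) z sequentially" for n
  proof -
    have "MCauchy (p n)" unfolding MCauchy_def
    proof (intro conjI allI impI)
      show "range (p n) \<subseteq> X" using p SX by blast
      fix \<epsilon> :: real assume "\<epsilon> > 0"
      then obtain t0 where "\<And>t x y. t \<ge> t0 \<Longrightarrow> x \<in> S t n \<Longrightarrow> y \<in> S t0 n \<Longrightarrow> d x y < \<epsilon>"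
        using close by blast
      then show "\<exists>N. \<forall>t t'. N \<le> t \<longrightarrow> N \<le> t' \<longrightarrow> d (p n t) (p n t') < \<epsilon>"
        using p mono by (metis subsetD)
    qed
    then show ?thesis using compl unfolding mcomplete_def by blast
  qed
  then obtain z where z: "\<And>n. limitin mtopology (p n) (z n) sequentially" by metis
  have zB: "z n \<in> B n" for n
  proof -
    have "p n t \<in> B n" for t using p SB by blast
    then show ?thesis using limitin_closedin[OF z[of n], of "B n"] B[of n] unfolding top by simp
  qed
  have zX: "z n \<in> X" for n using limitin_mspace[OF z] .
  have near: "\<exists>t0. \<forall>t\<ge>t0. S t n \<subseteq> N" if N: "openin mtopology N" "z n \<in> N" for n N
  proof -
    obtain r where r: "r > 0" "mball (z n) r \<subseteq> N"
      using N unfolding openin_mtopology by blast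
    obtain t0 where t0: "\<And>t x y. t \<ge> t0 \<Longrightarrow> x \<in> S t n \<Longrightarrow> y \<in> S t0 n \<Longrightarrow> d x y < r / 2"
      using close[OF half_gt_zero[OF r(1)], of n] by blast
    have "eventually (\<lambda>t. p n t \<in> X \<and> d (p n t) (z n) < r / 2) sequentially"
      using z[of n] r unfolding limitin_metric by (meson half_gt_zero)
    then obtain t1 where t1: "t1 \<ge> t0" "d (p n t1) (z n) < r / 2"
      by (metis (mono_tags, lifting) eventually_sequentially le_cases)
    have "S t n \<subseteq> N" if "t \<ge> t0" for t
    proof
      fix x assume x: "x \<in> S t n"
      have "d x (p n t1) < r / 2" using t0[OF that x] p[of n t1] mono[OF t1(1), of n] by blast
      then have "d x (z n) < r" using triangle[of x "p n t1" "z n"] x SX p zX t1(2) by (smt (verit) field_sum_of_halves subsetD)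
      then show "x \<in> N" using r(2) x SX zX by (auto simp: commute subset_iff)
    qed
    then show ?thesis by blast
  qed
  obtain n where n: "f (z n) \<noteq> f (z 0)"
  proof -
    have "f (z 0) \<notin> (\<Inter>n. f ` B n)" using empty by simp
    then obtain n where "f (z 0) \<notin> f ` B n" by blast
    then show ?thesis using that zB[of n] by (metis imageI)
  qed
  then have "n \<noteq> 0" by metis
  have "f (z k) \<in> topspace W" for k
    using continuous_map_image_subset_topspace[OF f] zX unfolding top by auto
  then obtain U V where UV: "openin W U" "openin W V" "f (z n) \<in> U" "f (z 0) \<in> V" "U \<inter> V = {}"
    using W n unfolding Hausdorff_space_def disjnt_def by metis
  have pre: "openin mtopology {x \<in> X. f x \<in> N}" if "openin W N" for N
    using openin_continuous_map_preimage[OF f that] unfolding top by simp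
  obtain t0 where t0: "\<And>t. t \<ge> t0 \<Longrightarrow> S t n \<subseteq> {x \<in> X. f x \<in> U}"
    using near[OF pre[OF UV(1)]] UV(3) zX by blast
  obtain t1 where t1: "\<And>t. t \<ge> t1 \<Longrightarrow> S t 0 \<subseteq> {x \<in> X. f x \<in> V}"
    using near[OF pre[OF UV(2)]] UV(4) zX by blast
  have "borel_separable W f (S (max t0 t1))"
    using t0[of "max t0 t1"] t1[of "max t0 t1"] \<open>n \<noteq> 0\<close>
    by (intro two[of "S (max t0 t1)" n 0 U V] SB UV) auto
  then show False using ins by blast
qed

text \<open>Passing to closed subsets of the product with Baire space changes no image once
  \<open>f\<close> is replaced by \<open>f \<circ> fst\<close>, and the product is again complete
  and separable.\<close>

theorem novikov_separation:
  assumes Z: "completely_metrizable_space Z" "separable_space Z"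
    and W: "Hausdorff_space W" and f: "continuous_map Z W f"
    and B: "\<And>n. B n \<in> borel_sets_of Z" and empty: "(\<Inter>n. f ` B n) = {}"
  shows "borel_separable W f B"
proof -
  have "\<forall>n. \<exists>F. closedin (prod_topology Z baire) F \<and> fst ` F = B n"
    using borel_set_is_projection[OF completely_metrizable_imp_metrizable_space[OF Z(1)] B] by blast
  then obtain F where "\<forall>n. closedin (prod_topology Z baire) (F n) \<and> fst ` F n = B n"
    by (rule choice[THEN exE])
  then have F: "\<And>n. closedin (prod_topology Z baire) (F n)" "\<And>n. fst ` F n = B n"
    by blast+
  have img: "(f \<circ> fst) ` F n = f ` B n" for n by (simp only: F(2)[symmetric] image_comp)
  have "(euclidean :: nat topology) = discrete_topology UNIV"
    by (simp add: topology_eq open_discrete)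
  then have "completely_metrizable_space (euclidean :: nat topology)"
    by (simp add: completely_metrizable_space_discrete_topology)
  then have "completely_metrizable_space baire"
    by (subst euclidean_product_topology[symmetric])
      (simp add: completely_metrizable_space_product_topology)
  then have "completely_metrizable_space (prod_topology Z baire)"
    by (simp add: completely_metrizable_space_prod_topology Z)
  moreover have "separable_space (prod_topology Z baire)"
  proof -
    obtain C D where "countable C" "C \<subseteq> topspace Z" "Z closure_of C = topspace Z"
      "countable D" "baire closure_of D = topspace baire"
      using Z(2) separable_space_baire unfolding separable_space_def by metis
    then show ?thesis
      unfolding separable_space_def
      by (intro exI[of _ "C \<times> D"]) (auto simp: closure_of_Times)
  qed
  ultimately have "borel_separable W (f \<circ> fst) F"
    using F(1) empty unfolding img[symmetric]
    by (intro novikov_separation_closed W) (auto intro: continuous_map_compose[OF continuous_map_fst f]) 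
  then show ?thesis unfolding borel_separable_def img .
qed

section \<open>Polish topologies and products of their Borel sigma-algebras\<close>

definition polish_measure :: "'a measure \<Rightarrow> 'a topology \<Rightarrow> bool" where
  "polish_measure M T \<longleftrightarrow> topspace T = space M \<and> completely_metrizable_space T \<and>
     second_countable T \<and> sets M = borel_sets_of T"

lemma second_countable_sequence:
  assumes "second_countable T"
  obtains U :: "nat \<Rightarrow> 'a set"
  where "\<And>n. openin T (U n)" "\<And>V x. openin T V \<Longrightarrow> x \<in> V \<Longrightarrow> \<exists>n. x \<in> U n \<and> U n \<subseteq> V"
proof -
  obtain \<B> where \<B>: "countable \<B>" "\<forall>V\<in>\<B>. openin T V"
    "\<forall>U x. openin T U \<and> x \<in> U \<longrightarrow> (\<exists>V\<in>\<B>. x \<in> V \<and> V \<subseteq> U)"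
    using assms unfolding second_countable_def by blast
  \<comment> \<open>The empty set is added because an enumeration by all natural numbers needs a
    nonempty set.\<close>
  have c: "countable (insert {} \<B>)" using \<B>(1) by simp
  obtain U :: "nat \<Rightarrow> 'a set" where r: "insert {} \<B> = range U"
    by (rule that) (rule range_from_nat_into[OF insert_not_empty c, symmetric])
  show ?thesis
  proof
    show "openin T (U n)" for n
    proof -
      have "U n \<in> insert {} \<B>" unfolding r by simp
      then show ?thesis using \<B>(2) by (elim insertE) simp_all
    qed
    show "\<exists>n. x \<in> U n \<and> U n \<subseteq> V" if V: "openin T V" "x \<in> V" for V x
    proof -
      obtain B where B: "B \<in> \<B>" "x \<in> B" "B \<subseteq> V" using V \<B>(3) by blast
      then have "B \<in> range U" unfolding r[symmetric] by simp
      then show ?thesis using B by blast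
    qed
  qed
qed

lemma second_countable_prod_topology:
  assumes "second_countable T" "second_countable T'"
  shows "second_countable (prod_topology T T')"
proof -
  obtain U where U: "\<And>n::nat. openin T (U n)" "\<And>V x. openin T V \<Longrightarrow> x \<in> V \<Longrightarrow> \<exists>n. x \<in> U n \<and> U n \<subseteq> V"
    by (rule second_countable_sequence[OF assms(1)]) blast
  obtain U' where U': "\<And>n::nat. openin T' (U' n)" "\<And>V x. openin T' V \<Longrightarrow> x \<in> V \<Longrightarrow> \<exists>n. x \<in> U' n \<and> U' n \<subseteq> V"
    by (rule second_countable_sequence[OF assms(2)]) blast
  show ?thesis
    unfolding second_countable_def
  proof (intro exI conjI ballI allI impI)
    show "countable (range (\<lambda>(n, m). U n \<times> U' m))" by simp
    show "openin (prod_topology T T') V" if "V \<in> range (\<lambda>(n, m). U n \<times> U' m)" for V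
      using that U(1) U'(1) by (auto simp: openin_prod_Times_iff)
    show "\<exists>V\<in>range (\<lambda>(n, m). U n \<times> U' m). z \<in> V \<and> V \<subseteq> W"
      if W: "openin (prod_topology T T') W \<and> z \<in> W" for W z
    proof -
      obtain x y where z: "z = (x, y)" by fastforce
      then obtain A B where AB: "openin T A" "openin T' B" "x \<in> A" "y \<in> B" "A \<times> B \<subseteq> W"
        using W unfolding openin_prod_topology_alt by blast
      obtain n where "x \<in> U n" "U n \<subseteq> A" using U(2) AB by blast
      moreover obtain m where "y \<in> U' m" "U' m \<subseteq> B" using U'(2) AB by blast
      ultimately show ?thesis using AB(5) z by (intro bexI[of _ "U n \<times> U' m"]) auto
    qed
  qed
qed

lemma polish_measure_continuous_measurable:
  assumes "polish_measure M T" "polish_measure N S" "continuous_map T S f"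
  shows "f \<in> measurable M N"
proof (rule measurable_sigma_sets)
  show "sets N = sigma_sets (topspace S) {U. openin S U}" "{U. openin S U} \<subseteq> Pow (topspace S)"
    using assms(2) by (auto simp: polish_measure_def dest: openin_subset)
  show "f \<in> space M \<rightarrow> topspace S"
    using assms continuous_map_image_subset_topspace[OF assms(3)] by (auto simp: polish_measure_def)
  show "f -` V \<inter> space M \<in> sets M" if "V \<in> {U. openin S U}" for V
  proof -
    have "f -` V \<inter> space M = {x \<in> topspace T. f x \<in> V}"
      using assms(1) by (auto simp: polish_measure_def)
    then show ?thesis
      using openin_continuous_map_preimage[OF assms(3)] that assms(1)
      by (auto simp: polish_measure_def)
  qed
qed

text \<open>Second countability makes each open set of the product a countable union of open
  rectangles; this gives the inclusion that fails for general topologies.\<close>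

lemma polish_measure_pair:
  assumes M: "polish_measure M T" and N: "polish_measure N S"
  shows "polish_measure (M \<Otimes>\<^sub>M N) (prod_topology T S)"
proof -
  obtain U where U: "\<And>n::nat. openin T (U n)" "\<And>V x. openin T V \<Longrightarrow> x \<in> V \<Longrightarrow> \<exists>n. x \<in> U n \<and> U n \<subseteq> V"
    by (rule second_countable_sequence[of T]) (use M polish_measure_def in blast)+
  obtain U' where U': "\<And>n::nat. openin S (U' n)" "\<And>V x. openin S V \<Longrightarrow> x \<in> V \<Longrightarrow> \<exists>n. x \<in> U' n \<and> U' n \<subseteq> V"
    by (rule second_countable_sequence[of S]) (use N polish_measure_def in blast)+
  define P where "P = sigma (space M \<times> space N) {U. openin (prod_topology T S) U}"
  have sp: "topspace T = space M" "topspace S = space N"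
    using M N by (auto simp: polish_measure_def)
  have open_sub: "{U. openin (prod_topology T S) U} \<subseteq> Pow (space M \<times> space N)"
    using sp openin_subset[of "prod_topology T S"] by auto
  have P: "space P = space M \<times> space N" "sets P = borel_sets_of (prod_topology T S)"
    using open_sub sp by (auto simp: P_def)
  have polP: "polish_measure P (prod_topology T S)"
    using M N P by (auto simp: polish_measure_def second_countable_prod_topology
        completely_metrizable_space_prod_topology)
  have "sets (M \<Otimes>\<^sub>M N) \<subseteq> sets P"
  proof -
    have "fst \<in> measurable P M" "snd \<in> measurable P N"
      using polish_measure_continuous_measurable[OF polP M continuous_map_fst]
        polish_measure_continuous_measurable[OF polP N continuous_map_snd] .
    then have "(\<lambda>p. (fst p, snd p)) \<in> measurable P (M \<Otimes>\<^sub>M N)" by measurable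
    then have *: "(\<lambda>p. (fst p, snd p)) -` A \<inter> space P \<in> sets P" if "A \<in> sets (M \<Otimes>\<^sub>M N)" for A
      using that by (rule measurable_sets)
    have "A \<in> sets P" if "A \<in> sets (M \<Otimes>\<^sub>M N)" for A
    proof -
      have "A \<subseteq> space P" using sets.sets_into_space[OF that] by (simp add: P space_pair_measure)
      then have "(\<lambda>p. (fst p, snd p)) -` A \<inter> space P = A" by auto
      then show ?thesis using *[OF that] by simp
    qed
    then show ?thesis by blast
  qed
  moreover have "sets P \<subseteq> sets (M \<Otimes>\<^sub>M N)"
    unfolding P_def
  proof (rule sets.sigma_sets_subset[of _ "M \<Otimes>\<^sub>M N", unfolded space_pair_measure, 
        THEN order_trans[rotated]])
    show "{U. openin (prod_topology T S) U} \<subseteq> sets (M \<Otimes>\<^sub>M N)"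
    proof clarify
      fix W assume W: "openin (prod_topology T S) W"
      have "W = (\<Union>(n, m)\<in>{(n, m). U n \<times> U' m \<subseteq> W}. U n \<times> U' m)" (is "_ = ?R")
      proof (intro equalityI subsetI)
        fix z assume zW: "z \<in> W"
        obtain x y where z: "z = (x, y)" by fastforce
        have "\<exists>A B. openin T A \<and> openin S B \<and> x \<in> A \<and> y \<in> B \<and> A \<times> B \<subseteq> W"
          using W zW unfolding openin_prod_topology_alt z by simp
        then obtain A B where AB: "openin T A" "openin S B" "x \<in> A" "y \<in> B" "A \<times> B \<subseteq> W"
          by (elim exE conjE)
        obtain n where n: "x \<in> U n" "U n \<subseteq> A" using U(2)[OF AB(1,3)] by (elim exE conjE)
        obtain m where m: "y \<in> U' m" "U' m \<subseteq> B" using U'(2)[OF AB(2,4)] by (elim exE conjE)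
        have "U n \<times> U' m \<subseteq> W" using AB(5) n(2) m(2) by (meson Sigma_mono order_trans)
        then show "z \<in> ?R" using z n(1) m(1) by auto
      qed auto
      also have "\<dots> \<in> sets (M \<Otimes>\<^sub>M N)"
        using M N U(1) U'(1)
        by (intro sets.countable_UN') (auto simp: polish_measure_def intro!: pair_measureI)
      finally show "W \<in> sets (M \<Otimes>\<^sub>M N)" .
    qed
    show "sets (sigma (space M \<times> space N) {U. openin (prod_topology T S) U}) \<subseteq>
        sigma_sets (space M \<times> space N) {U. openin (prod_topology T S) U}"
      using open_sub by simp
  qed
  ultimately have "sets (M \<Otimes>\<^sub>M N) = sets P" by blast
  then show ?thesis
    using polP P by (simp add: polish_measure_def space_pair_measure)
qed

lemma polish_measure_novikov:
  assumes Z: "polish_measure Z S" and W: "polish_measure W T" and f: "continuous_map S T f"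
    and B: "\<And>n. B n \<in> sets Z" and empty: "(\<Inter>n. f ` B n) = {}"
  obtains C :: "nat \<Rightarrow> _ set"
  where "\<And>n. C n \<in> sets W" "\<And>n. f ` B n \<subseteq> C n" "(\<Inter>n. C n) = {}"
proof -
  have "Hausdorff_space T"
    using W metrizable_imp_Hausdorff_space completely_metrizable_imp_metrizable_space
    unfolding polish_measure_def by blast
  moreover have "completely_metrizable_space S" "separable_space S" "\<And>n. B n \<in> borel_sets_of S"
    using Z B by (simp_all add: polish_measure_def second_countable_imp_separable_space)
  ultimately have "borel_separable T f B"
    using f empty by (intro novikov_separation)
  then obtain C where C: "\<forall>n. C n \<in> borel_sets_of T \<and> f ` B n \<subseteq> C n" "(\<Inter>n. C n) = {}"
    unfolding borel_separable_def by blast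
  show ?thesis
    by (rule that[of C]) (use C W in \<open>simp_all add: polish_measure_def\<close>)
qed

section \<open>Uniformization of Borel relations with finite sections\<close>

text \<open>The domain of \<open>Q\<close> is given only as a projection, so the function cannot
  simply be made constant off it. Instead, the points sent into a ball and those sent outside it are
  disjoint projections, hence separated by a Borel set \<open>S k i\<close>. The function is
  recovered as a limit of dense points selected by these sets.\<close>

lemma polish_measure_graph_extend:
  assumes M: "polish_measure M T" and Q: "Q \<in> sets (M \<Otimes>\<^sub>M M)"
    and fn: "\<And>x y y'. (x, y) \<in> Q \<Longrightarrow> (x, y') \<in> Q \<Longrightarrow> y = y'"
  obtains h where "h \<in> measurable M M" "\<And>x y. (x, y) \<in> Q \<Longrightarrow> h x = y"
proof (cases "space M = {}")
  case True
  then have "Q = {}" using sets.sets_into_space[OF Q] by (simp add: space_pair_measure)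
  then show ?thesis by (intro that[of id]) auto
next
  case False
  note M' = M[unfolded polish_measure_def]
  obtain X d where met: "Metric_space X d" and compl: "Metric_space.mcomplete X d"
    and top: "T = Metric_space.mtopology X d"
    using M' unfolding completely_metrizable_space_def by blast
  interpret Metric_space X d by (rule met)
  have X: "space M = X" using M' top by simp
  have openM: "U \<in> sets M" if "openin T U" for U
    using that M' by auto
  obtain D where D: "countable D" "D \<subseteq> X" "mtopology closure_of D = X"
    using second_countable_imp_separable_space[of T] M' unfolding separable_space_def top by auto
  then have "D \<noteq> {}" using False X by auto
  obtain q :: "nat \<Rightarrow> _" where q: "range q = D"
    by (rule that) (rule range_from_nat_into[OF \<open>D \<noteq> {}\<close> D(1)])
  have qX: "q i \<in> X" for i using q D(2) by blast
  have dense: "\<exists>i. d (q i) x < r" if "x \<in> X" "r > 0" for x r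
  proof -
    have "x \<in> mtopology closure_of D" using D(3) \<open>x \<in> X\<close> by simp
    then have "\<exists>y\<in>D. y \<in> mball x r" using \<open>r > 0\<close> unfolding metric_closure_of by blast
    then show ?thesis using q by (force simp: commute)
  qed
  define b where "b k i = mball (q i) (1 / real (Suc k))" for k i
  have bM: "b k i \<in> sets M" for k i using openM unfolding b_def top by simp
  have cf: "continuous_map (prod_topology T T) T fst" by (rule continuous_map_fst)
  have "\<exists>S. S \<in> sets M \<and> (\<forall>x y. (x, y) \<in> Q \<longrightarrow> (x \<in> S \<longleftrightarrow> y \<in> b k i))" for k i
  proof -
    \<comment> \<open>Only members 0 and 1 are to be separated; all others equal \<open>Q\<close>,
      so that their hulls contain its whole domain.\<close>
    define B where "B n = Q \<inter> (if n = 0 then space M \<times> b k i else if n = 1 then space M \<times> (space M - b k i)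
        else space M \<times> space M)" for n :: nat
    have "B n \<in> sets (M \<Otimes>\<^sub>M M)" for n
      unfolding B_def using Q bM by auto
    moreover have "(\<Inter>n. fst ` B n) = {}"
    proof (rule ccontr)
      assume "(\<Inter>n. fst ` B n) \<noteq> {}"
      then obtain x where "x \<in> fst ` B 0" "x \<in> fst ` B 1" by blast
      then obtain y y' where "(x, y) \<in> B 0" "(x, y') \<in> B 1" by force
      then show False using fn[of x y y'] by (auto simp: B_def)
    qed
    ultimately obtain C where C: "\<And>n. C n \<in> sets M" "\<And>n. fst ` B n \<subseteq> C n" "(\<Inter>n. C n) = {}"
      by (rule polish_measure_novikov[OF polish_measure_pair[OF M M] M cf]) blast
    show ?thesis
    proof (intro exI conjI allI impI)
      \<comment> \<open>On the domain of \<open>Q\<close> the hulls with index at least 2 contain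
        every point, so there the subtracted intersection agrees with \<open>C 1\<close>.\<close>
      show "C 0 - (\<Inter>n\<in>{1..}. C n) \<in> sets M" using C(1) by auto
      fix x y assume xy: "(x, y) \<in> Q"
      then have sp: "x \<in> space M" "y \<in> space M"
        using sets.sets_into_space[OF Q] by (auto simp: space_pair_measure)
      have oth: "x \<in> C n" if "n \<ge> 2" for n
        using C(2)[of n] xy sp that by (force simp: B_def)
      have "x \<in> C 0" if "y \<in> b k i" using C(2)[of 0] xy sp that by (force simp: B_def)
      moreover have "x \<in> C 1" if "y \<notin> b k i" using C(2)[of 1] xy sp that by (force simp: B_def)
      moreover have "\<not> (x \<in> C 0 \<and> x \<in> C 1)"
      proof
        assume "x \<in> C 0 \<and> x \<in> C 1"
        then have "x \<in> C n" for n using oth[of n] by (cases n; cases "n - 1") auto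
        then show False using C(3) by auto
      qed
      moreover have "x \<in> (\<Inter>n\<in>{1..}. C n) \<longleftrightarrow> x \<in> C 1"
        using oth by (auto simp: le_Suc_eq) (metis One_nat_def Suc_leI le_eq_less_or_eq not_less_eq_eq numeral_2_eq_2)
      ultimately show "(x \<in> C 0 - (\<Inter>n\<in>{1..}. C n)) \<longleftrightarrow> y \<in> b k i" by blast
    qed
  qed
  then obtain S where S: "\<And>k i. S k i \<in> sets M"
    "\<And>k i x y. (x, y) \<in> Q \<Longrightarrow> (x \<in> S k i \<longleftrightarrow> y \<in> b k i)"
    by metis
  define idx where "idx k x = (LEAST i. x \<in> S k i)" for k x
  have idx_meas[measurable]: "idx k \<in> measurable M (count_space UNIV)" for k
    unfolding idx_def using S(1) by measurable
  define s where "s x k = q (idx k x)" for x k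
  have approx: "d (s x k) y < 1 / real (Suc k)" if "(x, y) \<in> Q" for x y k
  proof -
    have "y \<in> X" using that sets.sets_into_space[OF Q] X by (auto simp: space_pair_measure)
    then obtain i where "d (q i) y < 1 / real (Suc k)" using dense[of y "1 / real (Suc k)"] by auto
    then have "x \<in> S k i" using S(2)[OF that] \<open>y \<in> X\<close> qX by (simp add: b_def)
    then have "x \<in> S k (idx k x)" unfolding idx_def by (rule LeastI)
    then show ?thesis using S(2)[OF that] by (simp add: b_def s_def)
  qed
  have inv0: "\<exists>m. 1 / real (Suc m) < r" if "r > 0" for r :: real
    using reals_Archimedean[OF that] by (simp add: inverse_eq_divide)
  \<comment> \<open>Off the domain of \<open>Q\<close> the sequence \<open>s x\<close> may diverge.
    The Cauchy property is written with countable quantifiers to be Borel, and \<open>q 0\<close> is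
    the default value where it fails.\<close>
  define cau where "cau x \<longleftrightarrow> (\<forall>m. \<exists>N. \<forall>k k'. N \<le> k \<longrightarrow> N \<le> k' \<longrightarrow> d (s x k) (s x k') < 1 / real (Suc m))" for x
  have cau: "cau x \<longleftrightarrow> MCauchy (s x)" for x
  proof
    assume "cau x"
    then show "MCauchy (s x)"
      unfolding cau_def MCauchy_def using inv0 qX by (auto simp: s_def) (meson order_less_trans)
  next
    assume "MCauchy (s x)"
    then show "cau x" unfolding cau_def MCauchy_def by simp
  qed
  define h where "h x = (if cau x then (THE l. limitin mtopology (s x) l sequentially) else q 0)" for x
  have h_lim: "limitin mtopology (s x) (h x) sequentially" if "cau x" for x
  proof -
    have "\<exists>!l. limitin mtopology (s x) l sequentially"
      using that compl limitin_metric_unique unfolding cau mcomplete_def by (metis trivial_limit_sequentially)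
    from theI'[OF this] show ?thesis using that unfolding h_def by simp
  qed
  have hQ: "h x = y" if "(x, y) \<in> Q" for x y
  proof -
    have y: "y \<in> X" using that sets.sets_into_space[OF Q] X by (auto simp: space_pair_measure)
    have lim: "limitin mtopology (s x) y sequentially"
      unfolding limitin_metric
    proof (intro conjI allI impI y)
      fix \<epsilon> :: real assume "\<epsilon> > 0"
      then obtain m where m: "1 / real (Suc m) < \<epsilon>" using inv0 by blast
      show "\<forall>\<^sub>F k in sequentially. s x k \<in> X \<and> d (s x k) y < \<epsilon>"
        unfolding eventually_sequentially
      proof (intro exI allI impI conjI)
        fix k assume "m \<le> k"
        then have "1 / real (Suc k) \<le> 1 / real (Suc m)" by (simp add: field_simps)
        then show "d (s x k) y < \<epsilon>" using approx[OF that, of k] m by linarith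
      qed (simp add: s_def qX)
    qed
    then have "cau x" unfolding cau using qX by (intro convergent_imp_MCauchy) (auto simp: s_def)
    then show ?thesis using h_lim[of x] lim limitin_metric_unique by (metis trivial_limit_sequentially)
  qed
  have hX: "h x \<in> X" for x
    using h_lim[of x] limitin_mspace qX unfolding h_def by (cases "cau x") auto
  \<comment> \<open>Closed balls contain the limits of their sequences, so membership of the limit
    in an open set becomes a countable condition on the approximations.\<close>
  have hU: "h x \<in> U \<longleftrightarrow> (\<exists>j m. mcball (q j) (1 / real (Suc m)) \<subseteq> U \<and>
      (\<exists>N. \<forall>k. N \<le> k \<longrightarrow> d (q j) (s x k) \<le> 1 / real (Suc m)))" if x: "cau x" and U: "openin T U" for x U
  proof
    assume "h x \<in> U"
    then obtain r where r: "r > 0" "mball (h x) r \<subseteq> U"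
      using U unfolding top openin_mtopology by blast
    obtain m where m: "1 / real (Suc m) < r / 2" using inv0[of "r/2"] r by auto
    define e where "e = 1 / real (Suc m)"
    have e: "e > 0" "e < r / 2" using m by (simp_all add: e_def)
    obtain j where j: "d (q j) (h x) < e / 2"
      using dense[OF hX[of x], of "e / 2"] e by auto
    have "mcball (q j) e \<subseteq> U"
    proof
      fix z assume z: "z \<in> mcball (q j) e"
      then have "d (h x) z \<le> d (h x) (q j) + d (q j) z" using triangle[of "h x" "q j" z] hX qX by simp
      moreover have "d (q j) z \<le> e" using z by simp
      moreover have "d (h x) (q j) = d (q j) (h x)" by (rule commute)
      ultimately have "d (h x) z < r" using e j by linarith
      then show "z \<in> U" using r(2) z hX by auto
    qed
    moreover have "\<exists>N. \<forall>k. N \<le> k \<longrightarrow> d (q j) (s x k) \<le> e"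
    proof -
      obtain N where N: "\<And>k. k \<ge> N \<Longrightarrow> s x k \<in> X \<and> d (s x k) (h x) < e / 2"
        using h_lim[OF x] half_gt_zero[OF e(1)] unfolding limitin_metric eventually_sequentially by blast
      have "d (q j) (s x k) \<le> e" if "N \<le> k" for k
        using triangle[of "q j" "h x" "s x k"] hX qX N[OF that] j commute[of "h x" "s x k"]
        by auto
      then show ?thesis by blast
    qed
    ultimately show "\<exists>j m. mcball (q j) (1 / real (Suc m)) \<subseteq> U \<and>
      (\<exists>N. \<forall>k. N \<le> k \<longrightarrow> d (q j) (s x k) \<le> 1 / real (Suc m))" unfolding e_def by blast
  next
    assume "\<exists>j m. mcball (q j) (1 / real (Suc m)) \<subseteq> U \<and>
      (\<exists>N. \<forall>k. N \<le> k \<longrightarrow> d (q j) (s x k) \<le> 1 / real (Suc m))"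
    then obtain j m N where jm: "mcball (q j) (1 / real (Suc m)) \<subseteq> U"
      "\<And>k. N \<le> k \<Longrightarrow> d (q j) (s x k) \<le> 1 / real (Suc m)" by blast
    have "h x \<in> mcball (q j) (1 / real (Suc m))"
      using qX jm(2)
      by (intro limitin_closedin[OF h_lim[OF x] closedin_mcball]) 
        (auto simp: eventually_sequentially s_def intro!: exI[of _ N])
    then show "h x \<in> U" using jm(1) by blast
  qed
  have d_meas: "Measurable.pred M (\<lambda>x. d (q j) (s x k) \<le> r)" for j k r
    unfolding s_def by measurable
  have d2_meas: "Measurable.pred M (\<lambda>x. d (s x k) (s x k') < r)" for k k' r
  proof -
    have "Measurable.pred M (\<lambda>x. \<exists>a b. idx k x = a \<and> idx k' x = b \<and> d (q a) (q b) < r)"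
      by measurable
    then show ?thesis by (simp add: s_def)
  qed
  have cau_meas: "Measurable.pred M cau"
    unfolding cau_def using d2_meas by measurable
  have "h \<in> measurable M M"
  proof (rule measurable_sigma_sets)
    show "sets M = sigma_sets (topspace T) {U. openin T U}" "{U. openin T U} \<subseteq> Pow (topspace T)"
      using M' by (auto dest: openin_subset)
    show "h \<in> space M \<rightarrow> topspace T" using hX top by auto
    fix U assume "U \<in> {U. openin T U}"
    then have U: "openin T U" by simp
    have "Measurable.pred M (\<lambda>x. if cau x then (\<exists>j m. mcball (q j) (1 / real (Suc m)) \<subseteq> U \<and>
      (\<exists>N. \<forall>k. N \<le> k \<longrightarrow> d (q j) (s x k) \<le> 1 / real (Suc m))) else q 0 \<in> U)"
      using d_meas cau_meas by measurable
    moreover have "(if cau x then (\<exists>j m. mcball (q j) (1 / real (Suc m)) \<subseteq> U \<and>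
      (\<exists>N. \<forall>k. N \<le> k \<longrightarrow> d (q j) (s x k) \<le> 1 / real (Suc m))) else q 0 \<in> U) = (h x \<in> U)" for x
      using hU[OF _ U, of x] by (auto simp: h_def)
    ultimately have "Measurable.pred M (\<lambda>x. h x \<in> U)" by simp
    then show "h -` U \<inter> space M \<in> sets M"
      by (simp add: pred_def vimage_def Int_def conj_commute)
  qed
  then show ?thesis using that hQ by blast
qed

text \<open>A point of a finite section is isolated in it by some basic open set \<open>U n\<close>.
  The points of \<open>P\<close> that \<open>U n\<close> fails to isolate form the projection of
  \<open>B n\<close>, and these projections have empty intersection. Removing their Borel hulls
  \<open>R n\<close> leaves graphs of partial functions, which cover \<open>P\<close>.\<close>

theorem finite_sections_uniformization:
  assumes M: "polish_measure M T" and P: "P \<in> sets (M \<Otimes>\<^sub>M M)"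
    and fin: "\<And>x. x \<in> space M \<Longrightarrow> finite (P `` {x})"
  obtains h :: "nat \<Rightarrow> 'a \<Rightarrow> 'a"
  where "\<And>n. h n \<in> measurable M M" "\<And>x y. (x, y) \<in> P \<Longrightarrow> \<exists>n. y = h n x"
proof -
  note M' = M[unfolded polish_measure_def]
  have T2: "Hausdorff_space T"
    using M' metrizable_imp_Hausdorff_space completely_metrizable_imp_metrizable_space by blast
  have Psp: "x \<in> space M" "y \<in> space M" if "(x, y) \<in> P" for x y
    using that sets.sets_into_space[OF P] by (auto simp: space_pair_measure)
  obtain U where U: "\<And>n::nat. openin T (U n)" "\<And>V x. openin T V \<Longrightarrow> x \<in> V \<Longrightarrow> \<exists>n. x \<in> U n \<and> U n \<subseteq> V"
    by (rule second_countable_sequence[of T]) (use M' in blast)+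
  have [measurable]: "U n \<in> sets M" for n using U(1) M' by auto
  have sep: "y = y' \<longleftrightarrow> (\<forall>n. y \<in> U n \<longleftrightarrow> y' \<in> U n)" if yy: "y \<in> space M" "y' \<in> space M" for y y'
  proof (rule ccontr)
    assume *: "\<not> ?thesis"
    then have "y \<noteq> y'" by auto
    then obtain V V' where "openin T V" "openin T V'" "y \<in> V" "y' \<in> V'" "V \<inter> V' = {}"
      using T2 yy M' unfolding Hausdorff_space_def disjnt_def by metis
    then show False using U(2)[of V y] * by blast
  qed
  \<comment> \<open>The third coordinate is a point of the same section that witnesses the failure.
    Distinctness is expressed through the sets \<open>U m\<close> so that \<open>B n\<close> is
    Borel.\<close>
  define B where "B n = {z \<in> space ((M \<Otimes>\<^sub>M M) \<Otimes>\<^sub>M M). fst z \<in> P \<and> (fst (fst z), snd z) \<in> P \<and>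
      (snd (fst z) \<notin> U n \<or> snd z \<in> U n \<and> \<not> (\<forall>m. snd (fst z) \<in> U m \<longleftrightarrow> snd z \<in> U m))}" for n
  have fstB: "(x, y) \<in> fst ` B n \<longleftrightarrow> (x, y) \<in> P \<and> (y \<notin> U n \<or> (\<exists>y'. (x, y') \<in> P \<and> y' \<in> U n \<and> y' \<noteq> y))" for x y n
  proof
    assume "(x, y) \<in> fst ` B n"
    then obtain y' where "((x, y), y') \<in> B n" by force
    then show "(x, y) \<in> P \<and> (y \<notin> U n \<or> (\<exists>y'. (x, y') \<in> P \<and> y' \<in> U n \<and> y' \<noteq> y))"
      using sep by (auto simp: B_def)
  next
    assume r: "(x, y) \<in> P \<and> (y \<notin> U n \<or> (\<exists>y'. (x, y') \<in> P \<and> y' \<in> U n \<and> y' \<noteq> y))"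
    then obtain y' where y': "(x, y') \<in> P" "y \<notin> U n \<or> y' \<in> U n \<and> y' \<noteq> y" by blast
    then have "((x, y), y') \<in> B n"
      using r Psp sep[of y y'] by (auto simp: B_def space_pair_measure)
    then show "(x, y) \<in> fst ` B n" by force
  qed
  have BM: "B n \<in> sets ((M \<Otimes>\<^sub>M M) \<Otimes>\<^sub>M M)" for n
    unfolding B_def using P by measurable
  have empty: "(\<Inter>n. fst ` B n) = {}"
  proof (rule ccontr)
    assume "(\<Inter>n. fst ` B n) \<noteq> {}"
    then obtain p where p: "p \<in> (\<Inter>n. fst ` B n)" by blast
    obtain x y where "p = (x, y)" by fastforce
    then have xy: "(x, y) \<in> fst ` B n" for n using p by blast
    then have "(x, y) \<in> P" using fstB by blast
    define F where "F = P `` {x} - {y}"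
    have "finite F" "F \<subseteq> topspace T"
      using fin Psp \<open>(x, y) \<in> P\<close> M' by (auto simp: F_def)
    then have "openin T (topspace T - F)"
      using Hausdorff_imp_t1_space[OF T2] by (meson closedin_def t1_space_closedin_finite)
    moreover have "y \<in> topspace T - F" using Psp \<open>(x, y) \<in> P\<close> M' by (auto simp: F_def)
    ultimately obtain n where "y \<in> U n" "U n \<subseteq> topspace T - F" using U(2) by metis
    then show False using xy[of n] unfolding fstB by (auto simp: F_def)
  qed
  obtain R where R: "\<And>n. R n \<in> sets (M \<Otimes>\<^sub>M M)" "\<And>n. fst ` B n \<subseteq> R n" "(\<Inter>n. R n) = {}"
    by (rule polish_measure_novikov[OF polish_measure_pair[OF polish_measure_pair[OF M M] M]
          polish_measure_pair[OF M M] continuous_map_fst BM empty]) blast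
  define Q where "Q n = P - R n" for n
  have "\<exists>h. h \<in> measurable M M \<and> (\<forall>x y. (x, y) \<in> Q n \<longrightarrow> h x = y)" for n
  proof -
    have "Q n \<in> sets (M \<Otimes>\<^sub>M M)" using P R(1) by (simp add: Q_def)
    moreover have "y = y'" if "(x, y) \<in> Q n" "(x, y') \<in> Q n" for x y y'
    proof -
      have "(x, y) \<notin> fst ` B n" "(x, y') \<notin> fst ` B n" "(x, y) \<in> P" "(x, y') \<in> P"
        using that R(2)[of n] by (auto simp: Q_def)
      then show ?thesis unfolding fstB by blast
    qed
    ultimately show ?thesis by (rule polish_measure_graph_extend[OF M]) blast+
  qed
  then obtain h where h: "\<And>n. h n \<in> measurable M M" "\<And>n x y. (x, y) \<in> Q n \<Longrightarrow> h n x = y"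
    by metis
  have "\<exists>n. y = h n x" if xy: "(x, y) \<in> P" for x y
  proof -
    have "(x, y) \<notin> (\<Inter>n. R n)" using R(3) by simp
    then obtain n where "(x, y) \<in> Q n" using xy by (auto simp: Q_def)
    then show ?thesis using h(2) by metis
  qed
  then show ?thesis using that h(1) by blast
qed

section \<open>Separating families and the enumeration of classes\<close>

lemma standard_borel_iff_polish: "standard_borel M \<longleftrightarrow> (\<exists>T. polish_measure M T)"
  unfolding standard_borel_def polish_measure_def by auto

lemma standard_borel_separating:
  assumes "standard_borel M"
  obtains A :: "nat \<Rightarrow> 'a set"
  where "\<And>n. A n \<in> sets M" "\<And>x y. x \<in> space M \<Longrightarrow> y \<in> space M \<Longrightarrow> x \<noteq> y \<Longrightarrow> \<exists>n. (x \<in> A n) \<noteq> (y \<in> A n)"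
proof -
  obtain T where "polish_measure M T" using assms standard_borel_iff_polish by blast
  note M' = this[unfolded polish_measure_def]
  have T2: "Hausdorff_space T"
    using M' metrizable_imp_Hausdorff_space completely_metrizable_imp_metrizable_space by blast
  obtain U where U: "\<And>n::nat. openin T (U n)" "\<And>V x. openin T V \<Longrightarrow> x \<in> V \<Longrightarrow> \<exists>n. x \<in> U n \<and> U n \<subseteq> V"
    by (rule second_countable_sequence[of T]) (use M' in blast)+
  show ?thesis
  proof (rule that[of U])
    show "U n \<in> sets M" for n using U(1) M' by auto
    fix x y assume xy: "x \<in> space M" "y \<in> space M" "x \<noteq> y"
    then obtain V V' where V: "openin T V" "openin T V'" "x \<in> V" "y \<in> V'" "V \<inter> V' = {}"
      using T2 M' unfolding Hausdorff_space_def disjnt_def by metis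
    then show "\<exists>n. (x \<in> U n) \<noteq> (y \<in> U n)" using U(2)[OF V(1,3)] by blast
  qed
qed

fun word_map :: "(nat \<Rightarrow> 'a \<Rightarrow> 'a) \<Rightarrow> nat list \<Rightarrow> 'a \<Rightarrow> 'a" where
  "word_map h [] x = x"
| "word_map h (n # w) x = word_map h w (h n x)"

lemma measurable_word_map:
  assumes "\<And>n. h n \<in> measurable M M"
  shows "word_map h w \<in> measurable M M"
proof (induction w)
  case (Cons n w)
  have "(\<lambda>x. word_map h w (h n x)) \<in> measurable M M"
    using measurable_compose[OF assms Cons] .
  moreover have "word_map h (n # w) = (\<lambda>x. word_map h w (h n x))" by auto
  ultimately show ?case by simp
next
  case Nil
  have "word_map h [] = (\<lambda>x. x)" by auto
  then show ?case by simp
qed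

text \<open>The uniformization is applied to \<open>G\<close>, whose sections are finite, rather
  than to \<open>E\<close>. Words in the resulting functions follow the paths of the graph, one
  letter for each edge.\<close>

lemma class_enumeration:
  assumes M: "standard_borel M" and E: "countable_borel_equivalence M E"
    and G: "borel_graphing M E G" and lf: "locally_finite_graph (space M) G"
  obtains g :: "nat \<Rightarrow> 'a \<Rightarrow> 'a"
  where "\<And>n. g n \<in> measurable M M" "\<And>x. x \<in> space M \<Longrightarrow> E `` {x} = range (\<lambda>n. g n x)"
proof -
  obtain T where T: "polish_measure M T" using M standard_borel_iff_polish by blast
  have GM: "G \<in> sets (M \<Otimes>\<^sub>M M)" and GE: "Restr (G\<^sup>*) (space M) = E"
    using G by (auto simp: borel_graphing_def)
  have EM: "E \<in> sets (M \<Otimes>\<^sub>M M)" and eq: "equiv (space M) E"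
    using E by (auto simp: countable_borel_equivalence_def)
  obtain h :: "nat \<Rightarrow> 'a \<Rightarrow> 'a" where h: "\<And>n. h n \<in> measurable M M"
    "\<And>x y. (x, y) \<in> G \<Longrightarrow> \<exists>n. y = h n x"
    using finite_sections_uniformization[OF T GM] lf unfolding locally_finite_graph_def by blast
  have word: "\<exists>w. y = word_map h w x" if "(x, y) \<in> G\<^sup>*" for x y
    using that
  proof (induction rule: converse_rtrancl_induct)
    case base
    show ?case by (intro exI[of _ "[]"]) simp
  next
    case (step x z)
    then obtain n w where "z = h n x" "y = word_map h w z" using h(2) by blast
    then show ?case by (intro exI[of _ "n # w"]) simp
  qed
  \<comment> \<open>The letters are total functions, so a word may leave the class; its value is
    then reset to \<open>x\<close>.\<close>
  define g where "g n x = (if (x, word_map h (from_nat n) x) \<in> E then word_map h (from_nat n) x else x)" for n x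
  note [measurable] = measurable_word_map[OF h(1)]
  have "g n \<in> measurable M M" for n
    unfolding g_def using EM by measurable
  moreover have "E `` {x} = range (\<lambda>n. g n x)" if x: "x \<in> space M" for x
  proof (intro equalityI subsetI)
    fix y assume "y \<in> E `` {x}"
    then have "(x, y) \<in> E" by simp
    then obtain w where "y = word_map h w x" using word GE by blast
    then have "y = g (to_nat w) x" using \<open>(x, y) \<in> E\<close> by (simp add: g_def)
    then show "y \<in> range (\<lambda>n. g n x)" by blast
  next
    fix y assume "y \<in> range (\<lambda>n. g n x)"
    then show "y \<in> E `` {x}" using x eq by (auto simp: g_def equiv_def refl_on_def)
  qed
  ultimately show ?thesis using that by blast
qed

section \<open>Walls of a graph with a neighborhood basis of ends\<close>

text \<open>A maximal family all of whose finite intersections have infinite trace on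
  \<open>S\<close>. Infinite trace, rather than mere nonemptiness, later rules out the ultrafilters
  of points.\<close>

lemma ultrafilter_of_infinite:
  assumes S: "infinite (S :: 'a set)"
  obtains \<U> where "\<And>X. X \<in> \<U> \<or> - X \<in> \<U>" "\<And>X Y. X \<in> \<U> \<Longrightarrow> Y \<in> \<U> \<Longrightarrow> X \<inter> Y \<in> \<U>"
    "\<And>X Y. X \<in> \<U> \<Longrightarrow> X \<subseteq> Y \<Longrightarrow> Y \<in> \<U>" "\<And>X. X \<in> \<U> \<Longrightarrow> infinite (S \<inter> X)"
proof -
  define A where "A = {F. \<forall>T. finite T \<and> T \<subseteq> F \<longrightarrow> infinite (S \<inter> \<Inter>T)}"
  have "\<exists>\<U>\<in>A. \<forall>X\<in>A. \<U> \<subseteq> X \<longrightarrow> X = \<U>"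
  proof (rule subset_Zorn')
    fix c assume c: "subset.chain A c"
    show "\<Union>c \<in> A"
      unfolding A_def
    proof (clarify)
      fix T assume T: "finite T" "T \<subseteq> \<Union>c" and fin: "finite (S \<inter> \<Inter>T)"
      show False
      proof (cases "T = {}")
        case True
        then show False using fin S by simp
      next
        case False
        then have "c \<noteq> {}" using T by auto
        then obtain F where "F \<in> c" "T \<subseteq> F"
          using finite_subset_Union_chain[OF T _ c] by blast
        then have "F \<in> A" using c by (auto simp: subset.chain_def)
        then show False using \<open>T \<subseteq> F\<close> T(1) fin by (auto simp: A_def)
      qed
    qed
  qed
  then obtain \<U> where U: "\<U> \<in> A" and max: "\<And>X. X \<in> A \<Longrightarrow> \<U> \<subseteq> X \<Longrightarrow> X = \<U>" by blast
  have inf: "infinite (S \<inter> \<Inter>T)" if "finite T" "T \<subseteq> \<U>" for T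
    using U that by (auto simp: A_def)
  \<comment> \<open>Maximality: a set belongs to \<open>\<U>\<close> as soon as adding it keeps all
    the traces infinite.\<close>
  have memI: "X \<in> \<U>" if X: "\<And>T. finite T \<Longrightarrow> T \<subseteq> \<U> \<Longrightarrow> infinite (S \<inter> \<Inter>T \<inter> X)" for X
  proof -
    have "insert X \<U> \<in> A"
      unfolding A_def
    proof clarify
      fix T assume T: "finite T" "T \<subseteq> insert X \<U>" and fin: "finite (S \<inter> \<Inter>T)"
      have "S \<inter> \<Inter>(T - {X}) \<inter> X \<subseteq> S \<inter> \<Inter>T" by auto
      then have "finite (S \<inter> \<Inter>(T - {X}) \<inter> X)" using fin finite_subset by blast
      moreover have "infinite (S \<inter> \<Inter>(T - {X}) \<inter> X)" using T by (intro X) auto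
      ultimately show False by blast
    qed
    then show ?thesis using max[of "insert X \<U>"] by blast
  qed
  show ?thesis
  proof (rule that[of \<U>])
    show "X \<in> \<U> \<or> - X \<in> \<U>" for X
    proof (rule ccontr)
      assume *: "\<not> (X \<in> \<U> \<or> - X \<in> \<U>)"
      obtain T where T: "finite T" "T \<subseteq> \<U>" "finite (S \<inter> \<Inter>T \<inter> X)" using * memI[of X] by blast
      obtain T' where T': "finite T'" "T' \<subseteq> \<U>" "finite (S \<inter> \<Inter>T' \<inter> - X)" using * memI[of "- X"] by blast
      have "S \<inter> \<Inter>(T \<union> T') \<subseteq> (S \<inter> \<Inter>T \<inter> X) \<union> (S \<inter> \<Inter>T' \<inter> - X)" by auto
      then have "finite (S \<inter> \<Inter>(T \<union> T'))" using T T' finite_subset by blast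
      then show False using inf[of "T \<union> T'"] T T' by blast
    qed
    show "X \<inter> Y \<in> \<U>" if "X \<in> \<U>" "Y \<in> \<U>" for X Y
    proof (rule memI)
      fix T assume "finite T" "T \<subseteq> \<U>"
      then have "infinite (S \<inter> \<Inter>(insert X (insert Y T)))" using that by (intro inf) auto
      moreover have "S \<inter> \<Inter>(insert X (insert Y T)) = S \<inter> \<Inter>T \<inter> (X \<inter> Y)" by auto
      ultimately show "infinite (S \<inter> \<Inter>T \<inter> (X \<inter> Y))" by simp
    qed
    show "Y \<in> \<U>" if "X \<in> \<U>" "X \<subseteq> Y" for X Y
    proof (rule memI)
      fix T assume "finite T" "T \<subseteq> \<U>"
      then have "infinite (S \<inter> \<Inter>(insert X T))" using that by (intro inf) auto
      moreover have "S \<inter> \<Inter>(insert X T) \<subseteq> S \<inter> \<Inter>T \<inter> Y" using that by auto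
      ultimately show "infinite (S \<inter> \<Inter>T \<inter> Y)" using finite_subset by blast
    qed
    show "infinite (S \<inter> X)" if "X \<in> \<U>" for X using inf[of "{X}"] that by simp
  qed
qed

text \<open>For subsets of \<open>C\<close> this says that no side of one wall lies in a side of the
  other, so that neither choice of side constrains the other.\<close>

definition crossing :: "'a set \<Rightarrow> 'a set \<Rightarrow> 'a set \<Rightarrow> bool" where
  "crossing C K L \<longleftrightarrow> K \<inter> L \<noteq> {} \<and> K - L \<noteq> {} \<and> L - K \<noteq> {} \<and> C - (K \<union> L) \<noteq> {}"

text \<open>Both sides of a wall are members, so that an orientation can choose between them,
  although \<open>\<H>\<close> need not be closed under complement.\<close>

definition walls :: "'a set \<Rightarrow> 'a set set \<Rightarrow> 'a set set" where
  "walls C \<H> = {H. H \<subseteq> C \<and> H \<noteq> {} \<and> H \<noteq> C \<and> (H \<in> \<H> \<or> C - H \<in> \<H>)}"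

lemma vertex_boundary_compl:
  "H \<subseteq> C \<Longrightarrow> vertex_boundary G C (C - H) = vertex_boundary G C H"
  by (auto simp: vertex_boundary_def outer_boundary_def double_diff)

lemma rtrancl_leaves:
  "(x, y) \<in> R\<^sup>* \<Longrightarrow> x \<in> K \<Longrightarrow> y \<notin> K \<Longrightarrow> \<exists>u v. (u, v) \<in> R \<and> u \<in> K \<and> v \<notin> K"
  by (induction rule: rtrancl_induct) auto

locale end_basis_graph =
  fixes G :: "('a \<times> 'a) set" and C :: "'a set" and \<H> :: "'a set set"
  assumes sym: "sym G" and closed: "\<And>x y. (x, y) \<in> G \<Longrightarrow> x \<in> C \<Longrightarrow> y \<in> C"
    and conn: "\<And>x y. x \<in> C \<Longrightarrow> y \<in> C \<Longrightarrow> (x, y) \<in> G\<^sup>*"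
    and locally_finite: "\<And>x. x \<in> C \<Longrightarrow> finite (G `` {x})"
    and half_space: "\<And>H. H \<in> \<H> \<Longrightarrow> H \<subseteq> C \<and> finite (vertex_boundary G C H) \<and>
           connected_set G H \<and> connected_set G (C - H)"
    and finite_boundaries: "\<And>x. x \<in> C \<Longrightarrow> finite {H \<in> \<H>. x \<in> vertex_boundary G C H}"
    and end_basis: "\<And>U A. graph_end G C U \<Longrightarrow> A \<in> U \<Longrightarrow> \<exists>H \<in> \<H>. H \<in> U \<and> H \<subseteq> A"
begin

lemma wallsD:
  assumes "H \<in> walls C \<H>"
  shows "H \<subseteq> C" "H \<noteq> {}" "H \<noteq> C" "C - H \<in> walls C \<H>" "finite (vertex_boundary G C H)"
    "connected_set G H" "connected_set G (C - H)"
proof -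
  show H: "H \<subseteq> C" "H \<noteq> {}" "H \<noteq> C" using assms by (auto simp: walls_def)
  show "C - H \<in> walls C \<H>" using assms H by (auto simp: walls_def double_diff)
  have dd: "C - (C - H) = H" using H(1) by (simp add: double_diff)
  consider "H \<in> \<H>" | "C - H \<in> \<H>" using assms by (auto simp: walls_def)
  then have "finite (vertex_boundary G C H) \<and> connected_set G H \<and> connected_set G (C - H)"
  proof cases
    case 1
    then show ?thesis using half_space by blast
  next
    case 2
    then show ?thesis using half_space[OF 2] unfolding dd vertex_boundary_compl[OF H(1)] by blast
  qed
  then show "finite (vertex_boundary G C H)" "connected_set G H" "connected_set G (C - H)"
    by blast+
qed

lemma finite_walls_boundary:
  assumes "x \<in> C" shows "finite {H \<in> walls C \<H>. x \<in> vertex_boundary G C H}"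
proof (rule finite_subset)
  show "{H \<in> walls C \<H>. x \<in> vertex_boundary G C H} \<subseteq>
      {H \<in> \<H>. x \<in> vertex_boundary G C H} \<union> (\<lambda>H. C - H) ` {H \<in> \<H>. x \<in> vertex_boundary G C H}"
  proof
    fix H assume H: "H \<in> {H \<in> walls C \<H>. x \<in> vertex_boundary G C H}"
    then have HC: "H \<subseteq> C" "H \<in> \<H> \<or> C - H \<in> \<H>" and xH: "x \<in> vertex_boundary G C H"
      by (simp_all add: walls_def)
    have dd: "H = C - (C - H)" using HC(1) by (simp add: double_diff)
    show "H \<in> {H \<in> \<H>. x \<in> vertex_boundary G C H} \<union> (\<lambda>H. C - H) ` {H \<in> \<H>. x \<in> vertex_boundary G C H}"
    proof (cases "H \<in> \<H>")
      case False
      then have "C - H \<in> {H \<in> \<H>. x \<in> vertex_boundary G C H}"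
        using HC xH vertex_boundary_compl[OF HC(1), of G] by simp
      then show ?thesis using dd by (intro UnI2 image_eqI[of H _ "C - H"])
    qed (use xH in simp)
  qed
qed (use finite_boundaries[OF assms] in simp)

text \<open>\<open>F\<close> consists of the vertices of a path except the last occurrence of its
  end: a path that leaves \<open>H\<close> does so from one of these.\<close>

lemma finite_path_meets_boundaries:
  assumes "(x, y) \<in> G\<^sup>*" "x \<in> C"
  shows "y \<in> C \<and> (\<exists>F. finite F \<and> F \<subseteq> C \<and>
    (\<forall>H\<subseteq>C. x \<in> H \<and> y \<notin> H \<longrightarrow> F \<inter> vertex_boundary G C H \<noteq> {}))"
  using assms
proof (induction rule: rtrancl_induct)
  case base
  then show ?case by auto
next
  case (step y z)
  from step.IH[OF step.prems] obtain F where F: "finite F" "F \<subseteq> C" "y \<in> C"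
    "\<forall>H\<subseteq>C. x \<in> H \<and> y \<notin> H \<longrightarrow> F \<inter> vertex_boundary G C H \<noteq> {}"
    by (elim conjE exE)
  have z: "z \<in> C" using closed[OF step.hyps(2) F(3)] .
  have "insert y F \<inter> vertex_boundary G C H \<noteq> {}" if "H \<subseteq> C" "x \<in> H" "z \<notin> H" for H
  proof (cases "y \<in> H")
    case True
    then have "y \<in> vertex_boundary G C H"
      using that step.hyps(2) z by (auto simp: vertex_boundary_def inner_boundary_def)
    then show ?thesis by blast
  qed (use F(4) that in blast)
  then show ?case using F z by (intro conjI exI[of _ "insert y F"]) auto
qed

text \<open>All separating walls have a boundary vertex on one fixed path, and
  \<open>finite_boundaries\<close> allows finitely many of them at each vertex.\<close>

lemma finite_separating:
  assumes "x \<in> C" "y \<in> C" shows "finite {H \<in> walls C \<H>. x \<in> H \<and> y \<notin> H}"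
proof -
  obtain F where F: "finite F" "F \<subseteq> C"
    "\<forall>H\<subseteq>C. x \<in> H \<and> y \<notin> H \<longrightarrow> F \<inter> vertex_boundary G C H \<noteq> {}"
    using finite_path_meets_boundaries[OF conn[OF assms] assms(1)] by (elim conjE exE)
  have "{H \<in> walls C \<H>. x \<in> H \<and> y \<notin> H} \<subseteq> (\<Union>v\<in>F. {H \<in> walls C \<H>. v \<in> vertex_boundary G C H})"
  proof
    fix H assume H: "H \<in> {H \<in> walls C \<H>. x \<in> H \<and> y \<notin> H}"
    then have "H \<subseteq> C" "x \<in> H" "y \<notin> H" using wallsD(1)[of H] by simp_all
    then have "F \<inter> vertex_boundary G C H \<noteq> {}" using F(3) by simp
    then show "H \<in> (\<Union>v\<in>F. {H \<in> walls C \<H>. v \<in> vertex_boundary G C H})" using H by blast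
  qed
  moreover have "finite (\<Union>v\<in>F. {H \<in> walls C \<H>. v \<in> vertex_boundary G C H})"
    using F(1,2) by (intro finite_UN_I finite_walls_boundary) auto
  ultimately show ?thesis by (rule finite_subset)
qed

lemma connected_meets_boundary:
  assumes "connected_set G L" "L \<subseteq> C" "L \<inter> K \<noteq> {}" "L - K \<noteq> {}"
  shows "\<exists>u\<in>L. u \<in> vertex_boundary G C K"
proof -
  obtain x y where "x \<in> L" "x \<in> K" "y \<in> L" "y \<notin> K" using assms by blast
  then have "(x, y) \<in> (Restr G L)\<^sup>*" using assms by (auto simp: connected_set_def)
  from rtrancl_leaves[OF this \<open>x \<in> K\<close> \<open>y \<notin> K\<close>]
  obtain u v where "u \<in> L" "v \<in> L" "(u, v) \<in> G" "u \<in> K" "v \<notin> K" by blast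
  then have "u \<in> inner_boundary G C K" using assms(2) by (auto simp: inner_boundary_def)
  then show ?thesis using \<open>u \<in> L\<close> by (auto simp: vertex_boundary_def)
qed

text \<open>If \<open>L\<close> crosses \<open>K\<close>, then \<open>L\<close> and
  \<open>C - L\<close> are connected and meet both sides of \<open>K\<close>, so each contains a
  vertex of the finite boundary of \<open>K\<close>. Hence \<open>L\<close> separates two of these
  vertices.\<close>

lemma finite_crossing:
  assumes K: "K \<in> walls C \<H>" shows "finite {L \<in> walls C \<H>. crossing C K L}"
proof (rule finite_subset)
  let ?B = "vertex_boundary G C K"
  have BC: "?B \<subseteq> C" using wallsD(1)[OF K] by (auto simp: vertex_boundary_def outer_boundary_def inner_boundary_def)
  show "{L \<in> walls C \<H>. crossing C K L} \<subseteq> (\<Union>u\<in>?B. \<Union>v\<in>?B. {L \<in> walls C \<H>. u \<in> L \<and> v \<notin> L})"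
  proof
    fix L assume "L \<in> {L \<in> walls C \<H>. crossing C K L}"
    then have L: "L \<in> walls C \<H>" and cr: "crossing C K L" by auto
    note W = wallsD[OF L] 
    obtain u where "u \<in> L" "u \<in> ?B"
      using connected_meets_boundary[OF W(6,1), of K] cr by (auto simp: crossing_def)
    moreover obtain v where "v \<in> C - L" "v \<in> ?B"
      using connected_meets_boundary[OF W(7), of K] cr wallsD(1)[OF K] by (auto simp: crossing_def)
    ultimately show "L \<in> (\<Union>u\<in>?B. \<Union>v\<in>?B. {L \<in> walls C \<H>. u \<in> L \<and> v \<notin> L})" using L by blast
  qed
  show "finite (\<Union>u\<in>?B. \<Union>v\<in>?B. {L \<in> walls C \<H>. u \<in> L \<and> v \<notin> L})"
    using wallsD(5)[OF K] BC by (intro finite_UN_I finite_separating) auto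
qed

lemma fin_boundary_sets_compl: "H \<in> fin_boundary_sets G C \<Longrightarrow> C - H \<in> fin_boundary_sets G C"
  by (auto simp: fin_boundary_sets_def vertex_boundary_compl)

lemma fin_boundary_sets_Int:
  assumes "H \<in> fin_boundary_sets G C" "K \<in> fin_boundary_sets G C"
  shows "H \<inter> K \<in> fin_boundary_sets G C"
proof -
  have "vertex_boundary G C (H \<inter> K) \<subseteq> vertex_boundary G C H \<union> vertex_boundary G C K"
    by (auto simp: vertex_boundary_def outer_boundary_def inner_boundary_def)
  then show ?thesis using assms finite_subset by (fastforce simp: fin_boundary_sets_def)
qed

text \<open>Local finiteness enters here. Since singletons are in the algebra, an ultrafilter whose
  members have infinite traces is not that of a point.\<close>

lemma fin_boundary_sets_singleton:
  assumes "x \<in> C" shows "{x} \<in> fin_boundary_sets G C"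
proof -
  have "vertex_boundary G C {x} \<subseteq> insert x (G `` {x})"
    using sym by (auto simp: vertex_boundary_def outer_boundary_def inner_boundary_def sym_def)
  then show ?thesis using assms locally_finite[OF assms] finite_subset
    by (fastforce simp: fin_boundary_sets_def)
qed

lemma end_of_infinite:
  assumes S: "infinite S" "S \<subseteq> C"
  obtains U where "graph_end G C U" "\<And>A. A \<in> U \<Longrightarrow> infinite (S \<inter> A)"
proof -
  obtain \<U> where U: "\<And>X. X \<in> \<U> \<or> - X \<in> \<U>" "\<And>X Y. X \<in> \<U> \<Longrightarrow> Y \<in> \<U> \<Longrightarrow> X \<inter> Y \<in> \<U>"
    "\<And>X Y. X \<in> \<U> \<Longrightarrow> X \<subseteq> Y \<Longrightarrow> Y \<in> \<U>" "\<And>X. X \<in> \<U> \<Longrightarrow> infinite (S \<inter> X)"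
    by (rule ultrafilter_of_infinite[OF S(1)]) blast
  define U where "U = \<U> \<inter> fin_boundary_sets G C"
  have C: "C \<in> \<U>"
  proof -
    have "S \<inter> - C = {}" using S by auto
    then have "- C \<notin> \<U>" using U(4)[of "- C"] by auto
    then show ?thesis using U(1) by blast
  qed
  have compl: "C - A \<in> \<U>" if "A \<notin> \<U>" for A
    using U(1)[of A] U(2)[OF C, of "- A"] that by (simp add: Diff_eq)
  have "graph_end G C U"
    unfolding graph_end_def ultrafilter_on_def
  proof (intro conjI ballI impI notI)
    show "U \<subseteq> fin_boundary_sets G C" by (simp add: U_def)
    have "C - {} \<in> fin_boundary_sets G C"
      by (rule fin_boundary_sets_compl) 
        (simp add: fin_boundary_sets_def vertex_boundary_def outer_boundary_def inner_boundary_def)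
    then show "C \<in> U" using C by (simp add: U_def)
    show False if "{} \<in> U" using U(4)[of "{}"] that by (simp add: U_def)
    show "A \<inter> A' \<in> U" if "A \<in> U" "A' \<in> U" for A A'
      using that U(2) fin_boundary_sets_Int by (simp add: U_def)
    show "A' \<in> U" if "A \<in> U" "A' \<in> fin_boundary_sets G C" "A \<subseteq> A'" for A A'
      using that U(3) by (auto simp: U_def)
    show "A \<in> U \<or> C - A \<in> U" if "A \<in> fin_boundary_sets G C" for A
      using that compl[of A] fin_boundary_sets_compl[OF that] by (auto simp: U_def)
    assume "\<exists>x. x \<in> C \<and> U = {H \<in> fin_boundary_sets G C. x \<in> H}"
    then obtain x where x: "x \<in> C" "U = {H \<in> fin_boundary_sets G C. x \<in> H}" by blast
    then have "{x} \<in> \<U>" using fin_boundary_sets_singleton[OF x(1)] by (auto simp: U_def)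
    then show False using U(4)[of "{x}"] by simp
  qed
  then show ?thesis using that[of U] U(4) by (auto simp: U_def)
qed

text \<open>The neighborhood bases of ends are used here. Infinitely many points of the ball
  accumulate at an end, around which there are arbitrarily many nested half-spaces that exclude
  \<open>x\<close>. A point of the ball inside enough of them is separated from \<open>x\<close> by
  more than \<open>d\<close> walls.\<close>

lemma finite_wall_ball:
  assumes x: "x \<in> C" shows "finite {y \<in> C. card {H \<in> walls C \<H>. x \<in> H \<and> y \<notin> H} \<le> d}" (is "finite ?S")
proof (rule ccontr)
  assume "infinite ?S"
  then obtain U where U: "graph_end G C U" "\<And>A. A \<in> U \<Longrightarrow> infinite (?S \<inter> A)"
    using end_of_infinite[of ?S] by blast
  have uf: "ultrafilter_on C (fin_boundary_sets G C) U" using U(1) by (simp add: graph_end_def)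
  then have Uint: "A \<inter> A' \<in> U" if "A \<in> U" "A' \<in> U" for A A'
    using that unfolding ultrafilter_on_def by blast
  have UC: "A \<subseteq> C" if "A \<in> U" for A
    using uf that by (auto simp: ultrafilter_on_def fin_boundary_sets_def)
  have remove: "C - {h} \<in> U" if "h \<in> C" for h
  proof -
    have "{h} \<in> U \<or> C - {h} \<in> U"
      using uf fin_boundary_sets_singleton[OF that] unfolding ultrafilter_on_def by blast
    moreover have "{h} \<notin> U"
    proof
      assume "{h} \<in> U"
      from U(2)[OF this] show False by simp
    qed
    ultimately show ?thesis by blast
  qed
  have "\<exists>\<K> A. finite \<K> \<and> card \<K> = n \<and> A \<in> U \<and> x \<notin> A \<and>
      (\<forall>H\<in>\<K>. H \<in> \<H> \<and> x \<notin> H \<and> A \<subseteq> H)" for n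
  proof (induction n)
    case 0
    show ?case using remove[OF x] by (intro exI[of _ "{}"] exI[of _ "C - {x}"]) auto
  next
    case (Suc n)
    then obtain \<K> A where K: "finite \<K>" "card \<K> = n" "A \<in> U" "x \<notin> A"
      "\<forall>H\<in>\<K>. H \<in> \<H> \<and> x \<notin> H \<and> A \<subseteq> H" by blast
    have "A \<noteq> {}" using U(2)[OF K(3)] by auto
    \<comment> \<open>Removing a point of \<open>A\<close> forces the next half-space to be strictly
      smaller than \<open>A\<close>, hence different from all earlier ones.\<close>
    then obtain h where h: "h \<in> A" by blast
    then have "A \<inter> (C - {h}) \<in> U" using Uint remove UC[OF K(3)] K(3) by blast
    then obtain H where H: "H \<in> \<H>" "H \<in> U" "H \<subseteq> A \<inter> (C - {h})" using end_basis[OF U(1)] by blast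
    then have "H \<notin> \<K>" using h K(5) by blast
    then have "card (insert H \<K>) = Suc n" using K by simp
    then show ?case using K H
      by (intro exI[of _ "insert H \<K>"] exI[of _ H]) auto
  qed
  then obtain \<K> A where K: "finite \<K>" "card \<K> = Suc d" "A \<in> U"
      "\<And>H. H \<in> \<K> \<Longrightarrow> H \<in> \<H> \<and> x \<notin> H \<and> A \<subseteq> H" by metis
  have "?S \<inter> A \<noteq> {}" using U(2)[OF K(3)] by (metis finite.emptyI)
  then obtain y where y: "y \<in> C" "y \<in> A" "card {H \<in> walls C \<H>. x \<in> H \<and> y \<notin> H} \<le> d" by blast
  \<comment> \<open>The half-spaces found contain \<open>y\<close>, while the counted ones contain
    \<open>x\<close>; hence the complements.\<close>
  have "(\<lambda>H. C - H) ` \<K> \<subseteq> {H \<in> walls C \<H>. x \<in> H \<and> y \<notin> H}"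
  proof
    fix L assume "L \<in> (\<lambda>H. C - H) ` \<K>"
    then obtain H where L: "L = C - H" "H \<in> \<K>" by blast
    have "H \<subseteq> C" "H \<in> \<H>" "x \<notin> H" "y \<in> H" using K(4)[OF L(2)] half_space y(2) by auto
    then show "L \<in> {H \<in> walls C \<H>. x \<in> H \<and> y \<notin> H}"
      using x y by (auto simp: L walls_def double_diff)
  qed
  then have "card ((\<lambda>H. C - H) ` \<K>) \<le> d"
    using card_mono[OF finite_separating[OF x y(1)]] y(3) by (meson order_trans)
  moreover have "inj_on (\<lambda>H. C - H) \<K>"
    using K(4) half_space by (intro inj_onI) (metis double_diff subset_refl)
  ultimately show False using K(2) by (simp add: card_image)
qed

end

section \<open>Acyclic graphs\<close>

text \<open>Reading the list as a periodic sequence removes the case distinction at its end from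
  arguments about consecutive edges.\<close>

lemma graph_cycle_periodic:
  assumes "graph_cycle R xs"
  obtains s :: "nat \<Rightarrow> 'a" and m where "m \<ge> 3" "\<And>i. (s i, s (Suc i)) \<in> R"
    "\<And>i j. s i = s j \<longleftrightarrow> i mod m = j mod m" "m = length xs" "\<And>i. s i = xs ! (i mod m)"
proof -
  define m where "m = length xs"
  have m: "m \<ge> 3" "distinct xs" and e: "\<And>i. i < m \<Longrightarrow> (xs ! i, xs ! (Suc i mod m)) \<in> R"
    using assms by (auto simp: graph_cycle_def m_def)
  define s where "s i = xs ! (i mod m)" for i
  have lt: "i mod m < m" for i using m(1) by simp
  show ?thesis
  proof (rule that[of m s])
    show "(s i, s (Suc i)) \<in> R" for i
      using e[OF lt[of i]] by (simp add: s_def mod_Suc_eq)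
    show "s i = s j \<longleftrightarrow> i mod m = j mod m" for i j
      using nth_eq_iff_index_eq[OF m(2)] lt by (simp add: s_def m_def)
  qed (use m m_def in \<open>simp_all add: s_def\<close>)
qed

text \<open>A shortest walk from \<open>w\<close> to \<open>v\<close> that avoids the edge has
  distinct vertices and length at least 2, so the edge would close it to a cycle.\<close>

lemma bridge_of_acyclic_graph:
  assumes ac: "acyclic_graph R" and vw: "(v, w) \<in> R" "v \<noteq> w"
  shows "(w, v) \<notin> (R - {(v, w), (w, v)})\<^sup>*"
proof
  let ?R = "R - {(v, w), (w, v)}"
  assume "(w, v) \<in> ?R\<^sup>*"
  then have ex: "\<exists>n. (w, v) \<in> ?R ^^ n" by (simp add: rtrancl_power)
  define n where "n = (LEAST n. (w, v) \<in> ?R ^^ n)"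
  have n: "(w, v) \<in> ?R ^^ n" unfolding n_def by (rule LeastI_ex[OF ex])
  have least: "(w, v) \<notin> ?R ^^ k" if "k < n" for k
    using that not_less_Least unfolding n_def by blast
  obtain f where f: "f 0 = w" "f n = v" "\<And>i. i < n \<Longrightarrow> (f i, f (Suc i)) \<in> ?R"
    using n unfolding relpow_fun_conv by blast
  have part: "(f i, f j) \<in> ?R ^^ (j - i)" if "i \<le> j" "j \<le> n" for i j
    unfolding relpow_fun_conv using that f(3) by (intro exI[of _ "\<lambda>k. f (i + k)"]) auto
  have neq: "f i \<noteq> f j" if "i < j" "j \<le> n" for i j
  proof
    assume eq: "f i = f j"
    have "(w, f i) \<in> ?R ^^ i" using part[of 0 i] that f(1) by simp
    moreover have "(f i, v) \<in> ?R ^^ (n - j)" using part[of j n] that f(2) eq by simp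
    ultimately have "(w, v) \<in> ?R ^^ (i + (n - j))" unfolding relpow_add by blast
    moreover have "i + (n - j) < n" using that by simp
    ultimately show False using least by blast
  qed
  have "n \<noteq> 0" using f vw by metis
  moreover have "n \<noteq> 1" using f(1,2) f(3)[of 0] by auto
  ultimately have "n \<ge> 2" by simp
  have "graph_cycle R (map f [0..<Suc n])"
    unfolding graph_cycle_def
  proof (intro conjI allI impI)
    show "3 \<le> length (map f [0..<Suc n])" using \<open>n \<ge> 2\<close> by simp
    have "inj_on f {0..<Suc n}"
      using neq by (intro linorder_inj_onI) (auto simp: less_Suc_eq_le)
    then show "distinct (map f [0..<Suc n])" by (simp only: distinct_map distinct_upt set_upt simp_thms)
    fix i assume "i < length (map f [0..<Suc n])"
    then have i: "i \<le> n" by simp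
    show "(map f [0..<Suc n] ! i, map f [0..<Suc n] ! (Suc i mod length (map f [0..<Suc n]))) \<in> R"
    proof (cases "i = n")
      case True
      then show ?thesis using f vw by (simp del: upt_Suc)
    next
      case False
      then have "Suc i mod Suc n = Suc i" using i by simp
      then show ?thesis using f(3)[of i] i False by (simp del: upt_Suc)
    qed
  qed
  then show False using ac unfolding acyclic_graph_def by blast
qed

text \<open>Contracting the fibres of \<open>r\<close> to points keeps a graph acyclic, provided that the fibres are
  connected: a cycle in the quotient lifts to a closed walk that uses one edge only once.\<close>

lemma acyclic_graph_contraction:
  assumes ac: "acyclic_graph R"
    and fib: "\<And>v w. v \<in> V \<Longrightarrow> w \<in> V \<Longrightarrow> r v = r w \<Longrightarrow> (v, w) \<in> {(v, w) \<in> R. r v = r w}\<^sup>*"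
    and RV: "R \<subseteq> V \<times> V"
  shows "acyclic_graph {(a, b). a \<noteq> b \<and> (\<exists>(v, w) \<in> R. r v = a \<and> r w = b)}"
  unfolding acyclic_graph_def
proof
  assume "\<exists>xs. graph_cycle {(a, b). a \<noteq> b \<and> (\<exists>(v, w) \<in> R. r v = a \<and> r w = b)} xs"
  then obtain xs where "graph_cycle {(a, b). a \<noteq> b \<and> (\<exists>(v, w) \<in> R. r v = a \<and> r w = b)} xs" ..
  then obtain s m where m: "m \<ge> 3" and
    s: "\<And>i. (s i, s (Suc i)) \<in> {(a, b). a \<noteq> b \<and> (\<exists>(v, w) \<in> R. r v = a \<and> r w = b)}" and
    per: "\<And>i j. s i = s j \<longleftrightarrow> i mod m = j mod m"
    by (rule graph_cycle_periodic) blast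
  have "\<exists>v w. (v, w) \<in> R \<and> r v = s i \<and> r w = s (Suc i)" for i using s[of i] by auto
  then obtain v w where vw: "\<And>i. (v i, w i) \<in> R" "\<And>i. r (v i) = s i" "\<And>i. r (w i) = s (Suc i)"
    by metis
  let ?R = "R - {(v 0, w 0), (w 0, v 0)}"
  have s01: "s 0 \<noteq> s (Suc 0)" using s[of 0] by auto
  have sub: "{(v, w) \<in> R. r v = r w} \<subseteq> ?R" using vw(2,3)[of 0] s01 by auto
  have fib': "(a, b) \<in> ?R\<^sup>*" if "a \<in> V" "b \<in> V" "r a = r b" for a b
    using fib[OF that] rtrancl_mono[OF sub] by blast
  have inV: "v i \<in> V" "w i \<in> V" for i using vw(1)[of i] RV by auto
  have edge: "(v i, w i) \<in> ?R" if "1 \<le> i" "i < m" for i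
  proof -
    have "s i \<noteq> s 0" using that per by simp
    then have "v i \<noteq> v 0" using vw(2) by metis
    \<comment> \<open>The edge could recur in reverse only for \<open>i = 1\<close> and
      \<open>m\<close> dividing 2, which \<open>m \<ge> 3\<close> excludes.\<close>
    moreover have "(v i, w i) \<noteq> (w 0, v 0)"
    proof
      assume "(v i, w i) = (w 0, v 0)"
      then have "s i = s (Suc 0)" "s (Suc i) = s 0" using vw by (metis prod.inject)+
      then have "i mod m = 1 mod m" "Suc i mod m = 0 mod m" using per by (metis One_nat_def)+
      then have "i = 1" "Suc i mod m = 0" using that by auto
      then show False using m by simp
    qed
    ultimately show ?thesis using vw(1)[of i] by auto
  qed
  have walk: "(w 0, w i) \<in> ?R\<^sup>*" if "i < m" for i
    using that
  proof (induction i)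
    case (Suc i)
    then have "(w 0, w i) \<in> ?R\<^sup>*" by simp
    also have "(w i, v (Suc i)) \<in> ?R\<^sup>*" using vw by (intro fib' inV) simp
    also have "(v (Suc i), w (Suc i)) \<in> ?R" using Suc.prems by (intro edge) auto
    finally show ?case .
  qed simp
  have "(w 0, w (m - 1)) \<in> ?R\<^sup>*" using m by (intro walk) simp
  also have "(w (m - 1), v 0) \<in> ?R\<^sup>*"
    using vw m per[of m 0] by (intro fib' inV) simp
  finally have "(w 0, v 0) \<in> ?R\<^sup>*" .
  moreover have "v 0 \<noteq> w 0" using vw s01 by metis
  ultimately show False using bridge_of_acyclic_graph[OF ac vw(1)[of 0]] by blast
qed

section \<open>Orientations and the tree on them\<close>

text \<open>The orientation pointing every wall towards \<open>x\<close>; distinct points may share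
  it.\<close>

definition hat :: "'a set set \<Rightarrow> 'a \<Rightarrow> 'a set set" where
  "hat W x = {H \<in> W. x \<in> H}"

text \<open>The vertices of the median graph dual to the walls.\<close>

definition orientations :: "'a set \<Rightarrow> 'a set set \<Rightarrow> 'a set set set" where
  "orientations C W = {y. y \<subseteq> W \<and> (\<forall>H\<in>W. H \<in> y \<longleftrightarrow> C - H \<notin> y) \<and>
     (\<forall>H\<in>W. \<forall>K\<in>W. H \<in> y \<and> K \<in> y \<longrightarrow> H \<inter> K \<noteq> {}) \<and> (\<exists>x\<in>C. finite (y - hat W x))}"

text \<open>The set on which \<open>col\<close> has to be injective: then crossing walls get
  different colors, and the colors alone describe which sides of the walls crossing \<open>K\<close>
  an orientation chooses.\<close>

definition hyperplane :: "'a set \<Rightarrow> 'a set set \<Rightarrow> 'a set \<Rightarrow> 'a set set" where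
  "hyperplane C W K = {L \<in> W. L = K \<or> L = C - K \<or> crossing C K L}"

text \<open>The coloring distinguishes the two sides of a wall; the minimum assigns one color to the
  wall itself.\<close>

definition wall_color :: "'a set \<Rightarrow> ('a set \<Rightarrow> nat) \<Rightarrow> 'a set \<Rightarrow> nat" where
  "wall_color C col H = min (col H) (col (C - H))"

text \<open>An edge of the median graph dual to \<open>K\<close>, directed from the side
  \<open>K\<close> to the side \<open>C - K\<close>.\<close>

definition flip :: "'a set \<Rightarrow> 'a set set \<Rightarrow> 'a set \<Rightarrow> 'a set set \<Rightarrow> 'a set set \<Rightarrow> bool" where
  "flip C W K y y' \<longleftrightarrow> K \<in> y \<and> C - K \<in> y' \<and>
     (\<forall>L\<in>W. L \<noteq> K \<and> L \<noteq> C - K \<longrightarrow> (L \<in> y \<longleftrightarrow> L \<in> y'))"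

definition flip_code :: "'a set \<Rightarrow> 'a set set \<Rightarrow> ('a set \<Rightarrow> nat) \<Rightarrow> 'a set \<Rightarrow> 'a set set \<Rightarrow> nat" where
  "flip_code C W col K y = set_encode (col ` {L \<in> W. L \<in> y \<and> crossing C K L})"

text \<open>Only finitely many walls cross \<open>K\<close>, and they decide which edge dual to \<open>K\<close> is meant; so
  \<open>flip_code\<close> is injective on these edges, and minimizing it selects a single one.\<close>

definition tree_edges :: "'a set \<Rightarrow> 'a set set \<Rightarrow> ('a set \<Rightarrow> nat) \<Rightarrow> ('a set set \<times> 'a set set) set" where
  "tree_edges C W col = {(y, y'). y \<in> orientations C W \<and> y' \<in> orientations C W \<and>
     (\<exists>K\<in>W. flip C W K y y' \<and>
       (\<forall>z\<in>orientations C W. \<forall>z'\<in>orientations C W. flip C W K z z' \<and>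
          (\<forall>H\<in>W. H \<in> z \<and> H \<notin> y \<longrightarrow> wall_color C col H < wall_color C col K) \<longrightarrow>
          flip_code C W col K y \<le> flip_code C W col K z))}"

definition nearest ::
  "'a set \<Rightarrow> 'a set set \<Rightarrow> ('a set \<Rightarrow> nat) \<Rightarrow> 'a set set \<Rightarrow> 'a \<Rightarrow> bool" where
  "nearest C W col y x \<longleftrightarrow> x \<in> C \<and> (\<exists>n. (y, hat W x) \<in> tree_edges C W col ^^ n \<and>
     (\<forall>x'\<in>C. \<forall>m<n. (y, hat W x') \<notin> tree_edges C W col ^^ m))"

definition wall_dist :: "'a set set \<Rightarrow> 'a set set \<Rightarrow> 'a \<Rightarrow> nat" where
  "wall_dist W y x = card {H \<in> W. H \<in> y \<and> x \<notin> H}"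

text \<open>Among the nearest points, minimizing \<open>wall_dist\<close> leaves finitely many by
  the finiteness of balls, and \<open>lt\<close> decides between these.\<close>

definition best :: "'a set \<Rightarrow> 'a set set \<Rightarrow> ('a set \<Rightarrow> nat) \<Rightarrow> ('a \<Rightarrow> 'a \<Rightarrow> bool) \<Rightarrow>
    'a set set \<Rightarrow> 'a \<Rightarrow> bool" where
  "best C W col lt y x \<longleftrightarrow> nearest C W col y x \<and>
     (\<forall>x'\<in>C. nearest C W col y x' \<longrightarrow> wall_dist W y x < wall_dist W y x' \<or>
        wall_dist W y x = wall_dist W y x' \<and> (x = x' \<or> lt x x'))"

text \<open>The step along the tree towards the best point. The bound on \<open>m\<close> says that
  \<open>z\<close> is strictly closer than \<open>y\<close>; with walks in place of a distance
  function the condition stays a countable one.\<close>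

definition parent :: "'a set \<Rightarrow> 'a set set \<Rightarrow> ('a set \<Rightarrow> nat) \<Rightarrow> ('a \<Rightarrow> 'a \<Rightarrow> bool) \<Rightarrow>
    ('a set set \<times> 'a set set) set" where
  "parent C W col lt = {(y, z). (y, z) \<in> tree_edges C W col \<and>
     (\<exists>x\<in>C. best C W col lt y x \<and> (\<exists>n. (z, hat W x) \<in> tree_edges C W col ^^ n \<and>
        (\<forall>m\<le>n. (y, hat W x) \<notin> tree_edges C W col ^^ m)))}"

text \<open>For an orientation \<open>hat W x\<close> all nearest points share it and have
  \<open>wall_dist\<close> 0, so the condition that \<open>x\<close> is best for it selects the
  \<open>lt\<close>-least point of this orientation.\<close>

definition root_of :: "'a set \<Rightarrow> 'a set set \<Rightarrow> ('a set \<Rightarrow> nat) \<Rightarrow> ('a \<Rightarrow> 'a \<Rightarrow> bool) \<Rightarrow>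
    'a set set \<Rightarrow> 'a \<Rightarrow> bool" where
  "root_of C W col lt y x \<longleftrightarrow> x \<in> C \<and> best C W col lt (hat W x) x \<and>
     (\<exists>n. (y, hat W x) \<in> parent C W col lt ^^ n)"

text \<open>The first disjunct is the image of the tree under contraction; the other two attach each
  point that is not its own root as a leaf.\<close>

definition point_tree :: "'a set \<Rightarrow> 'a set set \<Rightarrow> ('a set \<Rightarrow> nat) \<Rightarrow> ('a \<Rightarrow> 'a \<Rightarrow> bool) \<Rightarrow>
    ('a \<times> 'a) set" where
  "point_tree C W col lt = {(x, x'). x \<in> C \<and> x' \<in> C \<and> x \<noteq> x' \<and>
     ((\<exists>y\<in>orientations C W. \<exists>y'\<in>orientations C W. (y, y') \<in> tree_edges C W col \<and>
         root_of C W col lt y x \<and> root_of C W col lt y' x') \<or>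
      root_of C W col lt (hat W x) x' \<or> root_of C W col lt (hat W x') x)}"

section \<open>Orientations and flips in an abstract wallspace\<close>

locale wallspace =
  fixes C :: "'a set" and W :: "'a set set" and col :: "'a set \<Rightarrow> nat" and lt :: "'a \<Rightarrow> 'a \<Rightarrow> bool"
  assumes W_sub: "H \<in> W \<Longrightarrow> H \<subseteq> C" and W_ne: "H \<in> W \<Longrightarrow> H \<noteq> {}" "H \<in> W \<Longrightarrow> H \<noteq> C"
    and W_compl: "H \<in> W \<Longrightarrow> C - H \<in> W"
    and W_fin: "x \<in> C \<Longrightarrow> y \<in> C \<Longrightarrow> finite {H \<in> W. x \<in> H \<and> y \<notin> H}"
    and W_cross: "K \<in> W \<Longrightarrow> finite {L \<in> W. crossing C K L}"
    and W_ball: "x \<in> C \<Longrightarrow> finite {y \<in> C. card {H \<in> W. x \<in> H \<and> y \<notin> H} \<le> d}"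
    and col_inj: "K \<in> W \<Longrightarrow> L \<in> hyperplane C W K \<Longrightarrow> L' \<in> hyperplane C W K \<Longrightarrow> col L = col L' \<Longrightarrow> L = L'"
    and lt_irrefl: "x \<in> C \<Longrightarrow> \<not> lt x x"
    and lt_trans: "x \<in> C \<Longrightarrow> y \<in> C \<Longrightarrow> z \<in> C \<Longrightarrow> lt x y \<Longrightarrow> lt y z \<Longrightarrow> lt x z"
    and lt_total: "x \<in> C \<Longrightarrow> y \<in> C \<Longrightarrow> x \<noteq> y \<Longrightarrow> lt x y \<or> lt y x"
begin

abbreviation "Y \<equiv> orientations C W"
abbreviation "T \<equiv> tree_edges C W col"
abbreviation "wc \<equiv> wall_color C col"
abbreviation "flp \<equiv> flip C W"
abbreviation "fcode \<equiv> flip_code C W col"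

lemma compl_compl: "H \<in> W \<Longrightarrow> C - (C - H) = H"
  using W_sub by (simp add: double_diff)

lemma compl_neq: "H \<in> W \<Longrightarrow> C - H \<noteq> H"
  using W_sub W_ne by blast

lemma compl_eq_iff: "H \<in> W \<Longrightarrow> K \<in> W \<Longrightarrow> C - H = K \<longleftrightarrow> H = C - K"
  using compl_compl by metis

lemma wc_compl: "H \<in> W \<Longrightarrow> wc (C - H) = wc H"
  by (simp add: wall_color_def compl_compl min.commute)

lemma crossing_sym: "crossing C K L \<longleftrightarrow> crossing C L K"
  by (auto simp: crossing_def Un_commute Int_commute)

lemma crossing_compl1: "K \<in> W \<Longrightarrow> L \<in> W \<Longrightarrow> crossing C (C - K) L \<longleftrightarrow> crossing C K L"
  using W_sub[of K] W_sub[of L] unfolding crossing_def by blast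

lemma crossing_compl2: "K \<in> W \<Longrightarrow> L \<in> W \<Longrightarrow> crossing C K (C - L) \<longleftrightarrow> crossing C K L"
  using crossing_compl1 crossing_sym by metis

text \<open>The four sides of two crossing walls are distinct members of one hyperplane, so they
  have four different colors and the two minima differ.\<close>

lemma crossing_wc_neq:
  assumes "K \<in> W" "L \<in> W" "crossing C K L" shows "wc K \<noteq> wc L"
proof
  assume eq: "wc K = wc L"
  have K: "K \<in> hyperplane C W K" "C - K \<in> hyperplane C W K"
    and L: "L \<in> hyperplane C W K" "C - L \<in> hyperplane C W K"
    using assms W_compl crossing_compl2 by (auto simp: hyperplane_def)
  have "L \<noteq> K" "C - L \<noteq> K" "L \<noteq> C - K" "C - L \<noteq> C - K"
    using assms W_sub[of K] W_sub[of L] unfolding crossing_def by blast+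
  then have "col K \<noteq> col L" "col K \<noteq> col (C - L)" "col (C - K) \<noteq> col L" "col (C - K) \<noteq> col (C - L)"
    using col_inj[OF assms(1)] K L by metis+
  then show False using eq unfolding wall_color_def min_def by (auto split: if_splits)
qed

lemma Y_sub: "y \<in> Y \<Longrightarrow> H \<in> y \<Longrightarrow> H \<in> W"
  and Y_compl: "y \<in> Y \<Longrightarrow> H \<in> W \<Longrightarrow> C - H \<in> y \<longleftrightarrow> H \<notin> y"
  and Y_meet: "y \<in> Y \<Longrightarrow> H \<in> y \<Longrightarrow> K \<in> y \<Longrightarrow> H \<inter> K \<noteq> {}"
  and Y_fin: "y \<in> Y \<Longrightarrow> \<exists>x\<in>C. finite (y - hat W x)"
  unfolding orientations_def by blast+

lemma Y_up: "y \<in> Y \<Longrightarrow> H \<in> y \<Longrightarrow> K \<in> W \<Longrightarrow> H \<subseteq> K \<Longrightarrow> K \<in> y"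
  using Y_compl[of y K] Y_meet[of y H "C - K"] by blast

lemma Y_eqI:
  assumes "y \<in> Y" "z \<in> Y" "\<And>H. H \<in> W \<Longrightarrow> H \<in> y \<Longrightarrow> H \<in> z" shows "y = z"
proof
  show "y \<subseteq> z" using assms Y_sub by blast
  show "z \<subseteq> y"
  proof
    fix H assume H: "H \<in> z"
    show "H \<in> y"
    proof (rule ccontr)
      have HW: "H \<in> W" using Y_sub[OF assms(2) H] .
      assume "H \<notin> y"
      then have "C - H \<in> y" using Y_compl[OF assms(1) HW] by simp
      then have "C - H \<in> z" using assms(3) W_compl[OF HW] by blast
      then show False using H Y_compl[OF assms(2) HW] by simp
    qed
  qed
qed

lemma hat_Y: "x \<in> C \<Longrightarrow> hat W x \<in> Y"
  unfolding orientations_def hat_def using W_compl by (auto intro!: bexI[of _ x])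

lemma finite_compl_image:
  assumes "y \<in> Y" "z \<in> Y" "finite (y - z)" shows "finite (z - y)"
proof (rule finite_subset)
  show "z - y \<subseteq> (\<lambda>H. C - H) ` (y - z)"
  proof
    fix H assume H: "H \<in> z - y"
    then have HW: "H \<in> W" using Y_sub assms by blast
    then have "C - H \<in> y - z" using H Y_compl assms by blast
    then show "H \<in> (\<lambda>H. C - H) ` (y - z)" using compl_compl[OF HW] by (metis image_eqI)
  qed
qed (use assms in simp)

text \<open>The base point in the definition of orientations is immaterial, because finitely many
  walls separate two points.\<close>

lemma finite_diff_hat:
  assumes "y \<in> Y" "x \<in> C" shows "finite (y - hat W x)"
proof -
  obtain x' where x': "x' \<in> C" "finite (y - hat W x')" using Y_fin[OF assms(1)] by blast
  have "y - hat W x \<subseteq> (y - hat W x') \<union> {H \<in> W. x' \<in> H \<and> x \<notin> H}"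
    by (auto simp: hat_def)
  then show ?thesis using x' W_fin[OF x'(1) assms(2)] finite_subset by blast
qed

lemma finite_diff:
  assumes "y \<in> Y" "z \<in> Y" shows "finite (y - z)"
proof -
  obtain x where x: "x \<in> C" "finite (z - hat W x)" using Y_fin[OF assms(2)] by blast
  then have "finite (hat W x - z)" using finite_compl_image assms(2) hat_Y by blast
  moreover have "y - z \<subseteq> (y - hat W x) \<union> (hat W x - z)" by blast
  ultimately show ?thesis using finite_diff_hat[OF assms(1) x(1)] finite_subset by blast
qed

lemma flip_iff:
  assumes "flp K y y'" "y \<in> Y" "y' \<in> Y" "K \<in> W" "L \<in> W"
  shows "L \<in> y' \<longleftrightarrow> (L \<in> y \<and> L \<noteq> K) \<or> L = C - K"
proof -
  have fl: "K \<in> y" "C - K \<in> y'" "L \<noteq> K \<Longrightarrow> L \<noteq> C - K \<Longrightarrow> L \<in> y \<longleftrightarrow> L \<in> y'"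
    using assms(1,5) by (simp_all add: flip_def)
  have "K \<notin> y'" "C - K \<notin> y"
    using Y_compl[OF assms(3,4)] Y_compl[OF assms(2,4)] fl by simp_all
  then show ?thesis using fl by (cases "L = K"; cases "L = C - K") auto
qed

lemma flip_sym:
  assumes "flp K y y'" "K \<in> W" shows "flp (C - K) y' y"
  using assms compl_compl[OF assms(2)] unfolding flip_def by auto

lemma flip_unique:
  assumes "flp K y y'" "y \<in> Y" "y' \<in> Y" "K \<in> W" "L \<in> y" "L \<notin> y'" shows "L = K"
  using flip_iff[OF assms(1-4) Y_sub[OF assms(2,5)]] assms(5,6) by simp

lemma flip_target_eq:
  assumes "flp K y y'" "flp K y y''" "y \<in> Y" "y' \<in> Y" "y'' \<in> Y" "K \<in> W" shows "y' = y''"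
proof (rule Y_eqI[OF assms(4,5)])
  fix H assume "H \<in> W" "H \<in> y'"
  then show "H \<in> y''" using flip_iff[OF assms(1,3,4,6)] flip_iff[OF assms(2,3,5,6)] by simp
qed

text \<open>By minimality no other member of \<open>y\<close> lies inside \<open>K\<close>, so all
  of them meet \<open>C - K\<close>, and exchanging \<open>K\<close> for \<open>C - K\<close> keeps
  the sides pairwise intersecting.\<close>

lemma flip_exists:
  assumes y: "y \<in> Y" and K: "K \<in> y" and min: "\<And>L. L \<in> y \<Longrightarrow> L \<subseteq> K \<Longrightarrow> L = K"
  shows "\<exists>y'\<in>Y. flp K y y'"
proof
  have KW: "K \<in> W" using Y_sub[OF y K] .
  define y' where "y' = insert (C - K) (y - {K})"
  have mem: "L \<in> y' \<longleftrightarrow> L = C - K \<or> L \<in> y \<and> L \<noteq> K" for L by (auto simp: y'_def)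
  have CK: "C - K \<notin> y" "C - K \<noteq> K" using Y_compl[OF y KW] K compl_neq[OF KW] by auto
  show "flp K y y'"
    unfolding flip_def mem using K by blast
  have "H \<in> y' \<longleftrightarrow> C - H \<notin> y'" if H: "H \<in> W" for H
    unfolding mem
    using Y_compl[OF y H] compl_eq_iff[OF H KW] CK K compl_compl[OF H] compl_compl[OF KW] by metis
  moreover have meet: "(C - K) \<inter> L \<noteq> {}" if "L \<in> y" "L \<noteq> K" for L
    using min[OF that(1)] that(2) W_sub[OF Y_sub[OF y that(1)]] by blast
  have "C - K \<noteq> {}" using W_ne[OF W_compl[OF KW]] by simp
  then have "H \<inter> L \<noteq> {}" if "H \<in> y'" "L \<in> y'" for H L
    using that meet[of L] meet[of H] Y_meet[OF y, of H L] unfolding mem by (auto simp: Int_commute)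
  moreover have "\<exists>x\<in>C. finite (y' - hat W x)"
  proof -
    obtain x where "x \<in> C" "finite (y - hat W x)" using Y_fin[OF y] by blast
    moreover have "y' - hat W x \<subseteq> insert (C - K) (y - hat W x)" by (auto simp: y'_def)
    ultimately show ?thesis using finite_subset by (metis finite_insert)
  qed
  moreover have "y' \<subseteq> W" using Y_sub[OF y] W_compl[OF KW] by (auto simp: y'_def)
  ultimately show "y' \<in> Y" unfolding orientations_def by blast
qed

text \<open>Neither side of \<open>K\<close> crosses \<open>K\<close>, so flipping it leaves the
  code alone; both directions of an edge then compete with the same value.\<close>

lemma flip_code_cong:
  assumes "flp K y y'" "K \<in> W"
  shows "fcode (C - K) y' = fcode K y"
proof -
  have "{L \<in> W. L \<in> y' \<and> crossing C (C - K) L} = {L \<in> W. L \<in> y \<and> crossing C K L}"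
    using assms crossing_compl1[OF assms(2)] unfolding flip_def
    by (intro Collect_cong) (metis Diff_disjoint Diff_cancel crossing_def)
  then show ?thesis by (simp add: flip_code_def)
qed

section \<open>Symmetry and connectedness of the tree on orientations\<close>

lemma tree_edgesE:
  assumes "(y, y') \<in> T"
  obtains K where "y \<in> Y" "y' \<in> Y" "K \<in> W" "flp K y y'"
    "\<And>z z'. z \<in> Y \<Longrightarrow> z' \<in> Y \<Longrightarrow> flp K z z' \<Longrightarrow>
      (\<And>H. H \<in> W \<Longrightarrow> H \<in> z \<Longrightarrow> H \<notin> y \<Longrightarrow> wc H < wc K) \<Longrightarrow> fcode K y \<le> fcode K z"
  using assms unfolding tree_edges_def by blast

lemma tree_edgesI:
  assumes "y \<in> Y" "y' \<in> Y" "K \<in> W" "flp K y y'"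
    "\<And>z z'. z \<in> Y \<Longrightarrow> z' \<in> Y \<Longrightarrow> flp K z z' \<Longrightarrow>
      (\<And>H. H \<in> W \<Longrightarrow> H \<in> z \<Longrightarrow> H \<notin> y \<Longrightarrow> wc H < wc K) \<Longrightarrow> fcode K y \<le> fcode K z"
  shows "(y, y') \<in> T"
  using assms unfolding tree_edges_def by blast

lemma sym_T: "sym T"
proof (rule symI)
  fix y y' assume "(y, y') \<in> T"
  then obtain K where K: "y \<in> Y" "y' \<in> Y" "K \<in> W" "flp K y y'" and
    min: "\<And>z z'. z \<in> Y \<Longrightarrow> z' \<in> Y \<Longrightarrow> flp K z z' \<Longrightarrow>
      (\<And>H. H \<in> W \<Longrightarrow> H \<in> z \<Longrightarrow> H \<notin> y \<Longrightarrow> wc H < wc K) \<Longrightarrow> fcode K y \<le> fcode K z"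
    by (rule tree_edgesE) blast
  show "(y', y) \<in> T"
  proof (rule tree_edgesI[of _ _ "C - K"])
    show "flp (C - K) y' y" by (rule flip_sym[OF K(4,3)])
    fix z' z assume z: "z' \<in> Y" "z \<in> Y" and fl: "flp (C - K) z' z"
      and small: "\<And>H. H \<in> W \<Longrightarrow> H \<in> z' \<Longrightarrow> H \<notin> y' \<Longrightarrow> wc H < wc (C - K)"
    have fl': "flp K z z'" using flip_sym[OF fl W_compl[OF K(3)]] compl_compl[OF K(3)] by simp
    have "fcode K y \<le> fcode K z"
    proof (rule min[OF z(2,1) fl'])
      \<comment> \<open>Flipping \<open>K\<close> in both orientations does not change the set of
        walls on which they differ.\<close>
      fix H assume H: "H \<in> W" "H \<in> z" "H \<notin> y"
      have "H \<in> z'" "H \<notin> y'"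
        using H flip_iff[OF fl' z(2,1) K(3) H(1)] flip_iff[OF K(4,1,2,3) H(1)] 
          K(4) fl' Y_compl[OF z(2) K(3)] unfolding flip_def by blast+
      then show "wc H < wc K" using small H(1) wc_compl[OF K(3)] by simp
    qed
    then show "fcode (C - K) y' \<le> fcode (C - K) z'"
      using flip_code_cong[OF fl' K(3)] flip_code_cong[OF K(4,3)] by simp
  qed (use K W_compl in auto)
qed

lemma T_sub: "T \<subseteq> Y \<times> Y"
  unfolding tree_edges_def by blast

lemma T_irrefl: "(y, y) \<notin> T"
proof
  assume "(y, y) \<in> T"
  then obtain K where "y \<in> Y" "K \<in> W" "flp K y y" by (rule tree_edgesE) blast
  then show False using Y_compl unfolding flip_def by blast
qed

text \<open>Induction on the color bound and, within it, on the number of differing walls. A dual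
  edge of color \<open>n\<close> is replaced by a detour through the kept edge of its identification
  class; the two connecting pieces use smaller colors only.\<close>

lemma T_rtrancl_of_small_colors:
  assumes "y \<in> Y" "y' \<in> Y" "\<And>H. H \<in> y \<Longrightarrow> H \<notin> y' \<Longrightarrow> wc H < n"
  shows "(y, y') \<in> T\<^sup>*"
  using assms
proof (induction n arbitrary: y y')
  case 0
  then have "y = y'" by (intro Y_eqI) auto
  then show ?case by simp
next
  case (Suc n)
  note IH = Suc.IH
  have "(y, y') \<in> T\<^sup>*"
    if "y \<in> Y" "y' \<in> Y" "\<And>H. H \<in> y \<Longrightarrow> H \<notin> y' \<Longrightarrow> wc H < Suc n" "card (y - y') = k" for y y' k
    using that
  proof (induction k arbitrary: y)
    case 0
    then have "y - y' = {}" using finite_diff by simp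
    then have "y = y'" using 0 by (intro Y_eqI) auto
    then show ?case by simp
  next
    case (Suc k)
    have "finite (y - y')" using Suc.prems(1,2) by (rule finite_diff)
    moreover have "y - y' \<noteq> {}" using Suc.prems(4) by (metis card.empty nat.distinct(1))
    ultimately obtain K where K: "K \<in> y" "K \<notin> y'" and Kmin: "\<And>L. L \<in> y - y' \<Longrightarrow> L \<subseteq> K \<Longrightarrow> L = K"
      using finite_has_minimal[of "y - y'"] by blast
    have KW: "K \<in> W" using Y_sub[OF Suc.prems(1) K(1)] .
    have "\<exists>y1\<in>Y. flp K y y1"
    proof (rule flip_exists[OF Suc.prems(1) K(1)])
      fix L assume L: "L \<in> y" "L \<subseteq> K"
      \<comment> \<open>\<open>y'\<close> is closed upwards, so whatever lies below \<open>K\<close>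
        is missing from it too, and minimality in \<open>y - y'\<close> becomes minimality in
        \<open>y\<close>.\<close>
      have "L \<notin> y'" using Y_up[OF Suc.prems(2) _ KW L(2)] K(2) by blast
      then show "L = K" using Kmin L by blast
    qed
    then obtain y1 where y1: "y1 \<in> Y" "flp K y y1" by blast
    have mem1: "L \<in> y1 \<longleftrightarrow> (L \<in> y \<and> L \<noteq> K) \<or> L = C - K" if "L \<in> W" for L
      using flip_iff[OF y1(2) Suc.prems(1) y1(1) KW that] .
    have CK: "C - K \<in> y'" using Y_compl[OF Suc.prems(2) KW] K(2) by simp
    have CKy: "C - K \<notin> y" using Y_compl[OF Suc.prems(1) KW] K(1) by simp
    have "H \<in> y1 - y' \<longleftrightarrow> H \<in> (y - y') - {K}" if "H \<in> W" for H
      using mem1[OF that] CK CKy by auto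
    then have "y1 - y' = (y - y') - {K}"
      using Y_sub[OF y1(1)] Y_sub[OF Suc.prems(1)] by blast
    then have card: "card (y1 - y') = k" using Suc.prems(4) K by simp
    have rest: "(y1, y') \<in> T\<^sup>*"
    proof (rule Suc.IH[OF y1(1) Suc.prems(2) _ card])
      fix H assume "H \<in> y1" "H \<notin> y'"
      then have "H \<in> y" using mem1[of H] Y_sub[OF y1(1)] CK by blast
      then show "wc H < Suc n" using Suc.prems(3) \<open>H \<notin> y'\<close> by blast
    qed
    have "(y, y1) \<in> T\<^sup>*"
    proof (cases "wc K < n")
      case True
      show ?thesis
      proof (rule IH[OF Suc.prems(1) y1(1)])
        fix H assume "H \<in> y" "H \<notin> y1"
        then have "H = K" using flip_unique[OF y1(2) Suc.prems(1) y1(1) KW] by blast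
        then show "wc H < n" using True by simp
      qed
    next
      case False
      then have wcK: "wc K = n" using Suc.prems(3)[OF K] by simp
      \<comment> \<open>The identification class of the edge at \<open>y\<close>. A least code in it
        is also least among the competitors of \<open>z\<close>, since differences in colors below
        \<open>n\<close> compose.\<close>
      define P where "P z \<longleftrightarrow> z \<in> Y \<and> (\<exists>z'\<in>Y. flp K z z') \<and>
        (\<forall>H\<in>W. H \<in> z \<longrightarrow> H \<notin> y \<longrightarrow> wc H < n)" for z
      have "P y" using Suc.prems(1) y1 unfolding P_def by blast
      then obtain z where z: "P z" and zmin: "\<And>u. P u \<Longrightarrow> fcode K z \<le> fcode K u"
        using ex_has_least_nat[of P y "fcode K"] by blast
      obtain z' where zY: "z \<in> Y" "z' \<in> Y" and fz: "flp K z z'"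
        and zs: "\<And>H. H \<in> W \<Longrightarrow> H \<in> z \<Longrightarrow> H \<notin> y \<Longrightarrow> wc H < n"
        using z unfolding P_def by blast
      have "(z, z') \<in> T"
      proof (rule tree_edgesI[OF zY KW fz])
        fix u u' assume u: "u \<in> Y" "u' \<in> Y" "flp K u u'"
          "\<And>H. H \<in> W \<Longrightarrow> H \<in> u \<Longrightarrow> H \<notin> z \<Longrightarrow> wc H < wc K"
        have "P u"
          unfolding P_def
        proof (intro conjI ballI impI)
          fix H assume H: "H \<in> W" "H \<in> u" "H \<notin> y"
          show "wc H < n" using u(4)[OF H(1,2)] zs[OF H(1) _ H(3)] wcK by blast
        qed (use u in blast)+
        then show "fcode K z \<le> fcode K u" by (rule zmin)
      qed
      moreover have "(y, z) \<in> T\<^sup>*"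
      proof (rule IH[OF Suc.prems(1) zY(1)])
        fix H assume H: "H \<in> y" "H \<notin> z"
        have HW: "H \<in> W" using Y_sub[OF Suc.prems(1) H(1)] .
        then have "C - H \<in> z" "C - H \<notin> y" using H Y_compl zY(1) Suc.prems(1) by blast+
        then show "wc H < n" using zs[OF W_compl[OF HW]] wc_compl[OF HW] by simp
      qed
      moreover have "(z', y1) \<in> T\<^sup>*"
      proof (rule IH[OF zY(2) y1(1)])
        fix H assume H: "H \<in> z'" "H \<notin> y1"
        have HW: "H \<in> W" using Y_sub[OF zY(2) H(1)] .
        have "H \<in> z" "H \<notin> y"
          using H flip_iff[OF fz zY KW HW] mem1[OF HW] by blast+
        then show "wc H < n" using zs HW by blast
      qed
      ultimately show ?thesis by (meson converse_rtrancl_into_rtrancl rtrancl_trans)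
    qed
    then show ?case using rest by (rule rtrancl_trans)
  qed
  then show ?case using Suc.prems by blast
qed

lemma T_connected:
  assumes "y \<in> Y" "y' \<in> Y" shows "(y, y') \<in> T\<^sup>*"
proof (rule T_rtrancl_of_small_colors[OF assms])
  fix H assume "H \<in> y" "H \<notin> y'"
  then have "wc H \<le> Max (wc ` (y - y'))" using finite_diff[OF assms] by (intro Max_ge) auto
  then show "wc H < Suc (Max (wc ` (y - y')))" by simp
qed

end

section \<open>Acyclicity of the tree on orientations\<close>

lemma exists_last_before_change:
  fixes a b :: nat
  assumes "a < b" "P a" "\<not> P b"
  shows "\<exists>j. a \<le> j \<and> j < b \<and> P j \<and> \<not> P (Suc j)"
proof (rule ccontr)
  assume *: "\<not> ?thesis"
  have "P (a + k)" if "a + k \<le> b" for k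
    using that
  proof (induction k)
    case (Suc k)
    then show ?case using * by auto
  qed (use assms in simp)
  from this[of "b - a"] show False using assms by simp
qed

context wallspace
begin

text \<open>\<open>L\<close> belongs to both ends of one edge dual to \<open>K\<close>, so it meets
  \<open>K\<close> and \<open>C - K\<close>; as it does not cross \<open>K\<close>, it contains one
  of the two. The other edge has an end on each side of \<open>K\<close>, and upward closure puts
  \<open>L\<close> there.\<close>

lemma carrier_determined:
  assumes y: "flp K y y'" "y \<in> Y" "y' \<in> Y" and z: "flp K z z'" "z \<in> Y" "z' \<in> Y"
    and K: "K \<in> W" and L: "L \<in> W" "\<not> crossing C K L" "L \<in> y"
  shows "L \<in> z"
proof (cases "L = K")
  case True
  then show ?thesis using z by (simp add: flip_def)
next
  case False
  have Ky: "K \<in> y" "K \<in> z" "C - K \<in> y'" "C - K \<in> z'" using y z by (simp_all add: flip_def)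
  have LK: "L \<noteq> C - K" using L(3) Y_compl[OF y(2) K] Ky by blast
  have "L \<in> y'" using flip_iff[OF y K L(1)] L(3) False by simp
  then have "L \<inter> (C - K) \<noteq> {}" using Y_meet[OF y(3)] Ky by blast
  moreover have "K \<inter> L \<noteq> {}" using Y_meet[OF y(2)] Ky L(3) by blast
  ultimately consider "K \<subseteq> L" | "C - K \<subseteq> L"
    using L(2) unfolding crossing_def by blast
  then show ?thesis
  proof cases
    case 1
    then show ?thesis using Y_up[OF z(2) Ky(2) L(1)] by blast
  next
    case 2
    then have "L \<in> z'" using Y_up[OF z(3) Ky(4) L(1)] by blast
    then show ?thesis using flip_iff[OF z K L(1)] LK by simp
  qed
qed

lemma flip_code_inj:
  assumes y: "flp K y y'" "y \<in> Y" "y' \<in> Y" and z: "flp K z z'" "z \<in> Y" "z' \<in> Y"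
    and K: "K \<in> W" and eq: "fcode K y = fcode K z"
  shows "y = z"
proof -
  let ?A = "\<lambda>u. {L \<in> W. L \<in> u \<and> crossing C K L}"
  have fin: "finite (?A u)" for u by (rule finite_subset[OF _ W_cross[OF K]]) auto
  have "col ` ?A y = col ` ?A z"
    using eq fin by (simp add: flip_code_def set_encode_eq)
  then have col_eq: "col ` ?A y = col ` ?A z" .
  have inj: "inj_on col (hyperplane C W K)" using col_inj[OF K] by (auto intro: inj_onI)
  have sub: "?A u \<subseteq> hyperplane C W K" for u by (auto simp: hyperplane_def)
  have A: "?A y = ?A z" using inj_on_image_eq_iff[OF inj sub sub] col_eq by blast
  show ?thesis
  proof (rule Y_eqI[OF y(2) z(2)])
    fix L assume L: "L \<in> W" "L \<in> y"
    show "L \<in> z"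
    proof (cases "crossing C K L")
      case True
      then show ?thesis using A L by blast
    next
      case False
      then show ?thesis using carrier_determined[OF y z K L(1) _ L(2)] by blast
    qed
  qed
qed

text \<open>A cycle would cross a wall \<open>K\<close> of maximal color twice. Walls of the color of \<open>K\<close> do not cross
  \<open>K\<close>, hence cannot separate the two crossings, so both edges compete for the same choice.\<close>

lemma acyclic_T: "acyclic_graph T"
  unfolding acyclic_graph_def
proof
  assume "\<exists>xs. graph_cycle T xs"
  then obtain xs where "graph_cycle T xs" ..
  then obtain s m where m: "m \<ge> 3" and s: "\<And>i. (s i, s (Suc i)) \<in> T" and
    per: "\<And>i j. s i = s j \<longleftrightarrow> i mod m = j mod m"
    by (rule graph_cycle_periodic) blast
  define mn where "mn K y \<longleftrightarrow> (\<forall>z z'. z \<in> Y \<longrightarrow> z' \<in> Y \<longrightarrow> flp K z z' \<longrightarrow>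
      (\<forall>H. H \<in> W \<longrightarrow> H \<in> z \<longrightarrow> H \<notin> y \<longrightarrow> wc H < wc K) \<longrightarrow> fcode K y \<le> fcode K z)" for K y
  have edge: "\<exists>K. K \<in> W \<and> flp K y y' \<and> mn K y" if "(y, y') \<in> T" for y y'
    using that
  proof (rule tree_edgesE)
    fix K assume K: "K \<in> W" "flp K y y'" and
      min: "\<And>z z'. z \<in> Y \<Longrightarrow> z' \<in> Y \<Longrightarrow> flp K z z' \<Longrightarrow>
      (\<And>H. H \<in> W \<Longrightarrow> H \<in> z \<Longrightarrow> H \<notin> y \<Longrightarrow> wc H < wc K) \<Longrightarrow> fcode K y \<le> fcode K z"
    have "mn K y" unfolding mn_def by (intro allI impI min) blast+
    then show ?thesis using K by blast
  qed
  then obtain kf where kf0: "\<And>y y'. (y, y') \<in> T \<Longrightarrow> kf y y' \<in> W \<and> flp (kf y y') y y' \<and> mn (kf y y') y"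
    by metis
  define k where "k i = kf (s i) (s (Suc i))" for i
  have kW: "k i \<in> W" and fl: "flp (k i) (s i) (s (Suc i))" and km: "mn (k i) (s i)" for i
    using kf0[OF s[of i]] by (simp_all add: k_def)
  have sY: "s i \<in> Y" for i using s[of i] T_sub by blast
  have kper: "k (i mod m) = k i" for i
  proof -
    have "s (i mod m) = s i" "s (Suc (i mod m)) = s (Suc i)" using per by (simp_all add: mod_Suc_eq)
    then show ?thesis by (simp add: k_def)
  qed
  have "finite ((\<lambda>i. wc (k i)) ` {..<m})" "(\<lambda>i. wc (k i)) ` {..<m} \<noteq> {}"
    using m by (auto simp: lessThan_empty_iff)
  from Max_in[OF this] obtain a where a: "wc (k a) = Max ((\<lambda>i. wc (k i)) ` {..<m})" by auto
  have amax: "wc (k i) \<le> wc (k a)" for i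
  proof -
    have "i mod m < m" using m by simp
    then have "wc (k (i mod m)) \<le> wc (k a)" unfolding a by (intro Max_ge) auto
    then show ?thesis by (simp add: kper)
  qed
  let ?K = "k a"
  have KW: "?K \<in> W" by (rule kW)
  have Ka: "?K \<in> s a" "C - ?K \<in> s (Suc a)" using fl[of a] by (simp_all add: flip_def)
  then have nKa: "?K \<notin> s (Suc a)" using Y_compl[OF sY KW] by blast
  have "s (a + m) = s a" using per by simp
  then have "?K \<in> s (a + m)" using Ka by simp
  then obtain j where j: "Suc a \<le> j" "j < a + m" "?K \<notin> s j" "?K \<in> s (Suc j)"
    using exists_last_before_change[of "Suc a" "a + m" "\<lambda>i. ?K \<notin> s i"] nKa m by auto
  have CKj: "C - ?K \<in> s j" "C - ?K \<notin> s (Suc j)" using Y_compl[OF sY KW] j by auto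
  have kj: "k j = C - ?K" using flip_unique[OF fl sY sY kW CKj] by simp
  have flj: "flp ?K (s (Suc j)) (s j)"
    using flip_sym[OF fl[of j] kW] unfolding kj compl_compl[OF KW] .
  \<comment> \<open>\<open>H\<close> belongs to both ends of one edge dual to \<open>K\<close> and
    \<open>C - H\<close> to both ends of the other, which makes all four corners nonempty.\<close>
  have small: "wc H < wc ?K" if H: "H \<in> s a" "H \<notin> s (Suc j)" for H
  proof -
    have HW: "H \<in> W" using Y_sub[OF sY H(1)] .
    obtain i where "H \<in> s i" "H \<notin> s (Suc i)"
      using exists_last_before_change[of a "Suc j" "\<lambda>i. H \<in> s i"] H j by auto
    then have "H = k i" using flip_unique[OF fl sY sY kW] by blast
    then have le: "wc H \<le> wc ?K" using amax by simp
    have neq: "H \<noteq> ?K" using H j by blast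
    have neq': "H \<noteq> C - ?K" using H Ka Y_compl[OF sY KW] by blast
    have Ha: "H \<in> s (Suc a)" using flip_iff[OF fl sY sY KW HW] H(1) neq by simp
    have Hj: "H \<notin> s j" using flip_iff[OF flj sY sY KW HW] H(2) neq' by simp
    have "C - H \<in> s j" "C - H \<in> s (Suc j)" using Hj H(2) Y_compl[OF sY HW] by auto
    then have "?K \<inter> (C - H) \<noteq> {}" "(C - ?K) \<inter> (C - H) \<noteq> {}" 
      using Y_meet[OF sY[of "Suc j"] j(4)] Y_meet[OF sY[of j] CKj(1)] by auto
    moreover have "?K \<inter> H \<noteq> {}" "(C - ?K) \<inter> H \<noteq> {}"
      using Y_meet[OF sY[of a] Ka(1) H(1)] Y_meet[OF sY Ka(2) Ha] by auto
    ultimately have "crossing C ?K H" unfolding crossing_def by blast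
    then show ?thesis using crossing_wc_neq[OF KW HW] le by simp
  qed
  have small': "wc H < wc ?K" if H: "H \<in> W" "H \<in> s (Suc j)" "H \<notin> s a" for H
  proof -
    have "C - H \<in> s a" "C - H \<notin> s (Suc j)" using H Y_compl[OF sY H(1)] by auto
    from small[OF this] show ?thesis using wc_compl[OF H(1)] by simp
  qed
  have "fcode ?K (s a) \<le> fcode ?K (s (Suc j))"
    using km[of a] sY flj small' unfolding mn_def by blast
  moreover have "fcode ?K (s (Suc j)) \<le> fcode ?K (s a)"
  proof -
    have "fcode (C - ?K) (s j) \<le> fcode (C - ?K) (s (Suc a))"
    proof (rule km[of j, unfolded kj mn_def, rule_format])
      show "flp (C - ?K) (s (Suc a)) (s a)" by (rule flip_sym[OF fl KW])
      fix H assume H: "H \<in> W" "H \<in> s (Suc a)" "H \<notin> s j"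
      have "H \<in> s a" "H \<notin> s (Suc j)"
        using H flip_iff[OF fl[of a] sY sY KW H(1)] flip_iff[OF flj sY sY KW H(1)] nKa CKj by auto
      then show "wc H < wc (C - ?K)" using small wc_compl[OF KW] by simp
    qed (rule sY)+
    then show ?thesis using flip_code_cong[OF flj KW] flip_code_cong[OF fl KW] by simp
  qed
  ultimately have eq: "s a = s (Suc j)"
    by (intro flip_code_inj[OF fl sY sY flj sY sY KW]) simp
  then have "s (Suc a) = s j" using flip_target_eq[OF fl _ sY sY sY KW] flj by simp
  \<comment> \<open>Both crossings of \<open>K\<close> use the same edge in opposite directions, and
    in a cycle this would force \<open>m\<close> to divide 2.\<close>
  then have "Suc a mod m = j mod m" and "a mod m = Suc j mod m" using per eq by blast+
  then have d: "m dvd j - Suc a" "m dvd Suc j - a"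
    using j(1) mod_eq_dvd_iff_nat[of "Suc a" j m] mod_eq_dvd_iff_nat[of a "Suc j" m] by (auto simp: eq_commute)
  have "j - Suc a < m" using j m by linarith
  then have "j - Suc a = 0" using d(1) by (metis nat_dvd_not_less not_gr_zero)
  then have "j = Suc a" using j(1) by simp
  then have "m dvd 2" using d(2) by simp
  then show False using m dvd_imp_le[of m 2] by simp
qed

section \<open>Contraction of orientations onto points\<close>

abbreviation "nr \<equiv> nearest C W col"
abbreviation "bst \<equiv> best C W col lt"
abbreviation "par \<equiv> parent C W col lt"
abbreviation "rt \<equiv> root_of C W col lt"

lemma ex_lt_least:
  assumes "finite S" "S \<noteq> {}" "S \<subseteq> C"
  shows "\<exists>x\<in>S. \<forall>x'\<in>S. x = x' \<or> lt x x'"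
  using assms
proof (induction rule: finite_ne_induct)
  case (insert x S)
  then obtain z where z: "z \<in> S" "\<forall>x'\<in>S. z = x' \<or> lt z x'" by auto
  have C: "x \<in> C" "z \<in> C" using insert z by auto
  consider "lt x z" | "x = z" | "lt z x" using lt_total[OF C] by blast
  then show ?case
  proof cases
    case 1
    have "x = x' \<or> lt x x'" if "x' \<in> S" for x'
    proof (cases "x' = z")
      case False
      then have "lt z x'" using z(2) that by metis
      moreover have "x' \<in> C" using that insert.prems by blast
      ultimately show ?thesis using lt_trans[OF C] 1 by blast
    qed (use 1 in simp)
    then show ?thesis by blast
  qed (use z in auto)
qed simp

text \<open>The triangle inequality moves the center of the ball from \<open>y\<close> to a point
  \<open>x0\<close>, at the cost of the finite number of walls on which \<open>hat W x0\<close> and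
  \<open>y\<close> differ.\<close>

lemma finite_wall_dist_ball:
  assumes "y \<in> Y" shows "finite {x \<in> C. wall_dist W y x \<le> d}"
proof -
  obtain x0 where x0: "x0 \<in> C" using Y_fin[OF assms] by blast
  have eq: "{H \<in> W. H \<in> z \<and> x \<notin> H} = z - hat W x" if "z \<in> Y" for z x
    using Y_sub[OF that] by (auto simp: hat_def)
  have eq': "{H \<in> W. x0 \<in> H \<and> x \<notin> H} = hat W x0 - hat W x" for x by (auto simp: hat_def)
  show ?thesis
  proof (rule finite_subset[OF _ W_ball[OF x0, of "card (hat W x0 - y) + d"]], clarify)
    fix x assume x: "x \<in> C" "wall_dist W y x \<le> d"
    have "hat W x0 - hat W x \<subseteq> (hat W x0 - y) \<union> (y - hat W x)" by blast
    then have "card (hat W x0 - hat W x) \<le> card ((hat W x0 - y) \<union> (y - hat W x))"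
      using finite_diff hat_Y x x0 assms by (intro card_mono) auto
    also have "\<dots> \<le> card (hat W x0 - y) + card (y - hat W x)" by (rule card_Un_le)
    finally show "card {H \<in> W. x0 \<in> H \<and> x \<notin> H} \<le> card (hat W x0 - y) + d"
      using x(2) unfolding wall_dist_def eq[OF assms] eq' by simp
  qed
qed

lemma ex_best:
  assumes y: "y \<in> Y" shows "\<exists>x. bst y x"
proof -
  obtain x0 where x0: "x0 \<in> C" using Y_fin[OF y] by blast
  define P where "P n \<longleftrightarrow> (\<exists>x\<in>C. (y, hat W x) \<in> T ^^ n)" for n
  have "\<exists>n. P n"
    using T_connected[OF y hat_Y[OF x0]] x0 unfolding rtrancl_power P_def by blast
  then have "P (LEAST n. P n)" by (rule LeastI_ex)
  then obtain x1 where x1: "x1 \<in> C" "(y, hat W x1) \<in> T ^^ (LEAST n. P n)" unfolding P_def by blast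
  have "\<forall>x'\<in>C. \<forall>m<(LEAST n. P n). (y, hat W x') \<notin> T ^^ m"
    using not_less_Least[of _ P] unfolding P_def by blast
  then have n1: "nr y x1" unfolding nearest_def using x1 by blast
  obtain x2 where x2: "nr y x2" and min: "\<And>x. nr y x \<Longrightarrow> wall_dist W y x2 \<le> wall_dist W y x"
    using ex_has_least_nat[of "nr y" x1 "wall_dist W y"] n1 by blast
  \<comment> \<open>\<open>lt\<close> is not assumed well-founded, so a least element is sought only
    in the finite set of ties.\<close>
  define S where "S = {x \<in> C. nr y x \<and> wall_dist W y x = wall_dist W y x2}"
  have nC: "x \<in> C" if "nr y x" for x using that by (simp add: nearest_def)
  have "finite S" by (rule finite_subset[OF _ finite_wall_dist_ball[OF y, of "wall_dist W y x2"]]) (auto simp: S_def)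
  moreover have "x2 \<in> S" "S \<subseteq> C" using x2 nC by (auto simp: S_def)
  ultimately obtain x where x: "x \<in> S" "\<forall>x'\<in>S. x = x' \<or> lt x x'"
    using ex_lt_least[of S] by blast
  have "bst y x"
    unfolding best_def
  proof (intro conjI ballI impI)
    show "nr y x" using x(1) by (simp add: S_def)
    fix x' assume x': "x' \<in> C" "nr y x'"
    have wd: "wall_dist W y x = wall_dist W y x2" using x(1) by (simp add: S_def)
    show "wall_dist W y x < wall_dist W y x' \<or> wall_dist W y x = wall_dist W y x' \<and> (x = x' \<or> lt x x')"
    proof (cases "wall_dist W y x' = wall_dist W y x2")
      case True
      then have "x' \<in> S" using x' by (simp add: S_def)
      then show ?thesis using x(2) True wd by auto
    next
      case False
      then show ?thesis using min[OF x'(2)] wd by simp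
    qed
  qed
  then show ?thesis ..
qed

lemma best_C: "bst y x \<Longrightarrow> x \<in> C"
  by (simp add: best_def nearest_def)

lemma best_unique:
  assumes "bst y x" "bst y x'" shows "x = x'"
proof (rule ccontr)
  assume "x \<noteq> x'"
  then have "lt x x'" "lt x' x" using assms best_C unfolding best_def by (metis less_asym less_irrefl)+
  then show False using lt_trans lt_irrefl best_C assms by blast
qed

text \<open>The termination measure for passing to parents: the tree distance to the orientations of
  points.\<close>

definition depth :: "'a set set \<Rightarrow> nat" where
  "depth y = (LEAST n. \<exists>x\<in>C. (y, hat W x) \<in> T ^^ n)"

lemma nearest_depth:
  assumes "nr y x" shows "(y, hat W x) \<in> T ^^ depth y"
proof -
  obtain n where n: "x \<in> C" "(y, hat W x) \<in> T ^^ n" "\<forall>x'\<in>C. \<forall>m<n. (y, hat W x') \<notin> T ^^ m"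
    using assms unfolding nearest_def by blast
  then have "depth y = n"
    unfolding depth_def by (intro Least_equality) (auto simp: not_less[symmetric])
  then show ?thesis using n by simp
qed

lemma depth_le: "x \<in> C \<Longrightarrow> (y, hat W x) \<in> T ^^ n \<Longrightarrow> depth y \<le> n"
  unfolding depth_def by (rule Least_le) blast

text \<open>The best point may change from \<open>y\<close> to \<open>z\<close>; the drop of the
  distance to the nearest point is enough.\<close>

lemma parent_depth: "(y, z) \<in> par \<Longrightarrow> depth z < depth y"
proof -
  assume "(y, z) \<in> par"
  then obtain x n where x: "x \<in> C" "bst y x" "(z, hat W x) \<in> T ^^ n" "\<forall>m\<le>n. (y, hat W x) \<notin> T ^^ m"
    unfolding parent_def by blast
  have "(y, hat W x) \<in> T ^^ depth y" using x(2) nearest_depth by (simp add: best_def)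
  then have "n < depth y" using x(4) not_less by blast
  then show ?thesis using depth_le[OF x(1,3)] by simp
qed

lemma ex_parent:
  assumes "y \<in> Y" "depth y \<noteq> 0" shows "\<exists>z. (y, z) \<in> par"
proof -
  obtain x where x: "bst y x" using ex_best[OF assms(1)] by blast
  obtain k where k: "depth y = Suc k" using assms(2) not0_implies_Suc by blast
  have "(y, hat W x) \<in> T ^^ Suc k" using x nearest_depth k by (metis best_def)
  then obtain z where z: "(y, z) \<in> T" "(z, hat W x) \<in> T ^^ k" by (metis relpow_Suc_D2)
  have "\<forall>m\<le>k. (y, hat W x) \<notin> T ^^ m" using depth_le[OF best_C[OF x], of y] k by fastforce
  then show ?thesis unfolding parent_def using x z best_C[OF x] by blast
qed

text \<open>A visit to \<open>y\<close> would leave a walk from \<open>y\<close> to \<open>t\<close>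
  of length at most \<open>n\<close>.\<close>

lemma relpow_avoids:
  assumes "(a, t) \<in> T ^^ n" "\<forall>m\<le>n. (y, t) \<notin> T ^^ m"
  shows "(a, t) \<in> {(u, v) \<in> T. u \<noteq> y \<and> v \<noteq> y}\<^sup>*"
  using assms
proof (induction n arbitrary: a)
  case (Suc n)
  obtain b where b: "(a, b) \<in> T" "(b, t) \<in> T ^^ n" using Suc.prems(1) by (metis relpow_Suc_D2)
  have "a \<noteq> y" using Suc.prems by blast
  moreover have "b \<noteq> y" using b(2) Suc.prems(2) by (metis le_SucI order_refl)
  moreover have "(b, t) \<in> {(u, v) \<in> T. u \<noteq> y \<and> v \<noteq> y}\<^sup>*" using Suc.IH[OF b(2)] Suc.prems(2) by simp
  ultimately show ?case using b(1) by (intro converse_rtrancl_into_rtrancl[of a b]) auto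
qed simp

lemma par_T: "(y, z) \<in> par \<Longrightarrow> (y, z) \<in> T"
  by (simp add: parent_def)

text \<open>Two parents of \<open>y\<close> are both joined to the orientation of its unique best
  point without passing through \<open>y\<close>. The edge to one of them would then not be a
  bridge.\<close>

lemma single_valued_par: "single_valued par"
proof (rule single_valuedI, rule ccontr)
  fix y z z' assume p: "(y, z) \<in> par" "(y, z') \<in> par" and ne: "z \<noteq> z'"
  obtain x n where x: "bst y x" "(z, hat W x) \<in> T ^^ n" "\<forall>m\<le>n. (y, hat W x) \<notin> T ^^ m"
    using p(1) unfolding parent_def by blast
  obtain x' n' where x': "bst y x'" "(z', hat W x') \<in> T ^^ n'" "\<forall>m\<le>n'. (y, hat W x') \<notin> T ^^ m"
    using p(2) unfolding parent_def by blast
  have xx: "x' = x" using best_unique[OF x'(1) x(1)] .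
  let ?A = "{(u, v) \<in> T. u \<noteq> y \<and> v \<noteq> y}" and ?B = "T - {(y, z), (z, y)}"
  have yz: "(y, z) \<in> T" "(y, z') \<in> T" using p par_T by auto
  have "(z, hat W x) \<in> ?A\<^sup>*" "(z', hat W x) \<in> ?A\<^sup>*"
    using relpow_avoids[OF x(2,3)] relpow_avoids[OF x'(2,3)] xx by auto
  moreover have "sym (?A\<^sup>*)" using sym_T by (intro sym_rtrancl) (auto simp: sym_def)
  ultimately have "(z, z') \<in> ?A\<^sup>*" by (meson rtrancl_trans symE)
  then have "(z, z') \<in> ?B\<^sup>*" using rtrancl_mono[of ?A ?B] by auto
  moreover have "(z', y) \<in> ?B" using yz ne T_irrefl sym_T by (auto dest: symD)
  ultimately have "(z, y) \<in> ?B\<^sup>*" by (rule rtrancl_into_rtrancl)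
  moreover have "y \<noteq> z" using yz T_irrefl by blast
  ultimately show False using bridge_of_acyclic_graph[OF acyclic_T yz(1)] by blast
qed

lemma root_iff: "rt y x \<longleftrightarrow> x \<in> C \<and> bst (hat W x) x \<and> (y, hat W x) \<in> par\<^sup>*"
  by (simp add: root_of_def rtrancl_power)

lemma hat_no_parent: "x \<in> C \<Longrightarrow> (hat W x, z) \<notin> par"
  using parent_depth[of "hat W x" z] depth_le[of x "hat W x" 0] by auto

lemma root_exists: "y \<in> Y \<Longrightarrow> \<exists>x. rt y x"
proof (induction "depth y" arbitrary: y rule: less_induct)
  case less
  show ?case
  proof (cases "depth y = 0")
    case True
    obtain x where x: "bst y x" using ex_best[OF less.prems] by blast
    then have "(y, hat W x) \<in> T ^^ 0" using nearest_depth True by (metis best_def)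
    then have "y = hat W x" by simp
    then show ?thesis using x best_C[OF x] unfolding root_iff by blast
  next
    case False
    then obtain z where z: "(y, z) \<in> par" using ex_parent less.prems by blast
    have "z \<in> Y" using par_T[OF z] T_sub by blast
    then obtain x where "rt z x" using less.hyps[OF parent_depth[OF z]] by blast
    then show ?thesis unfolding root_iff using z by (meson converse_rtrancl_into_rtrancl)
  qed
qed

text \<open>Parents are unique, so of two chains from \<open>y\<close> one continues the other;
  orientations of points have no parent, so both end at the same place.\<close>

lemma root_unique:
  assumes "rt y x" "rt y x'" shows "x = x'"
proof -
  have stuck: "hat W a = b" if "(hat W a, b) \<in> par\<^sup>*" "a \<in> C" for a b
    using that hat_no_parent by (auto elim: converse_rtranclE)
  have "(hat W x, hat W x') \<in> par\<^sup>* \<or> (hat W x', hat W x) \<in> par\<^sup>*"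
    using single_valued_confluent[OF single_valued_par] assms unfolding root_iff by blast
  then have "hat W x = hat W x'" using stuck assms unfolding root_iff by metis
  then show ?thesis using best_unique assms unfolding root_iff by metis
qed

definition root :: "'a set set \<Rightarrow> 'a" where
  "root y = (THE x. rt y x)"

lemma root_eq: "rt y x \<Longrightarrow> root y = x"
  unfolding root_def using root_unique by blast

lemma rt_root: "y \<in> Y \<Longrightarrow> rt y (root y)"
  using root_exists root_eq by metis

lemma root_parent: "(y, z) \<in> par \<Longrightarrow> root y = root z"
proof -
  assume p: "(y, z) \<in> par"
  then have "z \<in> Y" using par_T T_sub by blast
  then have "rt z (root z)" by (rule rt_root)
  then have "rt y (root z)" unfolding root_iff using p by (meson converse_rtrancl_into_rtrancl)
  then show ?thesis by (rule root_eq)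
qed

text \<open>The connectedness required for contracting fibres: parent edges preserve the root, so
  each orientation reaches that of its root inside the fibre.\<close>

lemma root_fibre_connected:
  assumes "v \<in> Y" "w \<in> Y" "root v = root w"
  shows "(v, w) \<in> {(v, w) \<in> T. root v = root w}\<^sup>*"
proof -
  let ?F = "{(v, w) \<in> T. root v = root w}"
  have "par \<subseteq> ?F" using par_T root_parent by auto
  then have anchor: "(u, hat W (root u)) \<in> ?F\<^sup>*" if "u \<in> Y" for u
    using rt_root[OF that] rtrancl_mono unfolding root_iff by blast
  then have "(v, hat W (root v)) \<in> ?F\<^sup>*" "(w, hat W (root v)) \<in> ?F\<^sup>*"
    using anchor[OF assms(1)] anchor[OF assms(2)] by (simp_all only: assms(3))
  moreover have "sym (?F\<^sup>*)" using sym_T by (intro sym_rtrancl) (auto simp: sym_def)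
  ultimately show ?thesis by (meson rtrancl_trans symE)
qed

section \<open>The tree on the points of a class\<close>

abbreviation "PT \<equiv> point_tree C W col lt"

lemma root_C: "y \<in> Y \<Longrightarrow> root y \<in> C"
  using rt_root by (simp add: root_iff)

lemma root_idem: "y \<in> Y \<Longrightarrow> root (hat W (root y)) = root y"
  using rt_root[of y] by (intro root_eq) (simp add: root_iff)

lemma sym_PT: "sym PT"
proof (rule symI)
  fix x x' assume "(x, x') \<in> PT"
  moreover have "(y', y) \<in> T" if "(y, y') \<in> T" for y y' using that sym_T by (auto dest: symD)
  ultimately show "(x', x) \<in> PT" unfolding point_tree_def mem_Collect_eq case_prod_conv by metis
qed

lemma PT_cases:
  assumes "(x, x') \<in> PT"
  obtains "x = root (hat W x)" "x' = root (hat W x')" "x \<noteq> x'" "\<exists>(y, y')\<in>T. root y = x \<and> root y' = x'"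
  | "x \<noteq> root (hat W x)" "x' = root (hat W x)"
  | "x' \<noteq> root (hat W x')" "x = root (hat W x')"
proof -
  have x: "x \<in> C" "x' \<in> C" "x \<noteq> x'" using assms by (auto simp: point_tree_def)
  consider y y' where "y \<in> Y" "y' \<in> Y" "(y, y') \<in> T" "rt y x" "rt y' x'"
    | "rt (hat W x) x'" | "rt (hat W x') x"
    using assms unfolding point_tree_def by blast
  then show ?thesis
  proof cases
    case 1
    then have r: "root y = x" "root y' = x'" using root_eq by blast+
    have "x = root (hat W x)" "x' = root (hat W x')" using root_idem 1(1,2) r by metis+
    moreover have "\<exists>(y, y')\<in>T. root y = x \<and> root y' = x'" using 1(3) r by blast
    ultimately show ?thesis using that(1) x(3) by blast
  next
    case 2
    then show ?thesis using that(2) root_eq x(3) by metis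
  next
    case 3
    then show ?thesis using that(3) root_eq x(3) by metis
  qed
qed

text \<open>A point that is not its own root has a single neighbor, whereas on a cycle it would have
  two. What remains is a cycle in the contracted tree.\<close>

lemma acyclic_PT: "acyclic_graph PT"
  unfolding acyclic_graph_def
proof
  assume "\<exists>xs. graph_cycle PT xs"
  then obtain xs where xs: "graph_cycle PT xs" ..
  then obtain s m where m: "m \<ge> 3" and s: "\<And>i. (s i, s (Suc i)) \<in> PT" and
    per: "\<And>i j. s i = s j \<longleftrightarrow> i mod m = j mod m"
    and sxs: "m = length xs" "\<And>i. s i = xs ! (i mod m)"
    by (rule graph_cycle_periodic) blast
  let ?D = "{(a, b). a \<noteq> b \<and> (\<exists>(v, w) \<in> T. root v = a \<and> root w = b)}"
  have leaf: "b = root (hat W a)" if "(a, b) \<in> PT" "a \<noteq> root (hat W a)" for a b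
    using that(1)
  proof (cases rule: PT_cases)
    case 3
    have "a \<in> C" "b \<in> C" using that(1) by (auto simp: point_tree_def)
    then have "root (hat W a) = a" using 3 root_idem hat_Y by metis
    then show ?thesis using that by simp
  qed (use that in auto)
  have rep: "s i = root (hat W (s i))" for i
  proof (rule ccontr)
    assume *: "s i \<noteq> root (hat W (s i))"
    \<comment> \<open>The predecessor of \<open>s i\<close>, with a period added so that the
      subtraction is harmless at \<open>i = 0\<close>.\<close>
    have "(s (i + m), s (i + m - 1)) \<in> PT"
      using s[of "i + m - 1"] sym_PT m by (auto dest: symD)
    moreover have "s (i + m) = s i" using per by simp
    ultimately have "s (Suc i) = s (i + m - 1)" using leaf[OF _ *] s[of i] by metis
    then have "Suc i mod m = (i + m - 1) mod m" using per by blast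
    then have "m dvd (i + m - 1) - Suc i"
      using mod_eq_dvd_iff_nat[of "Suc i" "i + m - 1" m] m by (simp add: eq_commute)
    then have "m dvd m - 2" by (simp add: numeral_2_eq_2)
    then show False using m dvd_imp_le[of m "m - 2"] by simp
  qed
  have sD: "(s i, s (Suc i)) \<in> ?D" for i
    using s[of i]
  proof (cases rule: PT_cases)
    case 1
    then show ?thesis by auto
  qed (use rep in metis)+
  have "graph_cycle ?D xs"
    unfolding graph_cycle_def
  proof (intro conjI allI impI)
    show "3 \<le> length xs" "distinct xs" using xs by (auto simp: graph_cycle_def)
    fix i assume "i < length xs"
    then have "xs ! i = s i" "xs ! (Suc i mod length xs) = s (Suc i)" using sxs by simp_all
    then show "(xs ! i, xs ! (Suc i mod length xs)) \<in> ?D" using sD by simp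
  qed
  moreover have "acyclic_graph ?D"
    using acyclic_T root_fibre_connected T_sub by (rule acyclic_graph_contraction)
  ultimately show False unfolding acyclic_graph_def by blast
qed

lemma PT_sub: "PT \<subseteq> C \<times> C"
  by (auto simp: point_tree_def)

lemma PT_connected:
  assumes "x \<in> C" "x' \<in> C" shows "(x, x') \<in> PT\<^sup>*"
proof -
  have edge: "(root y, root y') \<in> PT\<^sup>*" if "(y, y') \<in> T" for y y'
  proof (cases "root y = root y'")
    case False
    have Y: "y \<in> Y" "y' \<in> Y" using that T_sub by auto
    then have "(root y, root y') \<in> PT"
      using False that rt_root root_C unfolding point_tree_def by blast
    then show ?thesis by simp
  qed simp
  have path: "(root y, root y') \<in> PT\<^sup>*" if "(y, y') \<in> T\<^sup>*" for y y'
    using that by (induction rule: rtrancl_induct) (auto intro: edge rtrancl_trans)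
  have leaf: "(z, root (hat W z)) \<in> PT\<^sup>*" if "z \<in> C" for z
  proof (cases "z = root (hat W z)")
    case False
    then have "(z, root (hat W z)) \<in> PT"
      using that rt_root[OF hat_Y[OF that]] root_C[OF hat_Y[OF that]] by (simp add: point_tree_def)
    then show ?thesis by simp
  qed simp
  have "(x, root (hat W x)) \<in> PT\<^sup>*" by (rule leaf[OF assms(1)])
  also have "(root (hat W x), root (hat W x')) \<in> PT\<^sup>*"
    by (rule path[OF T_connected[OF hat_Y[OF assms(1)] hat_Y[OF assms(2)]]])
  also have "(root (hat W x'), x') \<in> PT\<^sup>*"
    using leaf[OF assms(2)] sym_rtrancl[OF sym_PT] by (auto dest: symD)
  finally show ?thesis .
qed

end

section \<open>Coloring the walls\<close>

text \<open>Injectivity of a coloring on every hyperplane means that it is proper for this graph,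
  which has finite degrees because hyperplanes are finite.\<close>

definition wall_conflict :: "'a set \<Rightarrow> 'a set set \<Rightarrow> 'a set \<Rightarrow> 'a set \<Rightarrow> bool" where
  "wall_conflict C W K L \<longleftrightarrow> K \<noteq> L \<and> (\<exists>J\<in>W. K \<in> hyperplane C W J \<and> L \<in> hyperplane C W J)"

text \<open>\<open>n\<close> is the first resolution that tells \<open>K\<close> from all
  conflicting walls. Two conflicting walls of equal color would agree in \<open>n\<close> and in
  their pattern at \<open>n\<close>, contrary to the choice of \<open>n\<close>.\<close>

definition pattern_color :: "'a set \<Rightarrow> 'a set set \<Rightarrow> (nat \<Rightarrow> 'a set \<Rightarrow> nat) \<Rightarrow> 'a set \<Rightarrow> nat" where
  "pattern_color C W pat K =
    (let n = (LEAST n. \<forall>L\<in>W. wall_conflict C W K L \<longrightarrow> pat n L \<noteq> pat n K) in prod_encode (n, pat n K))"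

definition point_code :: "(nat \<Rightarrow> 'a set) \<Rightarrow> nat \<Rightarrow> 'a \<Rightarrow> nat" where
  "point_code A n z = set_encode {i. i < n \<and> z \<in> A i}"

text \<open>A finite approximation to the boundary pair: points are seen only through the first
  \<open>n\<close> sets of the separating family.\<close>

definition boundary_pattern ::
  "('a \<times> 'a) set \<Rightarrow> 'a set \<Rightarrow> (nat \<Rightarrow> 'a set) \<Rightarrow> nat \<Rightarrow> 'a set \<Rightarrow> nat" where
  "boundary_pattern G C A n H = prod_encode (set_encode (point_code A n ` inner_boundary G C H),
     set_encode (point_code A n ` outer_boundary G C H))"

lemma pattern_color_inj:
  assumes W: "\<And>K. K \<in> W \<Longrightarrow> K \<subseteq> C" and compl: "\<And>K. K \<in> W \<Longrightarrow> C - K \<in> W"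
    and cross: "\<And>K. K \<in> W \<Longrightarrow> finite {L \<in> W. crossing C K L}"
    and pat: "\<And>K L. K \<in> W \<Longrightarrow> L \<in> W \<Longrightarrow> K \<noteq> L \<Longrightarrow> \<exists>n0. \<forall>n\<ge>n0. pat n K \<noteq> pat n L"
    and J: "J \<in> W" and KL: "K \<in> hyperplane C W J" "L \<in> hyperplane C W J"
    and eq: "pattern_color C W pat K = pattern_color C W pat L"
  shows "K = L"
proof (rule ccontr)
  assume "K \<noteq> L"
  have KLW: "K \<in> W" "L \<in> W" using KL by (auto simp: hyperplane_def)
  have fin: "finite (hyperplane C W J)" if "J \<in> W" for J
  proof -
    have "hyperplane C W J \<subseteq> {J, C - J} \<union> {L \<in> W. crossing C J L}" by (auto simp: hyperplane_def)
    then show ?thesis using cross[OF that] finite_subset by blast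
  qed
  have hsym: "J \<in> hyperplane C W K" if "K \<in> hyperplane C W J" "J \<in> W" for J K
    using that W[of J] by (auto simp: hyperplane_def crossing_def Un_commute)
  have sep: "\<exists>n. \<forall>L\<in>W. wall_conflict C W K L \<longrightarrow> pat n L \<noteq> pat n K" if K: "K \<in> W" for K
  proof -
    let ?S = "{L \<in> W. wall_conflict C W K L}"
    have "?S \<subseteq> (\<Union>J\<in>hyperplane C W K. hyperplane C W J)"
      using hsym by (auto simp: wall_conflict_def)
    moreover have "finite (\<Union>J\<in>hyperplane C W K. hyperplane C W J)"
      using fin[OF K] fin by (intro finite_UN_I) (auto simp: hyperplane_def)
    ultimately have finS: "finite ?S" by (rule finite_subset)
    have "\<forall>L\<in>?S. \<exists>n0. \<forall>n\<ge>n0. pat n L \<noteq> pat n K" using pat K by (auto simp: wall_conflict_def)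
    then obtain n0 where n0: "\<forall>L\<in>?S. \<forall>n\<ge>n0 L. pat n L \<noteq> pat n K" by metis
    have "pat (Max (insert 0 (n0 ` ?S))) L \<noteq> pat (Max (insert 0 (n0 ` ?S))) K" if "L \<in> ?S" for L
      using n0 that finS by (intro n0[rule_format, OF that]) (simp add: Max_ge_iff)
    then show ?thesis by (intro exI[of _ "Max (insert 0 (n0 ` ?S))"]) blast
  qed
  define n where "n K = (LEAST n. \<forall>L\<in>W. wall_conflict C W K L \<longrightarrow> pat n L \<noteq> pat n K)" for K
  have col: "pattern_color C W pat K = prod_encode (n K, pat (n K) K)" for K
    by (simp add: pattern_color_def n_def Let_def)
  have nK: "\<forall>L\<in>W. wall_conflict C W K L \<longrightarrow> pat (n K) L \<noteq> pat (n K) K"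
    unfolding n_def by (rule LeastI_ex[OF sep[OF KLW(1)]])
  have "n K = n L" "pat (n K) K = pat (n L) L"
    using eq unfolding col prod_encode_eq prod.inject by blast+
  moreover have "wall_conflict C W K L" using \<open>K \<noteq> L\<close> J KL by (auto simp: wall_conflict_def)
  ultimately show False using nK KLW by auto
qed

text \<open>Needed for all large \<open>n\<close>, not for one, so that a common resolution exists
  for finitely many walls.\<close>

lemma point_code_eventually_inj:
  assumes "finite F" and sep: "\<And>x y. x \<in> F \<Longrightarrow> y \<in> F \<Longrightarrow> x \<noteq> y \<Longrightarrow> \<exists>n. (x \<in> A n) \<noteq> (y \<in> A n)"
  shows "\<exists>n0. \<forall>n\<ge>n0. inj_on (point_code A n) F"
proof -
  have "\<forall>p\<in>{(x, y). x \<in> F \<and> y \<in> F \<and> x \<noteq> y}. \<exists>n. (fst p \<in> A n) \<noteq> (snd p \<in> A n)"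
    using sep by auto
  from bchoice[OF this]
  obtain k where k: "\<forall>p\<in>{(x, y). x \<in> F \<and> y \<in> F \<and> x \<noteq> y}. (fst p \<in> A (k p)) \<noteq> (snd p \<in> A (k p))" ..
  let ?P = "{(x, y). x \<in> F \<and> y \<in> F \<and> x \<noteq> y}"
  have "finite ?P" by (rule finite_subset[of _ "F \<times> F"]) (use assms(1) in auto)
  then have le: "k p \<le> Max (insert 0 (k ` ?P))" if "p \<in> ?P" for p
    using that by (intro Max_ge) auto
  have "inj_on (point_code A n) F" if "n \<ge> Suc (Max (insert 0 (k ` ?P)))" for n
  proof (rule inj_onI, rule ccontr)
    fix x y assume xy: "x \<in> F" "y \<in> F" "point_code A n x = point_code A n y" "x \<noteq> y"
    then have "{i. i < n \<and> x \<in> A i} = {i. i < n \<and> y \<in> A i}"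
      by (simp add: point_code_def set_encode_eq)
    moreover have p: "(x, y) \<in> ?P" using xy by simp
    moreover have "k (x, y) < n" using le[OF p] that by simp
    ultimately have "x \<in> A (k (x, y)) \<longleftrightarrow> y \<in> A (k (x, y))" by blast
    then show False using k p by auto
  qed
  then show ?thesis by blast
qed

section \<open>Recovering a half-space from its boundaries\<close>

context end_basis_graph
begin

lemma boundary_nonempty:
  assumes "H \<subseteq> C" "H \<noteq> {}" "H \<noteq> C"
  shows "inner_boundary G C H \<noteq> {}" "outer_boundary G C H \<noteq> {}"
proof -
  obtain x y where "x \<in> H" "y \<in> C" "y \<notin> H" "x \<in> C" using assms by blast
  then obtain u v where uv: "(u, v) \<in> G" "u \<in> H" "v \<notin> H"
    using rtrancl_leaves[OF conn, of x y H] by blast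
  then have "u \<in> C" "v \<in> C" "(v, u) \<in> G" using closed assms(1) sym by (auto dest: symD)
  then show "inner_boundary G C H \<noteq> {}" "outer_boundary G C H \<noteq> {}"
    using uv by (auto simp: inner_boundary_def outer_boundary_def)
qed

text \<open>A path in the connected set \<open>H\<close> that starts in the common inner boundary
  cannot leave \<open>L\<close>, since it would enter the outer boundary of \<open>L\<close>, which
  is disjoint from \<open>H\<close>. The converse inclusion is the same for the complements.\<close>

lemma boundaries_determine:
  assumes H: "H \<subseteq> C" "H \<noteq> {}" "H \<noteq> C" "connected_set G H" "connected_set G (C - H)" and L: "L \<subseteq> C"
    and eq: "inner_boundary G C H = inner_boundary G C L" "outer_boundary G C H = outer_boundary G C L"
  shows "H = L"
proof
  obtain a where a: "a \<in> inner_boundary G C H" using boundary_nonempty[OF H(1-3)] by blast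
  obtain b where b: "b \<in> outer_boundary G C H" using boundary_nonempty[OF H(1-3)] by blast
  have aHL: "a \<in> H" "a \<in> L" using a eq(1) by (auto simp: inner_boundary_def)
  have bHL: "b \<in> C - H" "b \<in> C - L" using b eq(2) by (auto simp: inner_boundary_def outer_boundary_def)
  show "H \<subseteq> L"
  proof
    fix y assume y: "y \<in> H"
    show "y \<in> L"
    proof (rule ccontr)
      assume "y \<notin> L"
      moreover have "(a, y) \<in> (Restr G H)\<^sup>*" using H(4) aHL y by (auto simp: connected_set_def)
      ultimately obtain u v where uv: "(u, v) \<in> Restr G H" "u \<in> L" "v \<notin> L"
        using rtrancl_leaves[of a y _ L] aHL by blast
      then have "v \<in> outer_boundary G C L"
        using H(1) sym L by (auto simp: outer_boundary_def inner_boundary_def dest: symD)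
      then show False using eq(2) uv by (auto simp: outer_boundary_def inner_boundary_def)
    qed
  qed
  show "L \<subseteq> H"
  proof
    fix y assume y: "y \<in> L"
    show "y \<in> H"
    proof (rule ccontr)
      assume "y \<notin> H"
      then have "(b, y) \<in> (Restr G (C - H))\<^sup>*" using H(5) bHL y L by (auto simp: connected_set_def)
      then obtain u v where uv: "(u, v) \<in> Restr G (C - H)" "u \<in> C - L" "v \<notin> C - L"
        using rtrancl_leaves[of b y _ "C - L"] bHL y by blast
      then have "v \<in> inner_boundary G C L"
        using sym L by (auto simp: inner_boundary_def dest: symD)
      then show False using eq(1) uv by (auto simp: inner_boundary_def)
    qed
  qed
qed

lemma boundary_pattern_eventually_neq:
  assumes K: "K \<in> walls C \<H>" and L: "L \<in> walls C \<H>" and "K \<noteq> L"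
    and sep: "\<And>x y. x \<in> C \<Longrightarrow> y \<in> C \<Longrightarrow> x \<noteq> y \<Longrightarrow> \<exists>n. (x \<in> A n) \<noteq> (y \<in> A n)"
  shows "\<exists>n0. \<forall>n\<ge>n0. boundary_pattern G C A n K \<noteq> boundary_pattern G C A n L"
proof -
  let ?F = "vertex_boundary G C K \<union> vertex_boundary G C L"
  have FC: "?F \<subseteq> C" using wallsD(1)[OF K] wallsD(1)[OF L]
    by (auto simp: vertex_boundary_def inner_boundary_def outer_boundary_def)
  have finF: "finite ?F" using wallsD(5)[OF K] wallsD(5)[OF L] by simp
  obtain n0 where n0: "\<And>n. n \<ge> n0 \<Longrightarrow> inj_on (point_code A n) ?F"
    using point_code_eventually_inj[OF finF, of A] sep FC by (meson subsetD)
  have "boundary_pattern G C A n K \<noteq> boundary_pattern G C A n L" if n: "n \<ge> n0" for n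
  proof
    assume eq: "boundary_pattern G C A n K = boundary_pattern G C A n L"
    have fin: "finite (inner_boundary G C K)" "finite (inner_boundary G C L)"
      "finite (outer_boundary G C K)" "finite (outer_boundary G C L)"
      using finF by (auto simp: vertex_boundary_def)
    have img: "point_code A n ` inner_boundary G C K = point_code A n ` inner_boundary G C L"
      "point_code A n ` outer_boundary G C K = point_code A n ` outer_boundary G C L"
      using eq fin by (auto simp: boundary_pattern_def set_encode_eq)
    have "inner_boundary G C K = inner_boundary G C L"
      using inj_on_image_eq_iff[OF n0[OF n], of "inner_boundary G C K" "inner_boundary G C L"] img
      by (auto simp: vertex_boundary_def)
    moreover have "outer_boundary G C K = outer_boundary G C L"
      using inj_on_image_eq_iff[OF n0[OF n], of "outer_boundary G C K" "outer_boundary G C L"] img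
      by (auto simp: vertex_boundary_def)
    ultimately have "K = L"
      using boundaries_determine wallsD[OF K] wallsD(1)[OF L] by blast
    then show False using \<open>K \<noteq> L\<close> by simp
  qed
  then show ?thesis by blast
qed

end

section \<open>A Borel linear order on points, and the wallspace of a class\<close>

definition lex_less :: "(nat \<Rightarrow> 'a set) \<Rightarrow> 'a \<Rightarrow> 'a \<Rightarrow> bool" where
  "lex_less A x y \<longleftrightarrow> (\<exists>n. x \<notin> A n \<and> y \<in> A n \<and> (\<forall>m<n. x \<in> A m \<longleftrightarrow> y \<in> A m))"

lemma lex_less_trans:
  assumes "lex_less A x y" "lex_less A y z" shows "lex_less A x z"
proof -
  obtain n where n: "x \<notin> A n" "y \<in> A n" "\<forall>m<n. x \<in> A m \<longleftrightarrow> y \<in> A m"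
    using assms(1) by (auto simp: lex_less_def)
  obtain k where k: "y \<notin> A k" "z \<in> A k" "\<forall>m<k. y \<in> A m \<longleftrightarrow> z \<in> A m"
    using assms(2) by (auto simp: lex_less_def)
  have "n \<noteq> k" using n k by metis
  then show ?thesis
    unfolding lex_less_def using n k by (intro exI[of _ "min n k"]) (auto simp: min_def)
qed

lemma lex_less_total:
  assumes "(x \<in> A n) \<noteq> (y \<in> A n)" shows "lex_less A x y \<or> lex_less A y x"
proof -
  define k where "k = (LEAST n. (x \<in> A n) \<noteq> (y \<in> A n))"
  have "(x \<in> A k) \<noteq> (y \<in> A k)" unfolding k_def using assms by (rule LeastI)
  moreover have "\<forall>m<k. x \<in> A m \<longleftrightarrow> y \<in> A m" unfolding k_def using not_less_Least by blast
  ultimately show ?thesis unfolding lex_less_def by (cases "x \<in> A k") blast+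
qed

lemma (in end_basis_graph) wallspace_walls:
  assumes sep: "\<And>x y. x \<in> C \<Longrightarrow> y \<in> C \<Longrightarrow> x \<noteq> y \<Longrightarrow> \<exists>n. (x \<in> A n) \<noteq> (y \<in> A n)"
  shows "wallspace C (walls C \<H>) (pattern_color C (walls C \<H>) (boundary_pattern G C A)) (lex_less A)"
proof
  show "L = L'" if "K \<in> walls C \<H>" "L \<in> hyperplane C (walls C \<H>) K" "L' \<in> hyperplane C (walls C \<H>) K"
    "pattern_color C (walls C \<H>) (boundary_pattern G C A) L =
     pattern_color C (walls C \<H>) (boundary_pattern G C A) L'" for K L L'
  proof (rule pattern_color_inj[OF _ _ _ _ that])
    show "\<exists>n0. \<forall>n\<ge>n0. boundary_pattern G C A n H \<noteq> boundary_pattern G C A n H'"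
      if "H \<in> walls C \<H>" "H' \<in> walls C \<H>" "H \<noteq> H'" for H H'
      using that sep by (rule boundary_pattern_eventually_neq)
  qed (rule wallsD finite_crossing; assumption)+
  show "lex_less A x z" if "lex_less A x y" "lex_less A y z" for x y z
    using that by (rule lex_less_trans)
  show "lex_less A x y \<or> lex_less A y x" if "x \<in> C" "y \<in> C" "x \<noteq> y" for x y
    using sep[OF that] by (elim exE) (rule lex_less_total)
qed (auto simp: lex_less_def dest: wallsD intro: finite_separating finite_crossing finite_wall_ball)

section \<open>Borel measurability of the construction\<close>

lemma pred_cong:
  assumes "\<And>x. x \<in> space M \<Longrightarrow> P x \<longleftrightarrow> Q x" "Measurable.pred M Q"
  shows "Measurable.pred M P"
  using measurable_cong[of M P Q] assms by blast

lemma measurable_nat_of_pred: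
  fixes f :: "'a \<Rightarrow> nat"
  assumes "\<And>m. Measurable.pred M (\<lambda>x. f x = m)"
  shows "f \<in> measurable M (count_space UNIV)"
proof -
  have "f -` {m} \<inter> space M = {x \<in> space M. f x = m}" for m by auto
  then show ?thesis
    using predE[OF assms] by (simp add: measurable_count_space_eq2_countable)
qed

text \<open>Finiteness of \<open>N x\<close> is not presupposed: \<open>set_encode\<close> gives an
  infinite set the default code 0, and boundedness, a countable condition, tells the cases
  apart.\<close>

lemma pred_set_encode_eq:
  assumes "\<And>j. Measurable.pred M (\<lambda>x. j \<in> N x)"
  shows "Measurable.pred M (\<lambda>x. set_encode (N x) = m)"
proof (rule pred_cong)
  fix x
  have "set_encode (N x) = m \<longleftrightarrow> N x = set_decode m" if "finite (N x)"
    using that by (metis set_decode_inverse set_encode_inverse finite_set_decode)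
  moreover have "set_encode (N x) = 0" if "infinite (N x)"
    using that by (simp add: set_encode_def)
  moreover have "finite (N x) \<longleftrightarrow> (\<exists>b. \<forall>j. j \<in> N x \<longrightarrow> j \<le> b)"
    by (meson finite_nat_set_iff_bounded_le)
  ultimately show "set_encode (N x) = m \<longleftrightarrow>
    (if \<exists>b. \<forall>j. j \<in> N x \<longrightarrow> j \<le> b then \<forall>j. j \<in> N x \<longleftrightarrow> j \<in> set_decode m else m = 0)"
    by auto
next
  show "Measurable.pred M (\<lambda>x. if \<exists>b. \<forall>j. j \<in> N x \<longrightarrow> j \<le> b then \<forall>j. j \<in> N x \<longleftrightarrow> j \<in> set_decode m else m = 0)"
    using assms by measurable
qed

section \<open>Borel choices of points, finite sets and walls\<close>

locale wall_cber =
  fixes M :: "'a measure" and E G :: "('a \<times> 'a) set" and \<H> :: "'a set \<Rightarrow> 'a set set"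
    and A :: "nat \<Rightarrow> 'a set" and g :: "nat \<Rightarrow> 'a \<Rightarrow> 'a"
  assumes E: "countable_borel_equivalence M E"
    and graphing: "borel_graphing M E G"
    and lf: "locally_finite_graph (space M) G"
    and assignment: "borel_assignment M E G \<H>"
    and half_spaces: "\<And>C H. C \<in> space M // E \<Longrightarrow> H \<in> \<H> C \<Longrightarrow>
           H \<subseteq> C \<and> finite (vertex_boundary G C H) \<and>
           connected_set G H \<and> connected_set G (C - H)"
    and boundaries: "\<And>C x. C \<in> space M // E \<Longrightarrow> x \<in> C \<Longrightarrow>
           finite {H \<in> \<H> C. x \<in> vertex_boundary G C H}"
    and ends: "\<And>C U A. C \<in> space M // E \<Longrightarrow> graph_end G C U \<Longrightarrow> A \<in> U \<Longrightarrow>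
           \<exists>H \<in> \<H> C. H \<in> U \<and> H \<subseteq> A"
    and A_sets [measurable]: "\<And>n. A n \<in> sets M"
    and A_sep: "\<And>x y. x \<in> space M \<Longrightarrow> y \<in> space M \<Longrightarrow> x \<noteq> y \<Longrightarrow> \<exists>n. (x \<in> A n) \<noteq> (y \<in> A n)"
    and g_meas [measurable]: "\<And>n. g n \<in> measurable M M"
    and g_range: "\<And>x. x \<in> space M \<Longrightarrow> E `` {x} = range (\<lambda>n. g n x)"
begin

abbreviation cl :: "'a \<Rightarrow> 'a set" where "cl x \<equiv> E `` {x}"
abbreviation W :: "'a \<Rightarrow> 'a set set" where "W x \<equiv> walls (cl x) (\<H> (cl x))"

lemma equiv_E: "equiv (space M) E" and E_sets: "E \<in> sets (M \<Otimes>\<^sub>M M)"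
  and G_sets [measurable]: "G \<in> sets (M \<Otimes>\<^sub>M M)" and sym_G: "sym G"
  and G_E: "Restr (G\<^sup>*) (space M) = E"
  using E graphing by (auto simp: countable_borel_equivalence_def borel_graphing_def)

lemma G_sub: "(x, y) \<in> G \<Longrightarrow> x \<in> space M \<and> y \<in> space M"
  using sets.sets_into_space[OF G_sets] by (auto simp: space_pair_measure)

lemma class_mem: "x \<in> space M \<Longrightarrow> cl x \<in> space M // E"
  by (rule quotientI)

lemma cl_sub: "x \<in> space M \<Longrightarrow> cl x \<subseteq> space M"
  using equiv_E by (auto simp: equiv_def refl_on_def)

lemma cl_eq: "x \<in> space M \<Longrightarrow> y \<in> cl x \<Longrightarrow> cl y = cl x"
  using equiv_class_eq[OF equiv_E, of x y] by simp

lemma cl_self: "x \<in> space M \<Longrightarrow> x \<in> cl x"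
  using equiv_class_self[OF equiv_E] .

lemma g_cl: "x \<in> space M \<Longrightarrow> g n x \<in> cl x"
  using g_range by blast

lemma clE: "z \<in> cl x \<Longrightarrow> x \<in> space M \<Longrightarrow> (\<And>k. z = g k x \<Longrightarrow> thesis) \<Longrightarrow> thesis"
  using g_range by blast

lemma end_basis: 
  assumes x: "x \<in> space M" shows "end_basis_graph G (cl x) (\<H> (cl x))"
proof
  show "sym G" by (rule sym_G)
  show "finite (G `` {y})" if "y \<in> cl x" for y
    using lf cl_sub[OF x] that by (auto simp: locally_finite_graph_def)
  show "z \<in> cl x" if "(y, z) \<in> G" "y \<in> cl x" for y z
  proof -
    have "(y, z) \<in> E" using that(1) G_sub[OF that(1)] G_E by blast
    then have "z \<in> cl y" by simp
    then show ?thesis using cl_eq[OF x that(2)] by simp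
  qed
  show "(y, z) \<in> G\<^sup>*" if "y \<in> cl x" "z \<in> cl x" for y z
  proof -
    have "z \<in> cl y" using cl_eq[OF x that(1)] that(2) by simp
    then show ?thesis using G_E by blast
  qed
qed (use half_spaces[OF class_mem[OF x]] boundaries[OF class_mem[OF x]] ends[OF class_mem[OF x]] in blast)+

lemma pred_point_eq: 
  assumes [measurable]: "p \<in> measurable M M" "q \<in> measurable M M"
  shows "Measurable.pred M (\<lambda>x. p x = q x)"
proof (rule pred_cong)
  fix x assume "x \<in> space M"
  then have "p x \<in> space M" "q x \<in> space M" using assms measurable_space by metis+
  then show "p x = q x \<longleftrightarrow> (\<forall>n. p x \<in> A n \<longleftrightarrow> q x \<in> A n)" using A_sep by metis
qed measurable

lemma pred_edge [measurable]: "Measurable.pred M (\<lambda>x. (g i x, g j x) \<in> G)"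
  by measurable

text \<open>Quantifiers over a class become countable through the enumeration \<open>g\<close>; it
  suffices to know \<open>P\<close> along the functions \<open>g k\<close>.\<close>

lemma pred_cl_ex:
  assumes "\<And>k. Measurable.pred M (\<lambda>x. P x (g k x))"
  shows "Measurable.pred M (\<lambda>x. \<exists>z\<in>cl x. P x z)"
proof (rule pred_cong)
  show "(\<exists>z\<in>cl x. P x z) \<longleftrightarrow> (\<exists>k. P x (g k x))" if "x \<in> space M" for x
    using g_range[OF that] by auto
  show "Measurable.pred M (\<lambda>x. \<exists>k. P x (g k x))" using assms by measurable
qed

lemma pred_cl_all:
  assumes "\<And>k. Measurable.pred M (\<lambda>x. P x (g k x))"
  shows "Measurable.pred M (\<lambda>x. \<forall>z\<in>cl x. P x z)"
proof (rule pred_cong)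
  show "(\<forall>z\<in>cl x. P x z) \<longleftrightarrow> (\<forall>k. P x (g k x))" if "x \<in> space M" for x
    using g_range[OF that] by auto
  show "Measurable.pred M (\<lambda>x. \<forall>k. P x (g k x))" using assms by measurable
qed

lemmas pred_logic = pred_intros_logic(2-) pred_intros_countable pred_cl_ex pred_cl_all

text \<open>A Borel choice of a subset of each class, evaluated at each point of that class.\<close>

definition meas_set :: "('a \<Rightarrow> 'a set) \<Rightarrow> bool" where
  "meas_set S \<longleftrightarrow> (\<forall>x\<in>space M. S x \<subseteq> cl x) \<and> (\<forall>k. Measurable.pred M (\<lambda>x. g k x \<in> S x))"

lemma meas_set_sub: "meas_set S \<Longrightarrow> x \<in> space M \<Longrightarrow> S x \<subseteq> cl x"
  and pred_mem: "meas_set S \<Longrightarrow> Measurable.pred M (\<lambda>x. g k x \<in> S x)"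
  by (auto simp: meas_set_def)

lemma meas_set_Diff: "meas_set S \<Longrightarrow> meas_set (\<lambda>x. cl x - S x)"
  unfolding meas_set_def
proof (intro conjI ballI allI)
  fix k assume "(\<forall>x\<in>space M. S x \<subseteq> cl x) \<and> (\<forall>k. Measurable.pred M (\<lambda>x. g k x \<in> S x))"
  then have "Measurable.pred M (\<lambda>x. g k x \<notin> S x)" by (intro pred_logic) blast
  then show "Measurable.pred M (\<lambda>x. g k x \<in> cl x - S x)"
    by (rule pred_cong[rotated]) (use g_cl in auto)
qed auto

lemma pred_set_eq:
  assumes S: "meas_set S" and S': "meas_set S'" shows "Measurable.pred M (\<lambda>x. S x = S' x)"
proof (rule pred_cong)
  show "Measurable.pred M (\<lambda>x. \<forall>z\<in>cl x. z \<in> S x \<longleftrightarrow> z \<in> S' x)" (is "Measurable.pred M ?Q")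
    by (intro pred_logic pred_mem S S')
  show "S x = S' x \<longleftrightarrow> ?Q x" if "x \<in> space M" for x
    using meas_set_sub[OF S that] meas_set_sub[OF S' that] by blast
qed

lemma meas_set_empty: "meas_set (\<lambda>x. {})" and meas_set_full: "meas_set (\<lambda>x. cl x)"
proof -
  show e: "meas_set (\<lambda>x. {})" by (simp add: meas_set_def)
  show "meas_set (\<lambda>x. cl x)" using meas_set_Diff[OF e] by simp
qed

lemma meas_set_inner_boundary:
  assumes S: "meas_set S" shows "meas_set (\<lambda>x. inner_boundary G (cl x) (S x))"
  unfolding meas_set_def
proof (intro conjI ballI allI)
  show "inner_boundary G (cl x) (S x) \<subseteq> cl x" if "x \<in> space M" for x
    using meas_set_sub[OF S that] by (auto simp: inner_boundary_def)
  fix k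
  show "Measurable.pred M (\<lambda>x. g k x \<in> inner_boundary G (cl x) (S x))"
  proof (rule pred_cong)
    show "Measurable.pred M (\<lambda>x. g k x \<in> S x \<and> (\<exists>y\<in>cl x. y \<notin> S x \<and> (g k x, y) \<in> G))" (is "Measurable.pred M ?Q")
      by (intro pred_logic pred_mem S pred_edge)
    show "g k x \<in> inner_boundary G (cl x) (S x) \<longleftrightarrow> ?Q x" for x
      by (auto simp: inner_boundary_def)
  qed
qed

lemma meas_set_outer_boundary:
  assumes S: "meas_set S" shows "meas_set (\<lambda>x. outer_boundary G (cl x) (S x))"
  unfolding outer_boundary_def by (intro meas_set_inner_boundary meas_set_Diff S)

text \<open>Index lists as uniform codes for the finite subsets of the classes: countably many codes
  serve all classes.\<close>

definition pts :: "nat list \<Rightarrow> 'a \<Rightarrow> 'a set" where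
  "pts I x = (\<lambda>i. g i x) ` set I"

lemma meas_set_pts: "meas_set (pts I)"
  unfolding meas_set_def
proof (intro conjI ballI allI)
  show "pts I x \<subseteq> cl x" if "x \<in> space M" for x using g_cl[OF that] by (auto simp: pts_def)
  fix k
  have "Measurable.pred M (\<lambda>x. \<exists>i\<in>set I. g k x = g i x)"
    by (intro pred_intros_finite pred_point_eq g_meas) simp
  then show "Measurable.pred M (\<lambda>x. g k x \<in> pts I x)"
    by (rule pred_cong[rotated]) (auto simp: pts_def)
qed

lemma finite_subset_pts:
  assumes "x \<in> space M" "finite F" "F \<subseteq> cl x" obtains I where "F = pts I x"
proof -
  have "F \<subseteq> (\<lambda>i. g i x) ` UNIV" using assms g_range by simp
  then obtain N where "finite N" "F = (\<lambda>i. g i x) ` N" using assms(2) by (meson finite_subset_image)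
  moreover obtain I where "set I = N" using finite_list[OF \<open>finite N\<close>] by blast
  ultimately show ?thesis using that by (auto simp: pts_def)
qed

text \<open>The map factors through tuples of length \<open>n\<close>, and the sigma-algebra on
  finite sets is defined by preimages under the passage from tuples to sets.\<close>

lemma measurable_pts: "pts I \<in> measurable M (finite_subset_space M)"
proof (rule measurableI)
  fix x assume "x \<in> space M"
  then show "pts I x \<in> space (finite_subset_space M)"
    using g_cl cl_sub by (auto simp: space_finite_subset_space finite_subsets_def pts_def)
next
  fix S assume S: "S \<in> sets (finite_subset_space M)"
  define n where "n = length I"
  define f where "f x = (\<lambda>i\<in>{..<n}. g (I ! i) x)" for x
  have f: "f \<in> measurable M (Pi\<^sub>M {..<n} (\<lambda>_. M))" unfolding f_def by measurable
  have img: "f x ` {..<n} = pts I x" for x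
    by (auto simp: f_def pts_def n_def set_conv_nth image_iff)
  have "{f \<in> space (Pi\<^sub>M {..<n} (\<lambda>_. M)). f ` {..<n} \<in> S} \<in> sets (Pi\<^sub>M {..<n} (\<lambda>_. M))"
    using S by (simp add: sets_finite_subset_space)
  from measurable_sets[OF f this]
  have "f -` {f \<in> space (Pi\<^sub>M {..<n} (\<lambda>_. M)). f ` {..<n} \<in> S} \<inter> space M \<in> sets M" .
  moreover have "f -` {f \<in> space (Pi\<^sub>M {..<n} (\<lambda>_. M)). f ` {..<n} \<in> S} \<inter> space M = pts I -` S \<inter> space M"
    using measurable_space[OF f] img by auto
  ultimately show "pts I -` S \<inter> space M \<in> sets M" by simp
qed

definition coded :: "('a set \<times> 'a set) set" where
  "coded = {(inner_boundary G C H, outer_boundary G C H) | C H. C \<in> space M // E \<and> H \<in> \<H> C - {{}, C}}"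

lemma coded_sets: "coded \<in> sets (finite_subset_space M \<Otimes>\<^sub>M finite_subset_space M)"
  using assignment by (simp add: borel_assignment_def coded_def)

text \<open>\<open>coded\<close> mixes all classes. A boundary vertex, which exists because
  \<open>H\<close> is nontrivial, identifies the class; connectedness of the coded half-space then
  identifies \<open>H\<close>.\<close>

lemma coded_iff:
  assumes x: "x \<in> space M" and H: "H \<subseteq> cl x" "H \<noteq> {}" "H \<noteq> cl x"
  shows "H \<in> \<H> (cl x) \<longleftrightarrow> (inner_boundary G (cl x) H, outer_boundary G (cl x) H) \<in> coded"
proof
  assume "H \<in> \<H> (cl x)"
  then show "(inner_boundary G (cl x) H, outer_boundary G (cl x) H) \<in> coded"
    using H class_mem[OF x] unfolding coded_def by blast
next
  interpret end_basis_graph G "cl x" "\<H> (cl x)" by (rule end_basis[OF x])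
  assume "(inner_boundary G (cl x) H, outer_boundary G (cl x) H) \<in> coded"
  then obtain D K where DK: "D \<in> space M // E" "K \<in> \<H> D" "K \<noteq> {}" "K \<noteq> D"
    and eq: "inner_boundary G (cl x) H = inner_boundary G D K" "outer_boundary G (cl x) H = outer_boundary G D K"
    unfolding coded_def by blast
  obtain a where "a \<in> inner_boundary G (cl x) H" using boundary_nonempty[OF H] by blast
  then have a: "a \<in> cl x" "a \<in> D"
    using eq(1) H(1) half_spaces[OF DK(1,2)] by (auto simp: inner_boundary_def)
  have D: "D = cl x"
    using quotient_disj[OF equiv_E DK(1) class_mem[OF x]] a by blast
  have "K = H"
    using boundaries_determine[of K H] half_space[of K] DK eq H(1) unfolding D by simp
  then show "H \<in> \<H> (cl x)" using DK D by simp
qed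

text \<open>\<open>S x\<close> may be infinite, so \<open>S\<close> is not a map into the space of
  finite sets. Members of \<open>coded\<close> are pairs of finite sets, which index lists
  describe.\<close>

lemma pred_coded:
  assumes S: "meas_set S" and S': "meas_set S'"
  shows "Measurable.pred M (\<lambda>x. (S x, S' x) \<in> coded)"
proof (rule pred_cong)
  fix x assume x: "x \<in> space M"
  have "\<exists>I. F = pts I x" if "finite F" "F \<subseteq> cl x" for F using finite_subset_pts[OF x that] by blast
  moreover have "finite (S x)" "finite (S' x)" if "(S x, S' x) \<in> coded"
    using sets.sets_into_space[OF coded_sets] that
    by (auto simp: space_pair_measure space_finite_subset_space finite_subsets_def)
  ultimately show "(S x, S' x) \<in> coded \<longleftrightarrow>
      (\<exists>I J. S x = pts I x \<and> S' x = pts J x \<and> (pts I x, pts J x) \<in> coded)"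
    using meas_set_sub[OF S x] meas_set_sub[OF S' x] by metis
next
  have "Measurable.pred M (\<lambda>x. (pts I x, pts J x) \<in> coded)" for I J
    using coded_sets measurable_pts[of I] measurable_pts[of J] by measurable
  then show "Measurable.pred M (\<lambda>x. \<exists>I J. S x = pts I x \<and> S' x = pts J x \<and> (pts I x, pts J x) \<in> coded)"
    by (intro pred_logic pred_set_eq meas_set_pts S S')
qed

lemma pred_wall:
  assumes S: "meas_set S" shows "Measurable.pred M (\<lambda>x. S x \<in> W x)"
proof (rule pred_cong)
  fix x assume x: "x \<in> space M"
  have sub: "S x \<subseteq> cl x" by (rule meas_set_sub[OF S x])
  \<comment> \<open>Complementation exchanges the boundaries, so \<open>coded\<close> decides about
    both sides of a wall.\<close>
  have bd: "inner_boundary G (cl x) (cl x - S x) = outer_boundary G (cl x) (S x)"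
    "outer_boundary G (cl x) (cl x - S x) = inner_boundary G (cl x) (S x)"
    using sub by (simp_all add: outer_boundary_def double_diff)
  have "S x \<in> W x \<longleftrightarrow> S x \<noteq> {} \<and> S x \<noteq> cl x \<and> (S x \<in> \<H> (cl x) \<or> cl x - S x \<in> \<H> (cl x))"
    using sub by (simp add: walls_def)
  also have "\<dots> \<longleftrightarrow> S x \<noteq> {} \<and> S x \<noteq> cl x \<and>
     ((inner_boundary G (cl x) (S x), outer_boundary G (cl x) (S x)) \<in> coded \<or>
      (outer_boundary G (cl x) (S x), inner_boundary G (cl x) (S x)) \<in> coded)"
  proof (intro conj_cong refl)
    assume *: "S x \<noteq> {}" "S x \<noteq> cl x"
    then have "cl x - S x \<noteq> {}" "cl x - S x \<noteq> cl x" using sub by blast+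
    then show "(S x \<in> \<H> (cl x) \<or> cl x - S x \<in> \<H> (cl x)) \<longleftrightarrow>
     ((inner_boundary G (cl x) (S x), outer_boundary G (cl x) (S x)) \<in> coded \<or>
      (outer_boundary G (cl x) (S x), inner_boundary G (cl x) (S x)) \<in> coded)"
      using coded_iff[OF x sub *] coded_iff[OF x, of "cl x - S x"] bd by simp
  qed
  finally show "S x \<in> W x \<longleftrightarrow> S x \<noteq> {} \<and> S x \<noteq> cl x \<and>
     ((inner_boundary G (cl x) (S x), outer_boundary G (cl x) (S x)) \<in> coded \<or>
      (outer_boundary G (cl x) (S x), inner_boundary G (cl x) (S x)) \<in> coded)" .
next
  show "Measurable.pred M (\<lambda>x. S x \<noteq> {} \<and> S x \<noteq> cl x \<and>
     ((inner_boundary G (cl x) (S x), outer_boundary G (cl x) (S x)) \<in> coded \<or>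
      (outer_boundary G (cl x) (S x), inner_boundary G (cl x) (S x)) \<in> coded))"
    by (intro pred_logic pred_set_eq pred_coded S meas_set_empty meas_set_full
        meas_set_inner_boundary meas_set_outer_boundary)
qed

definition avoiding :: "nat list \<Rightarrow> 'a \<Rightarrow> ('a \<times> 'a) set" where
  "avoiding J x = {(u, v) \<in> G. u \<in> cl x - pts J x \<and> v \<in> cl x - pts J x}"

text \<open>The lists \<open>fst h\<close> and \<open>snd h\<close> stand for the inner and the
  outer boundary. Arbitrary lists also give a Borel choice of subsets; whether it is a wall is
  tested separately.\<close>

definition wall_of :: "nat list \<times> nat list \<Rightarrow> 'a \<Rightarrow> 'a set" where
  "wall_of h x = {z \<in> cl x. \<exists>n. \<exists>u\<in>cl x. u \<in> pts (fst h) x \<and> (z, u) \<in> avoiding (snd h) x ^^ n}"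

lemma pred_avoiding_relpow: "Measurable.pred M (\<lambda>x. (g i x, g j x) \<in> avoiding J x ^^ n)"
proof (induction n arbitrary: j)
  case 0
  show ?case using pred_point_eq[OF g_meas g_meas] by simp
next
  case (Suc n)
  show ?case
  proof (rule pred_cong)
    show "Measurable.pred M (\<lambda>x. \<exists>z\<in>cl x. (g i x, z) \<in> avoiding J x ^^ n \<and>
        (z, g j x) \<in> G \<and> z \<notin> pts J x \<and> g j x \<notin> pts J x)" (is "Measurable.pred M ?Q")
      by (intro pred_logic Suc.IH pred_edge pred_mem meas_set_pts)
    show "(g i x, g j x) \<in> avoiding J x ^^ Suc n \<longleftrightarrow> ?Q x" if "x \<in> space M" for x
      using g_cl[OF that] by (auto simp: avoiding_def)
  qed
qed

lemma meas_set_wall_of: "meas_set (wall_of h)"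
  unfolding meas_set_def
proof (intro conjI ballI allI)
  show "wall_of h x \<subseteq> cl x" for x by (auto simp: wall_of_def)
  fix k
  show "Measurable.pred M (\<lambda>x. g k x \<in> wall_of h x)"
  proof (rule pred_cong)
    show "Measurable.pred M (\<lambda>x. \<exists>n. \<exists>u\<in>cl x. u \<in> pts (fst h) x \<and> (g k x, u) \<in> avoiding (snd h) x ^^ n)" (is "Measurable.pred M ?Q")
      by (intro pred_logic pred_mem meas_set_pts pred_avoiding_relpow)
    show "g k x \<in> wall_of h x \<longleftrightarrow> ?Q x"
      if "x \<in> space M" for x using g_cl[OF that] by (simp add: wall_of_def)
  qed
qed

text \<open>A half-space is the set of points connected to its inner boundary off its outer boundary.\<close>

lemma wall_of_surj:
  assumes x: "x \<in> space M" and H: "H \<in> W x" shows "\<exists>h. H = wall_of h x"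
proof -
  interpret end_basis_graph G "cl x" "\<H> (cl x)" by (rule end_basis[OF x])
  note HW = wallsD[OF H]
  have fin: "finite (inner_boundary G (cl x) H)" "finite (outer_boundary G (cl x) H)"
    using HW(5) by (auto simp: vertex_boundary_def)
  have sub: "inner_boundary G (cl x) H \<subseteq> cl x" "outer_boundary G (cl x) H \<subseteq> cl x"
    using HW(1) by (auto simp: inner_boundary_def outer_boundary_def)
  obtain I where I: "inner_boundary G (cl x) H = pts I x" using finite_subset_pts[OF x fin(1) sub(1)] .
  obtain J where J: "outer_boundary G (cl x) H = pts J x" using finite_subset_pts[OF x fin(2) sub(2)] .
  have IH: "pts I x \<subseteq> H" using I by (auto simp: inner_boundary_def)
  have JH: "pts J x \<inter> H = {}" using J by (auto simp: inner_boundary_def outer_boundary_def)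
  have "z \<in> H \<longleftrightarrow> z \<in> wall_of (I, J) x" for z
  proof
    assume z: "z \<in> H"
    obtain u where u: "u \<in> pts I x" using boundary_nonempty(1)[OF HW(1-3)] I by blast
    have "(z, u) \<in> (Restr G H)\<^sup>*" using HW(6) z u IH by (auto simp: connected_set_def)
    moreover have "Restr G H \<subseteq> avoiding J x" using JH HW(1) by (auto simp: avoiding_def)
    ultimately have "(z, u) \<in> (avoiding J x)\<^sup>*" using rtrancl_mono by blast
    then show "z \<in> wall_of (I, J) x" using u IH HW(1) z by (auto simp: wall_of_def rtrancl_power)
  next
    assume "z \<in> wall_of (I, J) x"
    then obtain u where u: "u \<in> pts I x" "(z, u) \<in> (avoiding J x)\<^sup>*"
      by (auto simp: wall_of_def rtrancl_power)
    from u(2) show "z \<in> H"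
    proof (induction rule: converse_rtrancl_induct)
      case base
      then show ?case using u(1) IH by blast
    next
      case (step z v)
      show ?case
      proof (rule ccontr)
        assume "z \<notin> H"
        then have "z \<in> outer_boundary G (cl x) H"
          using step by (auto simp: avoiding_def outer_boundary_def inner_boundary_def)
        then show False using step.hyps(1) J by (auto simp: avoiding_def)
      qed
    qed
  qed
  then show ?thesis by blast
qed

text \<open>Every wall has one of countably many codes, and each code is a Borel choice to which the
  assumption applies.\<close>

lemma pred_W_ex:
  assumes "\<And>S. meas_set S \<Longrightarrow> Measurable.pred M (\<lambda>x. P x (S x))"
  shows "Measurable.pred M (\<lambda>x. \<exists>H\<in>W x. P x H)"
proof (rule pred_cong)
  show "Measurable.pred M (\<lambda>x. \<exists>h. wall_of h x \<in> W x \<and> P x (wall_of h x))" (is "Measurable.pred M ?Q")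
    by (intro pred_logic pred_wall assms meas_set_wall_of)
  show "(\<exists>H\<in>W x. P x H) \<longleftrightarrow> ?Q x" if "x \<in> space M" for x
    using wall_of_surj[OF that] by metis
qed

lemma pred_W_all:
  assumes "\<And>S. meas_set S \<Longrightarrow> Measurable.pred M (\<lambda>x. P x (S x))"
  shows "Measurable.pred M (\<lambda>x. \<forall>H\<in>W x. P x H)"
proof (rule pred_cong)
  show "(\<forall>H\<in>W x. P x H) \<longleftrightarrow> \<not> (\<exists>H\<in>W x. \<not> P x H)" for x by blast
  show "Measurable.pred M (\<lambda>x. \<not> (\<exists>H\<in>W x. \<not> P x H))"
    by (intro pred_logic pred_W_ex assms)
qed

end

section \<open>Borel choices of orientations, colors and tree edges\<close>

lemma pred_nat_rel:
  fixes f h :: "'a \<Rightarrow> nat"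
  assumes [measurable]: "f \<in> measurable M (count_space UNIV)" "h \<in> measurable M (count_space UNIV)"
  shows "Measurable.pred M (\<lambda>x. R (f x) (h x))"
proof (rule pred_cong)
  show "R (f x) (h x) \<longleftrightarrow> (\<exists>a b. f x = a \<and> h x = b \<and> R a b)" for x by simp
  show "Measurable.pred M (\<lambda>x. \<exists>a b. f x = a \<and> h x = b \<and> R a b)" by measurable
qed

lemma measurable_nat_fun2:
  fixes f h :: "'a \<Rightarrow> nat" and r :: "nat \<Rightarrow> nat \<Rightarrow> nat"
  assumes "f \<in> measurable M (count_space UNIV)" "h \<in> measurable M (count_space UNIV)"
  shows "(\<lambda>x. r (f x) (h x)) \<in> measurable M (count_space UNIV)"
  by (rule measurable_nat_of_pred) (rule pred_nat_rel[OF assms])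

context wall_cber
begin

abbreviation wcol :: "'a \<Rightarrow> 'a set \<Rightarrow> nat" where
  "wcol x \<equiv> pattern_color (cl x) (W x) (boundary_pattern G (cl x) A)"

abbreviation Or :: "'a \<Rightarrow> 'a set set set" where "Or x \<equiv> orientations (cl x) (W x)"
abbreviation TE where "TE x \<equiv> tree_edges (cl x) (W x) (wcol x)"
abbreviation PAR where "PAR x \<equiv> parent (cl x) (W x) (wcol x) (lex_less A)"

lemma wallspace_cl:
  assumes "x \<in> space M" shows "wallspace (cl x) (W x) (wcol x) (lex_less A)"
proof -
  interpret end_basis_graph G "cl x" "\<H> (cl x)" by (rule end_basis[OF assms])
  show ?thesis
    by (rule wallspace_walls) (use A_sep cl_sub[OF assms] in blast)
qed

text \<open>The analogue of \<open>meas_set\<close> one level up: a set of walls is tested against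
  every Borel choice of a subset.\<close>

definition meas_walls :: "('a \<Rightarrow> 'a set set) \<Rightarrow> bool" where
  "meas_walls y \<longleftrightarrow> (\<forall>x\<in>space M. y x \<subseteq> W x) \<and> (\<forall>S. meas_set S \<longrightarrow> Measurable.pred M (\<lambda>x. S x \<in> y x))"

lemma meas_walls_sub: "meas_walls y \<Longrightarrow> x \<in> space M \<Longrightarrow> y x \<subseteq> W x"
  and pred_wall_mem: "meas_walls y \<Longrightarrow> meas_set S \<Longrightarrow> Measurable.pred M (\<lambda>x. S x \<in> y x)"
  by (auto simp: meas_walls_def)

lemma meas_walls_hat: "meas_walls (\<lambda>x. hat (W x) (g k x))"
  unfolding meas_walls_def hat_def mem_Collect_eq
  by (intro conjI ballI allI impI pred_logic pred_wall pred_mem) auto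

text \<open>The inequality acts as exclusive or: the orientation by a base point is reversed on
  finitely many listed walls. A code need not yield an orientation, which is tested
  separately.\<close>

definition orientation_of :: "nat \<times> (nat list \<times> nat list) list \<Rightarrow> 'a \<Rightarrow> 'a set set" where
  "orientation_of q x = {H \<in> W x. (g (fst q) x \<in> H) \<noteq> (\<exists>h\<in>set (snd q). H = wall_of h x \<or> H = cl x - wall_of h x)}"

lemma meas_walls_orientation_of: "meas_walls (orientation_of q)"
  unfolding meas_walls_def
proof (intro conjI ballI allI impI)
  show "orientation_of q x \<subseteq> W x" for x by (auto simp: orientation_of_def)
  fix S assume S: "meas_set S"
  have "Measurable.pred M (\<lambda>x. S x \<in> W x \<and>
      ((g (fst q) x \<in> S x) \<noteq> (\<exists>h\<in>set (snd q). S x = wall_of h x \<or> S x = cl x - wall_of h x)))"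
    by (intro pred_logic pred_wall pred_mem pred_intros_finite pred_set_eq meas_set_Diff meas_set_wall_of S finite_set)
  then show "Measurable.pred M (\<lambda>x. S x \<in> orientation_of q x)" by (simp add: orientation_of_def)
qed

lemma wall_of_list:
  assumes x: "x \<in> space M" and D: "finite D" "D \<subseteq> W x"
  shows "\<exists>l. D = (\<lambda>h. wall_of h x) ` set l"
proof -
  have "D \<subseteq> (\<lambda>h. wall_of h x) ` UNIV" using D(2) wall_of_surj[OF x] by blast
  then obtain N where "finite N" "D = (\<lambda>h. wall_of h x) ` N" using D(1) by (meson finite_subset_image)
  moreover obtain l where "set l = N" using finite_list[OF \<open>finite N\<close>] by blast
  ultimately show ?thesis by blast
qed

lemma orientation_of_surj:
  assumes x: "x \<in> space M" and y: "y \<in> Or x" shows "\<exists>q. y = orientation_of q x"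
proof -
  interpret wallspace "cl x" "W x" "wcol x" "lex_less A" by (rule wallspace_cl[OF x])
  obtain p where p: "p \<in> cl x" "finite (y - hat (W x) p)" using Y_fin[OF y] by blast
  obtain i where i: "p = g i x" using clE[OF p(1) x] by blast
  obtain l where l: "y - hat (W x) p = (\<lambda>h. wall_of h x) ` set l"
    using wall_of_list[OF x p(2)] Y_sub[OF y] by blast
  have "H \<in> y \<longleftrightarrow> H \<in> orientation_of (i, l) x" if H: "H \<in> W x" for H
  proof -
    have "(\<exists>h\<in>set l. H = wall_of h x \<or> H = cl x - wall_of h x) \<longleftrightarrow> H \<in> y - hat (W x) p \<or> cl x - H \<in> y - hat (W x) p"
      (is "?l \<longleftrightarrow> ?r")
    proof
      assume ?l
      then obtain h where h: "h \<in> set l" "H = wall_of h x \<or> H = cl x - wall_of h x" by blast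
      have m: "wall_of h x \<in> y - hat (W x) p" unfolding l using h(1) by blast
      then have "wall_of h x \<in> W x" using Y_sub[OF y] by blast
      then show ?r using h(2) m compl_compl by metis
    next
      assume ?r
      then obtain h where "h \<in> set l" "H = wall_of h x \<or> cl x - H = wall_of h x" unfolding l by blast
      moreover have "H = cl x - (cl x - H)" using compl_compl[OF H] by simp
      ultimately show ?l by metis
    qed
    moreover have "p \<in> cl x - H \<longleftrightarrow> p \<notin> H" using p by simp
    ultimately show ?thesis
      using H Y_compl[OF y H] W_compl[OF H] unfolding orientation_of_def hat_def i by auto
  qed
  moreover have "orientation_of (i, l) x \<subseteq> W x" by (auto simp: orientation_of_def)
  ultimately have "y = orientation_of (i, l) x" using Y_sub[OF y] by blast
  then show ?thesis by blast
qed

lemma pred_walls_eq: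
  assumes "meas_walls y" "meas_walls y'" shows "Measurable.pred M (\<lambda>x. y x = y' x)"
proof (rule pred_cong)
  show "Measurable.pred M (\<lambda>x. \<forall>H\<in>W x. H \<in> y x \<longleftrightarrow> H \<in> y' x)" (is "Measurable.pred M ?Q")
    by (intro pred_logic pred_W_all pred_wall_mem assms)
  show "y x = y' x \<longleftrightarrow> ?Q x" if "x \<in> space M" for x
    using assms[THEN meas_walls_sub, OF that] by blast
qed

lemma pred_meet:
  assumes S: "meas_set S" and S': "meas_set S'" shows "Measurable.pred M (\<lambda>x. S x \<inter> S' x = {})"
proof (rule pred_cong)
  show "Measurable.pred M (\<lambda>x. \<not> (\<exists>z\<in>cl x. z \<in> S x \<and> z \<in> S' x))" (is "Measurable.pred M ?Q")
    by (intro pred_logic pred_mem S S')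
  show "S x \<inter> S' x = {} \<longleftrightarrow> ?Q x" if "x \<in> space M" for x
    using meas_set_sub[OF S that] by blast
qed

text \<open>Finiteness is expressed by a finite list of codes that covers the set; there are only
  countably many lists.\<close>

lemma pred_finite_diff:
  assumes y: "meas_walls y" shows "Measurable.pred M (\<lambda>x. finite (y x - hat (W x) (g k x)))"
proof (rule pred_cong)
  fix x assume x: "x \<in> space M"
  show "finite (y x - hat (W x) (g k x)) \<longleftrightarrow>
     (\<exists>l. \<forall>H\<in>W x. H \<in> y x \<and> g k x \<notin> H \<longrightarrow> (\<exists>h\<in>set l. H = wall_of h x))"
  proof
    assume fin: "finite (y x - hat (W x) (g k x))"
    have "y x - hat (W x) (g k x) \<subseteq> W x" using meas_walls_sub[OF y x] by blast
    from wall_of_list[OF x fin this]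
    obtain l where l: "y x - hat (W x) (g k x) = (\<lambda>h. wall_of h x) ` set l" ..
    have "\<exists>h\<in>set l. H = wall_of h x" if "H \<in> W x" "H \<in> y x \<and> g k x \<notin> H" for H
    proof -
      have "H \<in> y x - hat (W x) (g k x)" using that by (simp add: hat_def)
      then show ?thesis unfolding l by blast
    qed
    then show "\<exists>l. \<forall>H\<in>W x. H \<in> y x \<and> g k x \<notin> H \<longrightarrow> (\<exists>h\<in>set l. H = wall_of h x)"
      by blast
  next
    assume "\<exists>l. \<forall>H\<in>W x. H \<in> y x \<and> g k x \<notin> H \<longrightarrow> (\<exists>h\<in>set l. H = wall_of h x)"
    then obtain l where "\<forall>H\<in>W x. H \<in> y x \<and> g k x \<notin> H \<longrightarrow> (\<exists>h\<in>set l. H = wall_of h x)" ..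
    then have "y x - hat (W x) (g k x) \<subseteq> (\<lambda>h. wall_of h x) ` set l"
      using meas_walls_sub[OF y x] by (auto simp: hat_def)
    then show "finite (y x - hat (W x) (g k x))" by (rule finite_subset) simp
  qed
next
  show "Measurable.pred M (\<lambda>x. \<exists>l. \<forall>H\<in>W x. H \<in> y x \<and> g k x \<notin> H \<longrightarrow> (\<exists>h\<in>set l. H = wall_of h x))"
    by (intro pred_logic pred_W_all pred_wall_mem pred_mem y pred_intros_finite pred_set_eq meas_set_wall_of finite_set)
qed

lemma pred_Or:
  assumes y: "meas_walls y" shows "Measurable.pred M (\<lambda>x. y x \<in> Or x)"
proof (rule pred_cong)
  show "Measurable.pred M (\<lambda>x. (\<forall>H\<in>W x. H \<in> y x \<longleftrightarrow> cl x - H \<notin> y x) \<and>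
     (\<forall>H\<in>W x. \<forall>K\<in>W x. H \<in> y x \<and> K \<in> y x \<longrightarrow> H \<inter> K \<noteq> {}) \<and>
     (\<exists>z\<in>cl x. finite (y x - hat (W x) z)))" (is "Measurable.pred M ?Q")
    by (intro pred_logic pred_W_all pred_wall_mem[OF y] pred_meet pred_finite_diff y meas_set_Diff)
  show "y x \<in> Or x \<longleftrightarrow> ?Q x" if "x \<in> space M" for x
    using meas_walls_sub[OF y that] by (simp add: orientations_def)
qed

lemma pred_Or_ex:
  assumes "\<And>y. meas_walls y \<Longrightarrow> Measurable.pred M (\<lambda>x. P x (y x))"
  shows "Measurable.pred M (\<lambda>x. \<exists>y\<in>Or x. P x y)"
proof (rule pred_cong)
  show "Measurable.pred M (\<lambda>x. \<exists>q. orientation_of q x \<in> Or x \<and> P x (orientation_of q x))" (is "Measurable.pred M ?Q")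
    by (intro pred_logic pred_Or assms meas_walls_orientation_of)
  show "(\<exists>y\<in>Or x. P x y) \<longleftrightarrow> ?Q x" if "x \<in> space M" for x
    using orientation_of_surj[OF that] by metis
qed

lemma pred_Or_all:
  assumes "\<And>y. meas_walls y \<Longrightarrow> Measurable.pred M (\<lambda>x. P x (y x))"
  shows "Measurable.pred M (\<lambda>x. \<forall>y\<in>Or x. P x y)"
proof (rule pred_cong)
  show "(\<forall>y\<in>Or x. P x y) \<longleftrightarrow> \<not> (\<exists>y\<in>Or x. \<not> P x y)" for x by blast
  show "Measurable.pred M (\<lambda>x. \<not> (\<exists>y\<in>Or x. \<not> P x y))"
    by (intro pred_logic pred_Or_ex assms)
qed

lemmas pred_objects = pred_logic pred_W_ex pred_W_all pred_Or_ex pred_Or_all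

lemma pred_crossing:
  assumes S: "meas_set S" and S': "meas_set S'"
  shows "Measurable.pred M (\<lambda>x. crossing (cl x) (S x) (S' x))"
proof (rule pred_cong)
  show "Measurable.pred M (\<lambda>x. (\<exists>z\<in>cl x. z \<in> S x \<and> z \<in> S' x) \<and> (\<exists>z\<in>cl x. z \<in> S x \<and> z \<notin> S' x) \<and>
     (\<exists>z\<in>cl x. z \<notin> S x \<and> z \<in> S' x) \<and> (\<exists>z\<in>cl x. z \<notin> S x \<and> z \<notin> S' x))" (is "Measurable.pred M ?Q")
    by (intro pred_logic pred_mem S S')
  show "crossing (cl x) (S x) (S' x) \<longleftrightarrow> ?Q x" if "x \<in> space M" for x
    using meas_set_sub[OF S that] meas_set_sub[OF S' that] unfolding crossing_def by blast
qed

lemma pred_hyperplane: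
  assumes S: "meas_set S" and K: "meas_set K"
  shows "Measurable.pred M (\<lambda>x. S x \<in> hyperplane (cl x) (W x) (K x))"
  unfolding hyperplane_def mem_Collect_eq
  by (intro pred_logic pred_wall pred_set_eq pred_crossing meas_set_Diff S K)

lemma pred_wall_conflict:
  assumes S: "meas_set S" and K: "meas_set K"
  shows "Measurable.pred M (\<lambda>x. wall_conflict (cl x) (W x) (S x) (K x))"
  unfolding wall_conflict_def
  by (intro pred_objects pred_set_eq pred_hyperplane S K)

lemma pred_point_code: "Measurable.pred M (\<lambda>x. point_code A n (g k x) = m)"
  unfolding point_code_def by (rule pred_set_encode_eq) simp

lemma pred_set_code:
  assumes S: "meas_set S"
  shows "Measurable.pred M (\<lambda>x. set_encode (point_code A n ` S x) = m)"
proof (rule pred_set_encode_eq, rule pred_cong)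
  show "j \<in> point_code A n ` S x \<longleftrightarrow> (\<exists>z\<in>cl x. z \<in> S x \<and> point_code A n z = j)" if "x \<in> space M" for x j
    using meas_set_sub[OF S that] by blast
  show "Measurable.pred M (\<lambda>x. \<exists>z\<in>cl x. z \<in> S x \<and> point_code A n z = j)" for j
    by (intro pred_logic pred_mem S pred_point_code)
qed

lemma measurable_boundary_pattern:
  assumes S: "meas_set S"
  shows "(\<lambda>x. boundary_pattern G (cl x) A n (S x)) \<in> measurable M (count_space UNIV)"
  unfolding boundary_pattern_def
  by (rule measurable_nat_fun2[where r = "\<lambda>a b. prod_encode (a, b)"])
    (intro measurable_nat_of_pred pred_set_code meas_set_inner_boundary meas_set_outer_boundary S)+

lemma measurable_wcol:
  assumes S: "meas_set S" shows "(\<lambda>x. wcol x (S x)) \<in> measurable M (count_space UNIV)"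
proof (rule measurable_nat_of_pred)
  define P where "P n x \<longleftrightarrow> (\<forall>L\<in>W x. wall_conflict (cl x) (W x) (S x) L \<longrightarrow>
      boundary_pattern G (cl x) A n L \<noteq> boundary_pattern G (cl x) A n (S x))" for n x
  have P: "Measurable.pred M (P n)" for n
    unfolding P_def
    by (intro pred_objects pred_wall_conflict S pred_nat_rel measurable_boundary_pattern)
  then have L: "(\<lambda>x. LEAST n. P n x) \<in> measurable M (count_space UNIV)" by (rule measurable_Least)
  have "wcol x (S x) = m \<longleftrightarrow> (\<exists>n. (LEAST n. P n x) = n \<and> prod_encode (n, boundary_pattern G (cl x) A n (S x)) = m)" for x m
    unfolding pattern_color_def Let_def P_def by simp
  moreover have "Measurable.pred M (\<lambda>x. \<exists>n. (LEAST n. P n x) = n \<and> prod_encode (n, boundary_pattern G (cl x) A n (S x)) = m)" for m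
    by (intro pred_logic pred_nat_rel[OF L] pred_nat_rel[OF measurable_boundary_pattern[OF S]]) simp_all
  ultimately show "Measurable.pred M (\<lambda>x. wcol x (S x) = m)" for m by simp
qed

lemma measurable_wall_color:
  assumes S: "meas_set S"
  shows "(\<lambda>x. wall_color (cl x) (wcol x) (S x)) \<in> measurable M (count_space UNIV)"
  unfolding wall_color_def
  by (rule measurable_nat_fun2[of _ _ _ min]) (intro measurable_wcol meas_set_Diff S)+

lemma pred_flip:
  assumes K: "meas_set K" and y: "meas_walls y" "meas_walls y'"
  shows "Measurable.pred M (\<lambda>x. flip (cl x) (W x) (K x) (y x) (y' x))"
  unfolding flip_def
  by (intro pred_objects pred_wall_mem y K meas_set_Diff pred_set_eq)

lemma measurable_flip_code:
  assumes K: "meas_set K" and y: "meas_walls y"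
  shows "(\<lambda>x. flip_code (cl x) (W x) (wcol x) (K x) (y x)) \<in> measurable M (count_space UNIV)"
  unfolding flip_code_def
proof (rule measurable_nat_of_pred, rule pred_set_encode_eq, rule pred_cong)
  show "j \<in> wcol x ` {L \<in> W x. L \<in> y x \<and> crossing (cl x) (K x) L} \<longleftrightarrow>
      (\<exists>L\<in>W x. L \<in> y x \<and> crossing (cl x) (K x) L \<and> wcol x L = j)" for x j by auto
  show "Measurable.pred M (\<lambda>x. \<exists>L\<in>W x. L \<in> y x \<and> crossing (cl x) (K x) L \<and> wcol x L = j)" for j
    by (intro pred_objects pred_wall_mem y K pred_crossing pred_nat_rel measurable_wcol) simp_all
qed

lemma pred_tree_edges:
  assumes y: "meas_walls y" "meas_walls y'"
  shows "Measurable.pred M (\<lambda>x. (y x, y' x) \<in> TE x)"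
  unfolding tree_edges_def mem_Collect_eq case_prod_conv
  by (intro pred_objects pred_Or pred_wall_mem pred_flip y pred_nat_rel measurable_flip_code measurable_wall_color)

text \<open>The intermediate vertices of a walk are orientations, so the quantifier over them is
  countable.\<close>

lemma pred_relpow:
  assumes R: "\<And>y y'. meas_walls y \<Longrightarrow> meas_walls y' \<Longrightarrow> Measurable.pred M (\<lambda>x. (y x, y' x) \<in> R x)"
    and sub: "\<And>x. R x \<subseteq> Or x \<times> Or x"
    and y: "meas_walls y" "meas_walls y'"
  shows "Measurable.pred M (\<lambda>x. (y x, y' x) \<in> R x ^^ n)"
  using y(2)
proof (induction n arbitrary: y')
  case 0
  show ?case using pred_walls_eq[OF y(1) 0] by simp
next
  case (Suc n)
  show ?case
  proof (rule pred_cong)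
    show "Measurable.pred M (\<lambda>x. \<exists>z\<in>Or x. (y x, z) \<in> R x ^^ n \<and> (z, y' x) \<in> R x)" (is "Measurable.pred M ?Q")
      by (intro pred_objects Suc.IH R Suc.prems)
    show "(y x, y' x) \<in> R x ^^ Suc n \<longleftrightarrow> ?Q x" for x
      using sub[of x] by auto
  qed
qed

lemma TE_sub: "TE x \<subseteq> Or x \<times> Or x"
  by (auto simp: tree_edges_def)

lemma pred_TE_hat:
  assumes "meas_walls y"
  shows "Measurable.pred M (\<lambda>x. (y x, hat (W x) (g k x)) \<in> TE x ^^ n)"
  by (rule pred_relpow[OF pred_tree_edges TE_sub assms meas_walls_hat])

lemma pred_nearest:
  assumes y: "meas_walls y"
  shows "Measurable.pred M (\<lambda>x. nearest (cl x) (W x) (wcol x) (y x) (g k x))"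
proof (rule pred_cong)
  show "Measurable.pred M (\<lambda>x. \<exists>n. (y x, hat (W x) (g k x)) \<in> TE x ^^ n \<and>
     (\<forall>x'\<in>cl x. \<forall>m. m < n \<longrightarrow> (y x, hat (W x) x') \<notin> TE x ^^ m))" (is "Measurable.pred M ?Q")
    by (intro pred_objects pred_TE_hat y) simp
  show "nearest (cl x) (W x) (wcol x) (y x) (g k x) \<longleftrightarrow> ?Q x" if "x \<in> space M" for x
    using g_cl[OF that] by (simp add: nearest_def)
qed

lemma measurable_wall_dist:
  assumes y: "meas_walls y"
  shows "(\<lambda>x. wall_dist (W x) (y x) (g k x)) \<in> measurable M (count_space UNIV)"
proof (rule measurable_nat_of_pred)
  fix m
  \<comment> \<open>\<open>l\<close> lists codes of the counted walls without repetition, so its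
    length is their number.\<close>
  define Q where "Q l x \<longleftrightarrow> (\<forall>i\<in>{..<length l}. \<forall>j\<in>{..<i}. wall_of (l ! i) x \<noteq> wall_of (l ! j) x) \<and>
    (\<forall>h\<in>set l. wall_of h x \<in> y x \<and> g k x \<notin> wall_of h x) \<and>
    (\<forall>H\<in>W x. H \<in> y x \<and> g k x \<notin> H \<longrightarrow> (\<exists>h\<in>set l. H = wall_of h x))" for l x
  have Q: "Measurable.pred M (Q l)" for l
  proof -
    have "Measurable.pred M (\<lambda>x. \<forall>i\<in>{..<length l}. \<forall>j\<in>{..<i}. wall_of (l ! i) x \<noteq> wall_of (l ! j) x)"
      by (intro pred_intros_finite pred_logic pred_set_eq meas_set_wall_of finite_lessThan)
    moreover have "Measurable.pred M (\<lambda>x. (\<forall>h\<in>set l. wall_of h x \<in> y x \<and> g k x \<notin> wall_of h x) \<and>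
      (\<forall>H\<in>W x. H \<in> y x \<and> g k x \<notin> H \<longrightarrow> (\<exists>h\<in>set l. H = wall_of h x)))"
      by (intro pred_objects pred_intros_finite pred_set_eq pred_wall_mem pred_mem y meas_set_wall_of finite_set)
    ultimately have "Measurable.pred M (\<lambda>x. (\<forall>i\<in>{..<length l}. \<forall>j\<in>{..<i}. wall_of (l ! i) x \<noteq> wall_of (l ! j) x) \<and>
      ((\<forall>h\<in>set l. wall_of h x \<in> y x \<and> g k x \<notin> wall_of h x) \<and>
      (\<forall>H\<in>W x. H \<in> y x \<and> g k x \<notin> H \<longrightarrow> (\<exists>h\<in>set l. H = wall_of h x))))"
      by (rule pred_intros_logic(3))
    then show ?thesis unfolding Q_def .
  qed
  show "Measurable.pred M (\<lambda>x. wall_dist (W x) (y x) (g k x) = m)"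
  proof (rule pred_cong)
    fix x assume x: "x \<in> space M"
    let ?D = "{H \<in> W x. H \<in> y x \<and> g k x \<notin> H}"
    have Qiff: "Q l x \<longleftrightarrow> distinct (map (\<lambda>h. wall_of h x) l) \<and> ?D = (\<lambda>h. wall_of h x) ` set l" for l
    proof -
      have d: "distinct (map (\<lambda>h. wall_of h x) l) \<longleftrightarrow>
          (\<forall>i\<in>{..<length l}. \<forall>j\<in>{..<i}. wall_of (l ! i) x \<noteq> wall_of (l ! j) x)"
        unfolding distinct_conv_nth
        by (simp add: Ball_def) (metis less_trans linorder_neq_iff)
      have img1: "(\<lambda>h. wall_of h x) ` set l \<subseteq> ?D \<longleftrightarrow> (\<forall>h\<in>set l. wall_of h x \<in> y x \<and> g k x \<notin> wall_of h x)"
        using subsetD[OF meas_walls_sub[OF y x]] by (auto simp: image_subset_iff)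
      have img2: "?D \<subseteq> (\<lambda>h. wall_of h x) ` set l \<longleftrightarrow>
          (\<forall>H\<in>W x. H \<in> y x \<and> g k x \<notin> H \<longrightarrow> (\<exists>h\<in>set l. H = wall_of h x))"
        by (simp only: subset_iff image_iff Ball_def mem_Collect_eq imp_conjL)
      show ?thesis unfolding Q_def d set_eq_subset img1 img2
        by (rule iffI; elim conjE; intro conjI; assumption)
    qed
    have card: "card ?D = length l" if "Q l x" for l
      using that unfolding Qiff by (metis distinct_card length_map set_map)
    have ex: "\<exists>l. Q l x" if fin_D: "finite ?D"
    proof -
      obtain ds where ds: "set ds = ?D" "distinct ds" using finite_distinct_list[OF fin_D] by blast
      have "\<forall>H\<in>set ds. \<exists>h. H = wall_of h x" using ds(1) wall_of_surj[OF x] by blast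
      then obtain f where f: "\<forall>H\<in>set ds. H = wall_of (f H) x" by metis
      then have "map (\<lambda>h. wall_of h x) (map f ds) = ds" by (simp add: map_idI)
      then have "Q (map f ds) x" unfolding Qiff using ds by (metis list.set_map)
      then show ?thesis ..
    qed
    have fin: "finite ?D" if "Q l x" for l using that unfolding Qiff by (metis finite_imageI finite_set)
    \<comment> \<open>\<open>y x\<close> need not be an orientation; if the counted set is infinite,
      \<open>card\<close> has the default value 0.\<close>
    show "wall_dist (W x) (y x) (g k x) = m \<longleftrightarrow>
      (\<exists>l. Q l x \<and> length l = m) \<or> (m = 0 \<and> \<not> (\<exists>l. Q l x))"
    proof (cases "finite ?D")
      case True
      then obtain l0 where "Q l0 x" using ex by blast
      then have "wall_dist (W x) (y x) (g k x) = length l0" "\<exists>l. Q l x"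
        unfolding wall_dist_def using card by blast+
      moreover have "length l = length l0" if "Q l x" for l
        using card[OF that] card[OF \<open>Q l0 x\<close>] by simp
      ultimately show ?thesis using \<open>Q l0 x\<close> by metis
    next
      case False
      then have "wall_dist (W x) (y x) (g k x) = 0" unfolding wall_dist_def by (rule card.infinite)
      moreover have "\<not> Q l x" for l using False fin by blast
      ultimately show ?thesis by auto
    qed
  next
    show "Measurable.pred M (\<lambda>x. (\<exists>l. Q l x \<and> length l = m) \<or> (m = 0 \<and> \<not> (\<exists>l. Q l x)))"
      by (intro pred_logic Q) simp_all
  qed
qed

lemma pred_lex_less: "Measurable.pred M (\<lambda>x. lex_less A (g i x) (g j x))"
  unfolding lex_less_def by measurable

lemma pred_best:
  assumes y: "meas_walls y"
  shows "Measurable.pred M (\<lambda>x. best (cl x) (W x) (wcol x) (lex_less A) (y x) (g k x))"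
  unfolding best_def
  by (intro pred_objects pred_nearest pred_nat_rel measurable_wall_dist pred_point_eq g_meas pred_lex_less y)

lemma pred_parent:
  assumes y: "meas_walls y" "meas_walls y'"
  shows "Measurable.pred M (\<lambda>x. (y x, y' x) \<in> PAR x)"
proof -
  have "Measurable.pred M (\<lambda>x. (y x, y' x) \<in> TE x \<and>
     (\<exists>z\<in>cl x. best (cl x) (W x) (wcol x) (lex_less A) (y x) z \<and> (\<exists>n. (y' x, hat (W x) z) \<in> TE x ^^ n \<and>
        (\<forall>m. m \<le> n \<longrightarrow> (y x, hat (W x) z) \<notin> TE x ^^ m))))"
    by (intro pred_objects pred_tree_edges pred_best pred_TE_hat y) simp
  then show ?thesis by (simp add: parent_def)
qed

lemma pred_root_of:
  assumes y: "meas_walls y"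
  shows "Measurable.pred M (\<lambda>x. root_of (cl x) (W x) (wcol x) (lex_less A) (y x) (g k x))"
proof (rule pred_cong)
  show "root_of (cl x) (W x) (wcol x) (lex_less A) (y x) (g k x) \<longleftrightarrow>
    best (cl x) (W x) (wcol x) (lex_less A) (hat (W x) (g k x)) (g k x) \<and>
    (\<exists>n. (y x, hat (W x) (g k x)) \<in> PAR x ^^ n)" if "x \<in> space M" for x
    using g_cl[OF that] by (simp add: root_of_def)
  have "PAR x \<subseteq> Or x \<times> Or x" for x using TE_sub by (auto simp: parent_def)
  then show "Measurable.pred M (\<lambda>x. best (cl x) (W x) (wcol x) (lex_less A) (hat (W x) (g k x)) (g k x) \<and>
    (\<exists>n. (y x, hat (W x) (g k x)) \<in> PAR x ^^ n))"
    by (intro pred_objects pred_best pred_relpow pred_parent meas_walls_hat y)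
qed

lemma pred_point_tree:
  "Measurable.pred M (\<lambda>x. (g i x, g j x) \<in> point_tree (cl x) (W x) (wcol x) (lex_less A))"
proof (rule pred_cong)
  let ?root = "\<lambda>x. root_of (cl x) (W x) (wcol x) (lex_less A)"
  show "Measurable.pred M (\<lambda>x. g i x \<noteq> g j x \<and>
     ((\<exists>y\<in>Or x. \<exists>y'\<in>Or x. (y, y') \<in> TE x \<and> ?root x y (g i x) \<and> ?root x y' (g j x)) \<or>
      ?root x (hat (W x) (g i x)) (g j x) \<or> ?root x (hat (W x) (g j x)) (g i x)))" (is "Measurable.pred M ?Q")
    by (intro pred_objects pred_point_eq g_meas pred_tree_edges pred_root_of meas_walls_hat)
  show "(g i x, g j x) \<in> point_tree (cl x) (W x) (wcol x) (lex_less A) \<longleftrightarrow> ?Q x" if "x \<in> space M" for x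
    using g_cl[OF that] by (simp add: point_tree_def)
qed

section \<open>The treeing of the equivalence relation\<close>

definition treeing :: "('a \<times> 'a) set" where
  "treeing = {(x, y). x \<in> space M \<and> (x, y) \<in> point_tree (cl x) (W x) (wcol x) (lex_less A)}"

lemma treeing_sets: "treeing \<in> sets (M \<Otimes>\<^sub>M M)"
proof -
  let ?PT = "\<lambda>x. point_tree (cl x) (W x) (wcol x) (lex_less A)"
  have "Measurable.pred M (\<lambda>x. (x, g j x) \<in> ?PT x)" for j
  \<comment> \<open>\<open>pred_point_tree\<close> speaks of enumerated points only, and the index
    of \<open>x\<close> in its own enumeration may vary with \<open>x\<close>.\<close>
  proof (rule pred_cong)
    show "Measurable.pred M (\<lambda>x. \<exists>i. g i x = x \<and> (g i x, g j x) \<in> ?PT x)" (is "Measurable.pred M ?Q")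
      by (intro pred_logic pred_point_eq g_meas measurable_ident_sets refl pred_point_tree)
    show "(x, g j x) \<in> ?PT x \<longleftrightarrow> ?Q x" if "x \<in> space M" for x
      using clE[OF cl_self[OF that] that] by metis
  qed
  then have [measurable]: "Measurable.pred (M \<Otimes>\<^sub>M M) (\<lambda>p. (fst p, g j (fst p)) \<in> ?PT (fst p))" for j
    by (rule measurable_compose[OF measurable_fst])
  \<comment> \<open>On the product, equality of the second coordinate with \<open>g j\<close> of the
    first is tested by the separating family.\<close>
  have eq: "Measurable.pred (M \<Otimes>\<^sub>M M) (\<lambda>p. \<forall>n. snd p \<in> A n \<longleftrightarrow> g j (fst p) \<in> A n)" for j
    by measurable
  have "Measurable.pred (M \<Otimes>\<^sub>M M)
      (\<lambda>p. \<exists>j. (\<forall>n. snd p \<in> A n \<longleftrightarrow> g j (fst p) \<in> A n) \<and> (fst p, g j (fst p)) \<in> ?PT (fst p))"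
    using eq by measurable
  then have "{p \<in> space (M \<Otimes>\<^sub>M M). \<exists>j. (\<forall>n. snd p \<in> A n \<longleftrightarrow> g j (fst p) \<in> A n) \<and>
      (fst p, g j (fst p)) \<in> ?PT (fst p)} \<in> sets (M \<Otimes>\<^sub>M M)" by (rule predE)
  also have "{p \<in> space (M \<Otimes>\<^sub>M M). \<exists>j. (\<forall>n. snd p \<in> A n \<longleftrightarrow> g j (fst p) \<in> A n) \<and>
      (fst p, g j (fst p)) \<in> ?PT (fst p)} = treeing"
  proof (intro equalityI subsetI)
    fix p assume p: "p \<in> {p \<in> space (M \<Otimes>\<^sub>M M). \<exists>j. (\<forall>n. snd p \<in> A n \<longleftrightarrow> g j (fst p) \<in> A n) \<and>
      (fst p, g j (fst p)) \<in> ?PT (fst p)}"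
    obtain x y where xy: "p = (x, y)" by fastforce
    have sp: "x \<in> space M" "y \<in> space M" using p by (auto simp: space_pair_measure xy)
    obtain j where j: "\<forall>n. y \<in> A n \<longleftrightarrow> g j x \<in> A n" "(x, g j x) \<in> ?PT x"
      using p unfolding xy mem_Collect_eq fst_conv snd_conv by (elim conjE exE)
    have "y = g j x" using A_sep[OF sp(2) measurable_space[OF g_meas sp(1)]] j(1) by blast
    then show "p \<in> treeing" using j(2) sp(1) by (simp add: treeing_def xy)
  next
    fix p assume "p \<in> treeing"
    then obtain x y where p: "p = (x, y)" "x \<in> space M" "(x, y) \<in> ?PT x" by (auto simp: treeing_def)
    have y: "y \<in> cl x" using p(3) by (simp add: point_tree_def)
    obtain j where "y = g j x" using clE[OF y p(2)] by blast
    then show "p \<in> {p \<in> space (M \<Otimes>\<^sub>M M). \<exists>j. (\<forall>n. snd p \<in> A n \<longleftrightarrow> g j (fst p) \<in> A n) \<and>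
      (fst p, g j (fst p)) \<in> ?PT (fst p)}"
      using p y cl_sub[OF p(2)] by (auto simp: space_pair_measure)
  qed
  finally show ?thesis .
qed

text \<open>\<open>cl\<close> is constant on a class, so there \<open>treeing\<close> coincides with
  the tree built from any of its points. Walks and cycles stay in one class, which reduces
  everything to the wallspace of that class.\<close>

theorem borel_treeable_E: "borel_treeable M E"
proof -
  let ?PT = "\<lambda>x. point_tree (cl x) (W x) (wcol x) (lex_less A)"
  have tree: "(y, z) \<in> treeing \<longleftrightarrow> (y, z) \<in> ?PT x" if x: "x \<in> space M" "y \<in> cl x" for x y z
    using cl_eq[OF x] cl_sub[OF x(1)] x(2) by (auto simp: treeing_def)
  have self: "(x, y) \<in> treeing \<longleftrightarrow> x \<in> space M \<and> (x, y) \<in> ?PT x" for x y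
    by (simp add: treeing_def)
  have stay: "y \<in> cl x" if "(x, y) \<in> treeing" for x y
    using that by (simp add: treeing_def point_tree_def)
  have star: "y \<in> cl x" if "(x, y) \<in> treeing\<^sup>*" "x \<in> space M" for x y
    using that(1)
  proof (induction rule: rtrancl_induct)
    case base
    then show ?case using cl_self[OF that(2)] .
  next
    case (step y z)
    then show ?case using stay[OF step.hyps(2)] cl_eq[OF that(2) step.IH] by simp
  qed
  have "sym treeing"
  proof (rule symI)
    fix x y assume xy: "(x, y) \<in> treeing"
    then have x: "x \<in> space M" by (simp add: treeing_def)
    interpret wallspace "cl x" "W x" "wcol x" "lex_less A" by (rule wallspace_cl[OF x])
    have "(y, x) \<in> ?PT x" using xy sym_PT self by (auto dest: symD)
    then show "(y, x) \<in> treeing" using tree[OF x stay[OF xy]] by blast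
  qed
  moreover have "irrefl treeing" by (auto simp: irrefl_def treeing_def point_tree_def)
  moreover have "Restr (treeing\<^sup>*) (space M) = E"
  proof (intro equalityI subsetI)
    fix p assume "p \<in> Restr (treeing\<^sup>*) (space M)"
    then show "p \<in> E" using star by auto
  next
    fix p assume p: "p \<in> E"
    obtain x y where xy: "p = (x, y)" by fastforce
    have x: "x \<in> space M" "y \<in> space M" using sets.sets_into_space[OF E_sets] p xy by (auto simp: space_pair_measure)
    interpret wallspace "cl x" "W x" "wcol x" "lex_less A" by (rule wallspace_cl[OF x(1)])
    have "?PT x \<subseteq> treeing" using PT_sub tree[OF x(1)] by blast
    moreover have "(x, y) \<in> (?PT x)\<^sup>*" using p xy by (intro PT_connected cl_self x(1)) simp
    ultimately show "p \<in> Restr (treeing\<^sup>*) (space M)" using rtrancl_mono xy x by blast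
  qed
  ultimately have "borel_graphing M E treeing" by (simp add: borel_graphing_def treeing_sets)
  moreover have "acyclic_graph treeing"
    unfolding acyclic_graph_def
  proof
    assume "\<exists>xs. graph_cycle treeing xs"
    then obtain xs where xs: "graph_cycle treeing xs" ..
    define x where "x = xs ! 0"
    have len: "length xs \<ge> 3" and e: "\<And>i. i < length xs \<Longrightarrow> (xs ! i, xs ! (Suc i mod length xs)) \<in> treeing"
      using xs by (auto simp: graph_cycle_def)
    have "0 < length xs" using len by linarith
    from e[OF this] have x: "x \<in> space M" by (simp add: x_def treeing_def)
    interpret wallspace "cl x" "W x" "wcol x" "lex_less A" by (rule wallspace_cl[OF x])
    have "xs ! i \<in> cl x" if "i < length xs" for i
      using that
    proof (induction i)
      case 0
      then show ?case using cl_self[OF x] by (simp add: x_def)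
    next
      case (Suc i)
      then have IH: "xs ! i \<in> cl x" and "(xs ! i, xs ! Suc i) \<in> treeing" using e[of i] by auto
      then show ?case using stay cl_eq[OF x IH] by blast
    qed
    then have "graph_cycle (?PT x) xs"
      using xs tree[OF x] unfolding graph_cycle_def by auto
    then show False using acyclic_PT unfolding acyclic_graph_def by blast
  qed
  ultimately show ?thesis unfolding borel_treeable_def by blast
qed

end

theorem theorem1p5:
  fixes M :: "'a measure"
    and E G :: "('a \<times> 'a) set"
    and \<H> :: "'a set \<Rightarrow> 'a set set"
  assumes "standard_borel M"
    and "countable_borel_equivalence M E"
    and "borel_graphing M E G"
    and "locally_finite_graph (space M) G"
    and "borel_assignment M E G \<H>"
    and "\<And>C H. C \<in> space M // E \<Longrightarrow> H \<in> \<H> C \<Longrightarrow>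
           H \<subseteq> C \<and> finite (vertex_boundary G C H) \<and>
           connected_set G H \<and> connected_set G (C - H)"
    and "\<And>C x. C \<in> space M // E \<Longrightarrow> x \<in> C \<Longrightarrow>
           finite {H \<in> \<H> C. x \<in> vertex_boundary G C H}"
    and "\<And>C U A. C \<in> space M // E \<Longrightarrow> graph_end G C U \<Longrightarrow> A \<in> U \<Longrightarrow>
           \<exists>H \<in> \<H> C. H \<in> U \<and> H \<subseteq> A"
  shows "borel_treeable M E"
proof -
  obtain A :: "nat \<Rightarrow> 'a set" where A: "\<And>n. A n \<in> sets M"
    "\<And>x y. x \<in> space M \<Longrightarrow> y \<in> space M \<Longrightarrow> x \<noteq> y \<Longrightarrow> \<exists>n. (x \<in> A n) \<noteq> (y \<in> A n)"
    by (rule standard_borel_separating[OF assms(1)]) blast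
  obtain g :: "nat \<Rightarrow> 'a \<Rightarrow> 'a" where g: "\<And>n. g n \<in> measurable M M"
    "\<And>x. x \<in> space M \<Longrightarrow> E `` {x} = range (\<lambda>n. g n x)"
    by (rule class_enumeration[OF assms(1-4)]) blast
  have "wall_cber M E G \<H> A g"
    using assms(2-8) A g by (rule wall_cber.intro)
  then show ?thesis by (rule wall_cber.borel_treeable_E)
qed

end
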